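(* Suppose that: (a) $p(x,\cdot)$, $x\in\mathbb{Z}$, is a strictly stationary ergodic sequence of random vectors; (b) there is an $\varepsilon>0$ such that $p(1)\ge\varepsilon$ and $p(-1)\ge\varepsilon$ for any $p(\cdot)\in\tilde{\mathcal{J}}_0$; (c) $\tilde{\mathcal{J}}_0\subset\tilde{\mathcal{J}}_{al}$, that is, $\sum_{j=-m}^m j\,p(j)=0$ for any $p(\cdot)\in\tilde{\mathcal{J}}_0$. Then: (i) The random walk $\xi(\cdot)$ is asymptotically normal in every environment $\omega=(p(x,\cdot))_{x\in\mathbb{Z}}$ with all $p(x,\cdot)\in\tilde{\mathcal{J}}_0$, in the sense that, under $Pr_\omega$, $t^{-1/2}\xi(T_t)$ converges weakly to a standard normal random variable as $t\to\infty$. (ii) There is a $\sigma>0$ such that for $\mathbb{P}$-a.e. $\omega$ $$\lim_{t\to\infty}Pr_\omega\left\{\frac{\xi(t)}{\sqrt t}\le x\right\}=\frac{1}{\sqrt{2\pi}\,\sigma}\int_{-\infty}^x e^{-\frac{u^2}{2\sigma^2}}\,du$$ for every real $x$, and the convergence is uniform in $x$.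
   Context: Fix an integer $m>1$. $\tilde{\mathcal{J}}$ is the set of all $(2m+1)$-dimensional probability vectors $(p(j))_{-m\le j\le m}$, $p(\cdot)\ge0$, $\sum_{j=-m}^m p(j)=1$. An environment is a random sequence $\omega=(p(x,\cdot))_{x\in\mathbb{Z}}$ with $p(x,\cdot)\in\tilde{\mathcal{J}}$; its law is $\mathbb{P}$. It is assumed that $\mathbb{P}\{p(x,m)>0\}>0$ or $\mathbb{P}\{p(x,-m)>0\}>0$. For fixed $\omega$, the one-dimensional random walk with bounded jumps $\xi(t)$, $t=0,1,2,\dots$, on $\mathbb{Z}$ is the Markov chain with $\xi(0)=0$ and $Pr_\omega(\xi(t+1)=n+k\mid\xi(t)=n)=p(n,k)$ for $n\in\mathbb{Z}$, $-m\le k\le m$; $Pr_\omega$ denotes its law. $\tilde{\mathcal{J}}_0\subset\tilde{\mathcal{J}}$ is the support of the distribution of $p(0,\cdot)$, and $\tilde{\mathcal{J}}_{al}=\{p(\cdot)\in\tilde{\mathcal{J}}:\sum_{j=-m}^m j\,p(j)=0\}$. Put $\sigma_n^2=\sum_{j=-m}^m j^2\,p(\xi(n-1),j)$, $V_n^2=\sum_{j=1}^n\sigma_j^2$ for $n\ge 1$, and $T_t=\inf\{n: V_n^2\ge t\}$. *)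

theory Defs
  imports "HOL-Probability.Probability"
begin

section \<open>Environments\<close>

text \<open>
  A vector \<open>(p(j))\<close>, \<open>-m \<le> j \<le> m\<close>, is represented by a function on all of \<open>int\<close> that vanishes
  outside \<open>{-m..m}\<close>; the product topology on \<open>int \<Rightarrow> real\<close> induces the Euclidean one on these
  functions.
\<close>

definition prob_vectors :: "int \<Rightarrow> (int \<Rightarrow> real) set" where
  "prob_vectors m =
     {p. (\<forall>j. 0 \<le> p j) \<and> (\<forall>j. j \<notin> {-m..m} \<longrightarrow> p j = 0) \<and> (\<Sum>j=-m..m. p j) = 1}"

type_synonym env = "int \<Rightarrow> int \<Rightarrow> real"

definition env_space :: "int \<Rightarrow> env measure" where
  "env_space m = (\<Pi>\<^sub>M x\<in>UNIV. restrict_space borel (prob_vectors m))"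

lemma space_env_space: "space (env_space m) = {\<omega>. \<forall>x. \<omega> x \<in> prob_vectors m}"
  by (auto simp: env_space_def space_PiM PiE_def space_restrict_space)

definition env_law :: "int \<Rightarrow> env measure \<Rightarrow> bool" where
  "env_law m P \<longleftrightarrow> prob_space P \<and> sets P = sets (env_space m)"

definition shift :: "int \<Rightarrow> env \<Rightarrow> env" where
  "shift k \<omega> = (\<lambda>x. \<omega> (x + k))"

definition strictly_stationary :: "env measure \<Rightarrow> bool" where
  "strictly_stationary P \<longleftrightarrow> (\<forall>k. distr P P (shift k) = P)"

definition ergodic :: "env measure \<Rightarrow> bool" where
  "ergodic P \<longleftrightarrow>
     (\<forall>A\<in>sets P. shift 1 -` A \<inter> space P = A \<longrightarrow> measure P A = 0 \<or> measure P A = 1)"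

definition measure_support :: "'a::topological_space measure \<Rightarrow> 'a set" where
  "measure_support M = {x. \<forall>U. open U \<longrightarrow> x \<in> U \<longrightarrow> 0 < emeasure M U}"

definition vector_support :: "env measure \<Rightarrow> (int \<Rightarrow> real) set" where
  "vector_support P = measure_support (distr P borel (\<lambda>\<omega>. \<omega> 0))"

lemma closed_prob_vectors: "closed (prob_vectors m)"
proof -
  have *: "prob_vectors m = (\<Inter>j. {p. 0 \<le> p j}) \<inter> (\<Inter>j\<in>-{-m..m}. {p. p j = 0})
      \<inter> {p. (\<Sum>j=-m..m. p j) = 1}"
    unfolding prob_vectors_def by blast
  show ?thesis
    unfolding *
    by (intro closed_Int closed_INT ballI closed_Collect_le closed_Collect_eq
          continuous_intros continuous_on_sum continuous_on_product_coordinates)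
qed

lemma shift_measurable: "shift k \<in> measurable (env_space m) (env_space m)"
  unfolding env_space_def shift_def
  by (intro measurable_PiM_single') (auto simp: space_PiM PiE_def)

lemma env_coordinate_measurable:
  assumes "env_law m P"
  shows "(\<lambda>\<omega>. \<omega> x) \<in> measurable P borel"
proof -
  have "(\<lambda>\<omega>. \<omega> x) \<in> measurable (env_space m) (restrict_space borel (prob_vectors m))"
    unfolding env_space_def by (rule measurable_component_singleton) simp
  then have "(\<lambda>\<omega>. \<omega> x) \<in> measurable (env_space m) borel"
    by (simp add: measurable_restrict_space2_iff)
  then show ?thesis
    using assms by (simp add: env_law_def cong: measurable_cong_sets)
qed

lemma vector_support_subset:
  assumes "env_law m P"
  shows "vector_support P \<subseteq> prob_vectors m"
proof
  fix v assume v: "v \<in> vector_support P"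
  show "v \<in> prob_vectors m"
  proof (rule ccontr)
    assume "v \<notin> prob_vectors m"
    with v closed_prob_vectors[of m]
    have "0 < emeasure (distr P borel (\<lambda>\<omega>. \<omega> 0)) (- prob_vectors m)"
      unfolding vector_support_def measure_support_def by (auto simp: open_Compl)
    also have "\<dots> = emeasure P ((\<lambda>\<omega>. \<omega> 0) -` (- prob_vectors m) \<inter> space P)"
      by (rule emeasure_distr)
         (use assms closed_prob_vectors[of m] in \<open>auto intro: env_coordinate_measurable\<close>)
    also have "space P = space (env_space m)"
      using assms by (auto simp: env_law_def dest: sets_eq_imp_space_eq)
    also have "(\<lambda>\<omega>. \<omega> 0) -` (- prob_vectors m) \<inter> \<dots> = {}"
      by (auto simp: space_env_space)
    finally show False by simp
  qed
qed

section \<open>The walk in a fixed environment\<close>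

abbreviation path_space :: "(nat \<Rightarrow> int) measure" where
  "path_space \<equiv> (\<Pi>\<^sub>M t\<in>UNIV. count_space UNIV)"

text \<open>
  The transition probabilities are conditioned on the whole past \<open>\<xi>(0), \<dots>, \<xi>(t)\<close> and written
  multiplicatively, so that pasts of probability \<open>0\<close> need no separate treatment.
\<close>

definition is_walk_law :: "env \<Rightarrow> (nat \<Rightarrow> int) measure \<Rightarrow> bool" where
  "is_walk_law \<omega> Q \<longleftrightarrow>
     prob_space Q \<and> sets Q = sets path_space \<and>
     measure Q {\<xi> \<in> space Q. \<xi> 0 = 0} = 1 \<and>
     (\<forall>t a k. measure Q {\<xi> \<in> space Q. (\<forall>s\<le>t. \<xi> s = a s) \<and> \<xi> (Suc t) = a t + k}
        = measure Q {\<xi> \<in> space Q. \<forall>s\<le>t. \<xi> s = a s} * \<omega> (a t) k)"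

definition walk_law :: "env \<Rightarrow> (nat \<Rightarrow> int) measure" where
  "walk_law \<omega> = (THE Q. is_walk_law \<omega> Q)"

definition step_var :: "int \<Rightarrow> env \<Rightarrow> (nat \<Rightarrow> int) \<Rightarrow> nat \<Rightarrow> real" where
  "step_var m \<omega> \<xi> n = (\<Sum>j=-m..m. (real_of_int j)\<^sup>2 * \<omega> (\<xi> (n - 1)) j)"

definition total_var :: "int \<Rightarrow> env \<Rightarrow> (nat \<Rightarrow> int) \<Rightarrow> nat \<Rightarrow> real" where
  "total_var m \<omega> \<xi> n = (\<Sum>k=1..n. step_var m \<omega> \<xi> k)"

text \<open>
  If \<open>\<omega> x 1 \<ge> \<epsilon>\<close> for all \<open>x\<close>, then \<open>total_var m \<omega> \<xi> n \<ge> \<epsilon> * n\<close> along every path, so the infimum is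
  over a nonempty set.
\<close>

definition var_time :: "int \<Rightarrow> env \<Rightarrow> (nat \<Rightarrow> int) \<Rightarrow> real \<Rightarrow> nat" where
  "var_time m \<omega> \<xi> t = Inf {n. 1 \<le> n \<and> t \<le> total_var m \<omega> \<xi> n}"

lemma walk_at_var_time_measurable:
  "(\<lambda>\<xi>. \<xi> (var_time m \<omega> \<xi> t)) \<in> measurable path_space (count_space UNIV)"
proof -
  have [measurable]: "(\<lambda>\<xi>. \<xi> n) \<in> measurable path_space (count_space UNIV)" for n
    by (rule measurable_component_singleton) simp
  have [measurable]: "(\<lambda>\<xi>. \<omega> (\<xi> n) j) \<in> borel_measurable path_space" for n j
    by (rule measurable_compose[where N="count_space UNIV"]) auto
  have [measurable]: "(\<lambda>\<xi>. total_var m \<omega> \<xi> n) \<in> borel_measurable path_space" for n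
    unfolding total_var_def step_var_def by measurable
  have "(\<lambda>\<xi>. LEAST n. 1 \<le> n \<and> t \<le> total_var m \<omega> \<xi> n) \<in> measurable path_space (count_space UNIV)"
    by measurable
  then have [measurable]: "(\<lambda>\<xi>. var_time m \<omega> \<xi> t) \<in> measurable path_space (count_space UNIV)"
    by (simp add: var_time_def Inf_nat_def)
  show ?thesis
    by (rule measurable_compose_countable) measurable
qed

section \<open>Weak convergence along a real parameter\<close>

text \<open>\<^const>\<open>weak_conv_m\<close> with a real parameter tending to infinity in place of a sequence index.\<close>

definition weak_conv_at_top :: "(real \<Rightarrow> real measure) \<Rightarrow> real measure \<Rightarrow> bool" where
  "weak_conv_at_top N M \<longleftrightarrow>
     (\<forall>x. isCont (cdf M) x \<longrightarrow> ((\<lambda>t. cdf (N t) x) \<longlongrightarrow> cdf M x) at_top)"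

lemma weak_conv_at_top_iff:
  "weak_conv_at_top N M \<longleftrightarrow>
     (\<forall>\<tau>. filterlim \<tau> at_top sequentially \<longrightarrow> weak_conv_m (\<lambda>n. N (\<tau> n)) M)"
  unfolding weak_conv_at_top_def weak_conv_m_def weak_conv_def
  by (auto intro: filterlim_compose tendsto_at_topI_sequentially)

section \<open>Existence and uniqueness of the walk\<close>

lemma sets_path_prefix:
  "{\<xi>. \<forall>s\<le>t. \<xi> s = a s} \<in> sets path_space" (is "?A \<in> _")
proof -
  have "?A = {\<xi> \<in> space path_space. \<forall>s\<in>{..t}. \<xi> s = a s}"
    by (auto simp: space_PiM)
  also have "\<dots> \<in> sets path_space"
    by measurable
  finally show ?thesis .
qed

lemma space_walk_law: "is_walk_law \<omega> Q \<Longrightarrow> space Q = UNIV"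
  by (auto simp: is_walk_law_def space_PiM dest!: sets_eq_imp_space_eq)

lemma is_walk_law_prefix:
  assumes "is_walk_law \<omega> Q"
  shows "measure Q {\<xi>. \<forall>s\<le>t. \<xi> s = a s} =
    (if a 0 = 0 then \<Prod>s<t. \<omega> (a s) (a (Suc s) - a s) else 0)"
proof (induction t)
  case 0
  have sp: "space Q = UNIV" by (rule space_walk_law[OF assms])
  interpret prob_space Q using assms by (simp add: is_walk_law_def)
  have S: "{\<xi>. \<xi> 0 = c} \<in> sets Q" for c
    using sets_path_prefix[of 0 "\<lambda>_. c"] assms by (simp add: is_walk_law_def)
  have one: "prob {\<xi>. \<xi> 0 = 0} = 1"
    using assms sp by (simp add: is_walk_law_def)
  show ?case
  proof (cases "a 0 = 0")
    case False
    have "prob {\<xi>. \<xi> 0 = a 0} \<le> prob (space Q - {\<xi>. \<xi> 0 = 0})"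
      by (rule finite_measure_mono) (use False sets.compl_sets[OF S[of 0]] sp in auto)
    also have "\<dots> = 0" using prob_compl[OF S[of 0]] one by simp
    finally show ?thesis using False by (simp add: measure_le_0_iff)
  qed (simp add: one)
next
  case (Suc t)
  have *: "{\<xi>. \<forall>s\<le>Suc t. \<xi> s = a s} =
      {\<xi> \<in> space Q. (\<forall>s\<le>t. \<xi> s = a s) \<and> \<xi> (Suc t) = a t + (a (Suc t) - a t)}"
    by (auto simp: space_walk_law[OF assms] le_Suc_eq)
  have "measure Q {\<xi> \<in> space Q. (\<forall>s\<le>t. \<xi> s = a s) \<and> \<xi> (Suc t) = a t + (a (Suc t) - a t)} =
      measure Q {\<xi> \<in> space Q. \<forall>s\<le>t. \<xi> s = a s} * \<omega> (a t) (a (Suc t) - a t)"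
    using assms unfolding is_walk_law_def by blast
  then show ?case
    unfolding * by (simp add: space_walk_law[OF assms] Suc)
qed

lemma is_walk_law_unique:
  assumes "is_walk_law \<omega> Q" "is_walk_law \<omega> Q'"
  shows "Q = Q'"
proof (rule measure_eqI_PiM_infinite)
  interpret Q: prob_space Q using assms(1) by (simp add: is_walk_law_def)
  interpret Q': prob_space Q' using assms(2) by (simp add: is_walk_law_def)
  show s1: "sets Q = sets path_space" and s2: "sets Q' = sets path_space"
    using assms by (auto simp: is_walk_law_def)
  show "finite_measure Q" by unfold_locales
  fix F :: "nat \<Rightarrow> int set" and J :: "nat set"
  assume J: "finite J"
  define n where "n = Max (insert 0 J)"
  have nJ: "j \<le> n" if "j \<in> J" for j using that J by (auto simp: n_def)
  define f where "f = (\<lambda>\<xi>::nat \<Rightarrow> int. map \<xi> [0..<Suc n])"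
  have pre: "f -` {l} = (if length l = Suc n then {\<xi>. \<forall>s\<le>n. \<xi> s = l ! s} else {})" for l
  proof -
    have "f \<xi> = l \<longleftrightarrow> length l = Suc n \<and> (\<forall>s<Suc n. \<xi> s = l ! s)" for \<xi>
      unfolding f_def by (subst list_eq_iff_nth_eq) (auto simp del: upt_Suc)
    then show ?thesis by (auto simp: less_Suc_eq_le)
  qed
  have fm: "f \<in> measurable path_space (count_space UNIV)"
    by (subst measurable_count_space_eq2_countable) (auto simp: pre space_PiM sets_path_prefix)
  have fQ: "f \<in> measurable Q (count_space UNIV)" "f \<in> measurable Q' (count_space UNIV)"
    using fm s1 s2 by (simp_all cong: measurable_cong_sets)
  have "distr Q (count_space UNIV) f = distr Q' (count_space UNIV) f"
  proof (rule measure_eqI_countable[where A=UNIV])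
    fix l :: "int list"
    have "emeasure Q (f -` {l}) = emeasure Q' (f -` {l})"
      by (simp add: pre Q.emeasure_eq_measure Q'.emeasure_eq_measure
          is_walk_law_prefix[OF assms(1)] is_walk_law_prefix[OF assms(2)])
    then show "emeasure (distr Q (count_space UNIV) f) {l} =
        emeasure (distr Q' (count_space UNIV) f) {l}"
      using fQ by (simp add: emeasure_distr space_walk_law[OF assms(1)] space_walk_law[OF assms(2)])
  qed auto
  then have "emeasure (distr Q (count_space UNIV) f) {l. \<forall>j\<in>J. l ! j \<in> F j} =
      emeasure (distr Q' (count_space UNIV) f) {l. \<forall>j\<in>J. l ! j \<in> F j}"
    by simp
  then have "emeasure Q (f -` {l. \<forall>j\<in>J. l ! j \<in> F j}) = emeasure Q' (f -` {l. \<forall>j\<in>J. l ! j \<in> F j})"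
    using fQ by (simp add: emeasure_distr space_walk_law[OF assms(1)] space_walk_law[OF assms(2)])
  moreover have "f -` {l. \<forall>j\<in>J. l ! j \<in> F j} = prod_emb UNIV (\<lambda>_. count_space UNIV) J (Pi\<^sub>E J F)"
    using nJ by (auto simp: f_def prod_emb_def PiE_iff less_Suc_eq_le simp del: upt_Suc)
  ultimately show "emeasure Q (prod_emb UNIV (\<lambda>_. count_space UNIV) J (Pi\<^sub>E J F)) =
      emeasure Q' (prod_emb UNIV (\<lambda>_. count_space UNIV) J (Pi\<^sub>E J F))"
    by simp
qed

lemma is_walk_law_exists:
  assumes "\<forall>x. \<omega> x \<in> prob_vectors m"
  shows "\<exists>Q. is_walk_law \<omega> Q"
proof -
  define step where "step = (\<lambda>x. embed_pmf (\<lambda>y. \<omega> x (y - x)))"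
  have pstep: "pmf (step x) y = \<omega> x (y - x)" for x y
    unfolding step_def
  proof (rule pmf_embed_pmf)
    have w: "\<And>j. 0 \<le> \<omega> x j" "\<And>j. j \<notin> {-m..m} \<Longrightarrow> \<omega> x j = 0" "(\<Sum>j=-m..m. \<omega> x j) = 1"
      using assms by (auto simp: prob_vectors_def)
    show "0 \<le> \<omega> x (y - x)" for y by (rule w)
    have "(\<integral>\<^sup>+y. ennreal (\<omega> x (y - x)) \<partial>count_space UNIV)
        = (\<integral>\<^sup>+j. ennreal (\<omega> x j) \<partial>count_space UNIV)"
      by (rule nn_integral_bij_count_space[where g="\<lambda>y. y - x" and f="\<lambda>j. ennreal (\<omega> x j)"])
         (auto intro!: bij_betwI[where g="\<lambda>j. j + x"])
    also have "\<dots> = (\<Sum>j=-m..m. ennreal (\<omega> x j))"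
      by (rule nn_integral_count_space'[where A="{-m..m}"]) (use w in auto)
    also have "\<dots> = 1"
      by (simp add: sum_ennreal w)
    finally show "(\<integral>\<^sup>+y. ennreal (\<omega> x (y - x)) \<partial>count_space UNIV) = 1" .
  qed
  define kern where "kern = (\<lambda>t (h :: nat \<Rightarrow> int). if t = 0 then return_pmf 0 else step (h (t - 1)))"
  define K where "K = (\<lambda>t h. measure_pmf (kern t h))"
  define CS where "CS = (\<lambda>_::nat. count_space (UNIV :: int set))"
  interpret IT: Ionescu_Tulcea K CS
  proof (rule Ionescu_Tulcea.intro)
    fix i
    show "K i \<in> measurable (PiM {0..<i} CS) (subprob_algebra (CS i))"
    proof (cases i)
      case 0
      then show ?thesis
        by (simp add: K_def kern_def CS_def space_subprob_algebra measure_pmf.subprob_space_axioms)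
    next
      case (Suc k)
      have c: "(\<lambda>h. h k) \<in> measurable (PiM {0..<i} CS) (count_space UNIV)"
        using measurable_component_singleton[of k "{0..<i}" CS] Suc by (simp add: CS_def)
      have "(\<lambda>x. measure_pmf (step x)) \<in> measurable (count_space UNIV) (subprob_algebra (CS i))"
        by (simp add: CS_def space_subprob_algebra measure_pmf.subprob_space_axioms)
      from measurable_compose[OF c this] show ?thesis
        by (simp add: K_def kern_def Suc)
    qed
    fix x
    show "prob_space (K i x)"
      unfolding K_def by (rule prob_space_measure_pmf)
  qed
  define Q where "Q = IT.PF.lim"
  define c where "c = (\<lambda>a n. emeasure (IT.C 0 n (\<lambda>_. undefined)) {restrict a {0..<n}})"
  have u: "(\<lambda>_. undefined) \<in> space (PiM {0..<0} CS)"
    by (simp add: space_PiM)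
  have sing: "{restrict a {0..<n}} \<in> sets (PiM {0..<n} CS)" for a n
  proof -
    have "{restrict a {0..<n}} = Pi\<^sub>E {0..<n} (\<lambda>i. {a i})"
      by (auto simp: PiE_iff restrict_def extensional_def fun_eq_iff)
    then show ?thesis by (simp add: CS_def sets_PiM_I_finite)
  qed
  have cyl: "emeasure Q {\<xi>. \<forall>s<n. \<xi> s = a s} = c a n" for a n
  proof -
    have "{\<xi>. \<forall>s<n. \<xi> s = a s} = IT.PF.emb UNIV {0..<n} {restrict a {0..<n}}"
    proof -
      have "restrict \<xi> {0..<n} = restrict a {0..<n} \<longleftrightarrow> (\<forall>s\<in>{0..<n}. \<xi> s = a s)" for \<xi>
        by (metis restrict_apply' restrict_ext)
      then show ?thesis by (auto simp: prod_emb_def CS_def)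
    qed
    moreover have "IT.PF.emb {0..<n} {0..<n} {restrict a {0..<n}} = {restrict a {0..<n}}"
      by (rule prod_emb_id) (auto simp: CS_def)
    ultimately show ?thesis
      unfolding Q_def c_def
      using IT.lim[OF _ sing, of n a] IT.emeasure_CI[OF _ sing, of n n a] by simp
  qed
  have c0: "c a 0 = 1" for a
    using sing[of a 0] by (simp add: c_def restrict_def)
  have cS: "c a (Suc n) = c a n * pmf (kern n a) (a n)" for a n
  proof -
    let ?C = "IT.C 0 n (\<lambda>_. undefined)"
    have spC: "space ?C = space (PiM {0..<n} CS)" and seC: "sets ?C = sets (PiM {0..<n} CS)"
      using IT.space_C[OF u, of n] IT.sets_C[OF u, of n] by simp_all
    have eP: "emeasure (IT.eP n h) {restrict a {0..<Suc n}} =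
        ennreal (pmf (kern n a) (a n)) * indicator {restrict a {0..<n}} h"
      if h: "h \<in> space (PiM {0..<n} CS)" for h
    proof -
      have ex: "h i = undefined" if "\<not> i < n" for i
        using h that by (auto simp: space_PiM PiE_iff extensional_def)
      have "(\<lambda>x. h(n := x)) -` {restrict a {0..<Suc n}} \<inter> space (CS n)
          = (if h = restrict a {0..<n} then {a n} else {})"
      proof -
        have "h(n := x) = restrict a {0..<Suc n} \<longleftrightarrow> h = restrict a {0..<n} \<and> x = a n" for x
        proof
          assume eq: "h(n := x) = restrict a {0..<Suc n}"
          have "h i = restrict a {0..<n} i" for i
            using fun_cong[OF eq, of i] ex[of i] by (cases "i < n") auto
          then show "h = restrict a {0..<n} \<and> x = a n"
            using fun_cong[OF eq, of n] by auto
        next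
          assume "h = restrict a {0..<n} \<and> x = a n"
          then show "h(n := x) = restrict a {0..<Suc n}"
            by (auto simp: restrict_def less_Suc_eq)
        qed
        then show ?thesis by (auto simp: CS_def)
      qed
      moreover have "kern n (restrict a {0..<n}) = kern n a"
        by (auto simp: kern_def)
      ultimately show ?thesis
        using IT.emeasure_eP[OF h sing] by (simp add: K_def emeasure_pmf_single)
    qed
    have "c a (Suc n) = (\<integral>\<^sup>+h. emeasure (IT.eP n h) {restrict a {0..<Suc n}} \<partial>?C)"
      unfolding c_def IT.C.simps
      using IT.measurable_eP[of n] seC spC u IT.prob_space_C[OF u, of n, THEN prob_space.not_empty]
      by (subst emeasure_bind[where N="PiM {0..<Suc n} CS"])
         (auto simp: sing cong: measurable_cong_sets)
    also have "\<dots> = (\<integral>\<^sup>+h. ennreal (pmf (kern n a) (a n)) * indicator {restrict a {0..<n}} h \<partial>?C)"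
      by (intro nn_integral_cong eP) (simp add: spC)
    also have "\<dots> = c a n * pmf (kern n a) (a n)"
      by (subst nn_integral_cmult_indicator) (auto simp: seC sing c_def mult.commute)
    finally show ?thesis .
  qed
  have sQ: "sets Q = sets path_space"
    unfolding Q_def IT.PF.sets_lim by (simp add: CS_def)
  then have spQ: "space Q = UNIV"
    using sets_eq_imp_space_eq[of Q path_space] by (simp add: space_PiM)
  have ps: "prob_space Q"
    using cyl[of 0 undefined] c0[of undefined] by (intro prob_spaceI) (simp add: spQ)
  interpret prob_space Q by (rule ps)
  have m0: "ennreal (prob {\<xi>. \<forall>s<n. \<xi> s = a s}) = c a n" for a n
    using cyl by (simp add: emeasure_eq_measure)
  have mS: "prob {\<xi>. \<forall>s<Suc n. \<xi> s = a s} = prob {\<xi>. \<forall>s<n. \<xi> s = a s} * pmf (kern n a) (a n)" for a n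
  proof -
    have "ennreal (prob {\<xi>. \<forall>s<Suc n. \<xi> s = a s}) =
        ennreal (prob {\<xi>. \<forall>s<n. \<xi> s = a s} * pmf (kern n a) (a n))"
      unfolding m0 cS by (simp add: ennreal_mult m0)
    then show ?thesis
      by (subst (asm) ennreal_inj) auto
  qed
  have "is_walk_law \<omega> Q"
    unfolding is_walk_law_def
  proof (intro conjI allI ps sQ)
    have "prob {\<xi>. \<forall>s<Suc 0. \<xi> s = 0} = 1"
      using mS[of 0 "\<lambda>_. 0"] prob_space spQ by (simp add: kern_def)
    then show "prob {\<xi> \<in> space Q. \<xi> 0 = 0} = 1"
      by (simp add: spQ)
  next
    fix t k and a :: "nat \<Rightarrow> int"
    let ?b = "a(Suc t := a t + k)"
    have e1: "{\<xi> \<in> space Q. (\<forall>s\<le>t. \<xi> s = a s) \<and> \<xi> (Suc t) = a t + k}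
        = {\<xi>. \<forall>s<Suc (Suc t). \<xi> s = ?b s}"
      by (auto simp: spQ less_Suc_eq_le le_Suc_eq)
    have e2: "{\<xi> \<in> space Q. \<forall>s\<le>t. \<xi> s = a s} = {\<xi>. \<forall>s<Suc t. \<xi> s = ?b s}"
      by (auto simp: spQ less_Suc_eq_le)
    show "prob {\<xi> \<in> space Q. (\<forall>s\<le>t. \<xi> s = a s) \<and> \<xi> (Suc t) = a t + k} =
        prob {\<xi> \<in> space Q. \<forall>s\<le>t. \<xi> s = a s} * \<omega> (a t) k"
      unfolding e1 e2 mS[of "Suc t"] by (simp add: kern_def pstep)
  qed
  then show ?thesis ..
qed

theorem walk_law:
  assumes "\<forall>x. \<omega> x \<in> prob_vectors m"
  shows "is_walk_law \<omega> (walk_law \<omega>)"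
  unfolding walk_law_def
  using is_walk_law_exists[OF assms] by (rule exE) (metis theI is_walk_law_unique)

end

(*
Fix an environment. Since the steps are centred, exp (i u S_n + u^2 V_n / 2) is a martingale up to an
error of order n |u|^3. As u^2 V_n is almost deterministic at the stopping time var_time, this gives (i).
For (ii) it remains to show that V_n / n tends to a constant in L^1 of the quenched law.

Let f be the variance of a step from the origin. On the environments, f is approximated in L^1(P) by
c + g - Rg, where c is a constant, g is bounded and R is the transition operator of the environment
seen from the walk. A function orthogonal to all these approximants (tested against its own sign) is
positive on a shift-invariant set, hence vanishes by ergodicity, so the error can be made arbitrarily
small. Along the walk, g - Rg contributes a bounded term and a martingale of order sqrt n. The error
has small averages over all intervals starting at the origin, by the maximal ergodic inequality; if F
is the convex function on the integers whose second difference dominates the error r, then ellipticity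
makes F (walk) grow in mean by at least epsilon * r (walk) per step, while F x <= l * x^2 and
E (walk_n)^2 <= m^2 n. So the error contributes at most (m^2 l / epsilon) n, and no invariant measure
for the environment seen from the walk is needed.
*)
theory Submission
  imports Defs
begin

text \<open>The obstacle in (ii) is that P is in general not invariant for the environment seen from
  the walk, so an ergodic theorem under P says nothing directly about averages in time. What P
  controls is averages in space, because it is invariant under shifts; centring and ellipticity
  convert these into bounds on expected occupation, with constants that depend only on
  \<open>m\<close> and \<open>\<epsilon>\<close>. The approximation in L^1(P) is a duality
  statement: its annihilators are the densities of signed invariant measures of total mass zero, so
  it rests on a uniqueness property, which ergodicity of the shift and the positive probability of
  the jump +1 provide. The constants c of the approximants do not depend on the environment. Hence
  their limit, the asymptotic variance, is deterministic; it is positive because every step has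
  variance at least \<open>2 * \<epsilon>\<close>.\<close>

section \<open>Finite-horizon expectations of the walk\<close>

text \<open>This stands in for adaptedness to the natural filtration. Since only finitely many
  prefixes of a given length carry mass, expectations of such functionals are finite sums, and
  conditional expectations become averages over one jump.\<close>

definition depends_upto :: "nat \<Rightarrow> ((nat \<Rightarrow> int) \<Rightarrow> 'b) \<Rightarrow> bool" where
  "depends_upto t \<Phi> \<longleftrightarrow> (\<forall>\<xi> \<eta>. (\<forall>s\<le>t. \<xi> s = \<eta> s) \<longrightarrow> \<Phi> \<xi> = \<Phi> \<eta>)"

lemma depends_uptoD: "depends_upto t \<Phi> \<Longrightarrow> (\<And>s. s \<le> t \<Longrightarrow> \<xi> s = \<eta> s) \<Longrightarrow> \<Phi> \<xi> = \<Phi> \<eta>"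
  unfolding depends_upto_def by blast

definition extend_path :: "(nat \<Rightarrow> int) \<Rightarrow> nat \<Rightarrow> int \<Rightarrow> nat \<Rightarrow> int" where
  "extend_path a t j = (\<lambda>s. if s \<le> t then a s else a t + j)"

lemma extend_path_simps [simp]:
  "s \<le> t \<Longrightarrow> extend_path a t j s = a s" "t < s \<Longrightarrow> extend_path a t j s = a t + j"
  by (auto simp: extend_path_def)

text \<open>Each prefix of length \<open>t\<close> of a path with jumps at most \<open>m\<close> is represented by the path that is
  constant from time \<open>t\<close> on.\<close>

primrec paths :: "int \<Rightarrow> nat \<Rightarrow> (nat \<Rightarrow> int) set" where
  "paths m 0 = {\<lambda>_. 0}"
| "paths m (Suc t) = (\<lambda>(a, j). extend_path a t j) ` (paths m t \<times> {-m..m})"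

definition cylinder :: "nat \<Rightarrow> (nat \<Rightarrow> int) \<Rightarrow> (nat \<Rightarrow> int) set" where
  "cylinder t a = {\<xi>. \<forall>s\<le>t. \<xi> s = a s}"

lemma finite_paths: "finite (paths m t)"
  by (induction t) auto

lemma paths_const: "a \<in> paths m t \<Longrightarrow> t \<le> s \<Longrightarrow> a s = a t"
  by (cases t) (auto simp: extend_path_def)

text \<open>\<open>extend_path\<close> forgets \<open>a\<close> after time \<open>t\<close>;
  injectivity is recovered because elements of \<open>paths m t\<close> are constant from then
  on.\<close>

lemma inj_on_extend_path: "inj_on (\<lambda>(a, j). extend_path a t j) (paths m t \<times> {-m..m})"
proof (rule inj_onI, clarify)
  fix a j b k assume a: "a \<in> paths m t" and b: "b \<in> paths m t" and eq: "extend_path a t j = extend_path b t k"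
  have "a s = b s" if "s \<le> t" for s using fun_cong[OF eq, of s] that by simp
  moreover from this have "a s = b s" if "t < s" for s
    using paths_const[OF a, of s] paths_const[OF b, of s] that by simp
  ultimately have "a = b" by (metis ext not_le)
  moreover have "j = k" using fun_cong[OF eq, of "Suc t"] \<open>a = b\<close> by simp
  ultimately show "a = b \<and> j = k" by blast
qed

lemma paths_eqI: "a \<in> paths m t \<Longrightarrow> b \<in> paths m t \<Longrightarrow> (\<And>s. s \<le> t \<Longrightarrow> a s = b s) \<Longrightarrow> a = b"
  by (metis ext nat_le_linear order_refl paths_const)

text \<open>The functional factors through the list of the first \<open>Suc t\<close> positions,
  which takes values in a countable discrete space, where every function is measurable.\<close>

lemma depends_upto_measurable:
  fixes \<Phi> :: "(nat \<Rightarrow> int) \<Rightarrow> 'b::topological_space"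
  assumes "depends_upto t \<Phi>"
  shows "\<Phi> \<in> borel_measurable path_space"
proof -
  define f where "f = (\<lambda>\<xi>::nat \<Rightarrow> int. map \<xi> [0..<Suc t])"
  have pre: "f -` {l} = (if length l = Suc t then {\<xi>. \<forall>s\<le>t. \<xi> s = l ! s} else {})" for l
  proof -
    have "f \<xi> = l \<longleftrightarrow> length l = Suc t \<and> (\<forall>s<Suc t. \<xi> s = l ! s)" for \<xi>
      unfolding f_def by (subst list_eq_iff_nth_eq) (auto simp del: upt_Suc)
    then show ?thesis by (auto simp: less_Suc_eq_le)
  qed
  have fm: "f \<in> measurable path_space (count_space UNIV)"
    by (subst measurable_count_space_eq2_countable) (auto simp: pre space_PiM sets_path_prefix)
  have "\<Phi> \<xi> = (\<lambda>l. \<Phi> (\<lambda>s. l ! s)) (f \<xi>)" for \<xi>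
    by (rule depends_uptoD[OF assms]) (simp add: f_def del: upt_Suc)
  then have "\<Phi> = (\<lambda>\<xi>. (\<lambda>l. \<Phi> (\<lambda>s. l ! s)) (f \<xi>))" by blast
  also have "\<dots> \<in> borel_measurable path_space"
    by (rule measurable_compose[OF fm]) simp
  finally show ?thesis .
qed

section \<open>Integrals of prefix functionals under the quenched law\<close>

locale walk_env =
  fixes m :: int and \<omega> :: env
  assumes env: "\<forall>x. \<omega> x \<in> prob_vectors m"
begin

abbreviation Q :: "(nat \<Rightarrow> int) measure" where "Q \<equiv> walk_law \<omega>"

lemma is_walk_law_Q: "is_walk_law \<omega> Q"
  by (rule walk_law[OF env])

lemma sets_Q [measurable_cong]: "sets Q = sets path_space"
  using is_walk_law_Q by (simp add: is_walk_law_def)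

lemma space_Q [simp]: "space Q = UNIV"
  by (rule space_walk_law[OF is_walk_law_Q])

sublocale prob_space Q
  using is_walk_law_Q by (simp add: is_walk_law_def)

lemma prob_UNIV [simp]: "prob UNIV = 1"
  using prob_space by simp

lemma env_nonneg [simp]: "0 \<le> \<omega> x j"
  and env_sum [simp]: "(\<Sum>j=-m..m. \<omega> x j) = 1"
  using env by (auto simp: prob_vectors_def)

lemma sets_cylinder [measurable]: "cylinder t a \<in> sets Q"
  using sets_path_prefix by (simp add: cylinder_def sets_Q)

lemma prob_cylinder_extend:
  "prob (cylinder (Suc t) (extend_path a t j)) = prob (cylinder t a) * \<omega> (a t) j"
proof -
  have *: "cylinder (Suc t) (extend_path a t j)
      = {\<xi> \<in> space Q. (\<forall>s\<le>t. \<xi> s = a s) \<and> \<xi> (Suc t) = a t + j}"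
    by (auto simp: cylinder_def le_Suc_eq)
  have "prob {\<xi> \<in> space Q. (\<forall>s\<le>t. \<xi> s = a s) \<and> \<xi> (Suc t) = a t + j} =
      prob {\<xi> \<in> space Q. \<forall>s\<le>t. \<xi> s = a s} * \<omega> (a t) j"
    using is_walk_law_Q unfolding is_walk_law_def by blast
  then show ?thesis unfolding * by (simp add: cylinder_def)
qed

lemma sum_paths_Suc:
  "(\<Sum>a\<in>paths m (Suc t). h a) = (\<Sum>a\<in>paths m t. \<Sum>j=-m..m. h (extend_path a t j))"
  using inj_on_extend_path[of t m] unfolding split_def by (simp add: sum.reindex sum.cartesian_product split_def)

lemma sum_prob_cylinder: "(\<Sum>a\<in>paths m t. prob (cylinder t a)) = 1"
proof (induction t)
  case 0
  have "prob {\<xi> \<in> space Q. \<xi> 0 = 0} = 1" using is_walk_law_Q by (simp add: is_walk_law_def)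
  then show ?case by (simp add: cylinder_def)
next
  case (Suc t)
  show ?case
    unfolding sum_paths_Suc prob_cylinder_extend
    by (simp add: sum_distrib_left[symmetric] Suc)
qed

lemma disjoint_cylinders: "disjoint_family_on (cylinder t) (paths m t)"
  unfolding disjoint_family_on_def cylinder_def by (auto 4 4 dest: paths_eqI)

text \<open>The cylinders of the finitely many admissible prefixes are disjoint and their masses add
  up to one.\<close>

lemma AE_cylinder: "AE \<xi> in Q. \<exists>a\<in>paths m t. \<xi> \<in> cylinder t a"
proof -
  have "prob (\<Union>a\<in>paths m t. cylinder t a) = (\<Sum>a\<in>paths m t. prob (cylinder t a))"
    by (rule finite_measure_finite_Union) (auto simp: finite_paths disjoint_cylinders)
  then have "prob (\<Union>a\<in>paths m t. cylinder t a) = 1" by (simp add: sum_prob_cylinder)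
  then have "AE \<xi> in Q. \<xi> \<in> (\<Union>a\<in>paths m t. cylinder t a)"
    by (subst (asm) prob_eq_1) (auto simp: finite_paths intro!: sets.finite_UN)
  then show ?thesis by eventually_elim auto
qed

text \<open>Outside a null set exactly one cylinder contains the path, so the functional agrees
  almost everywhere with a simple function.\<close>

lemma
  fixes \<Phi> :: "(nat \<Rightarrow> int) \<Rightarrow> 'b::{banach, second_countable_topology}"
  assumes "depends_upto t \<Phi>"
  shows integrable_depends_upto: "integrable Q \<Phi>"
    and integral_depends_upto: "(\<integral>\<xi>. \<Phi> \<xi> \<partial>Q) = (\<Sum>a\<in>paths m t. prob (cylinder t a) *\<^sub>R \<Phi> a)"
proof -
  have m[measurable]: "\<Phi> \<in> borel_measurable Q"
    using depends_upto_measurable[OF assms] by (simp add: measurable_cong_sets[OF sets_Q refl])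
  have ae: "AE \<xi> in Q. \<Phi> \<xi> = (\<Sum>a\<in>paths m t. indicator (cylinder t a) \<xi> *\<^sub>R \<Phi> a)"
    using AE_cylinder[of t]
  proof eventually_elim
    case (elim \<xi>)
    then obtain a where a: "a \<in> paths m t" "\<xi> \<in> cylinder t a" by blast
    have "indicator (cylinder t b) \<xi> *\<^sub>R \<Phi> b = (if b = a then \<Phi> a else 0)" if "b \<in> paths m t" for b
      using disjoint_cylinders[of t] that a unfolding disjoint_family_on_def
      by (auto simp: indicator_def)
    then have "(\<Sum>b\<in>paths m t. indicator (cylinder t b) \<xi> *\<^sub>R \<Phi> b) = (\<Sum>b\<in>paths m t. if b = a then \<Phi> a else 0)"
      by (intro sum.cong) auto
    also have "\<dots> = \<Phi> a" using a finite_paths by simp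
    also have "\<dots> = \<Phi> \<xi>" using a(2) by (intro depends_uptoD[OF assms]) (auto simp: cylinder_def)
    finally show ?case by simp
  qed
  have i: "has_bochner_integral Q (\<lambda>\<xi>. \<Sum>a\<in>paths m t. indicator (cylinder t a) \<xi> *\<^sub>R \<Phi> a)
    (\<Sum>a\<in>paths m t. prob (cylinder t a) *\<^sub>R \<Phi> a)"
    by (intro has_bochner_integral_sum has_bochner_integral_scaleR_left has_bochner_integral_indicator)
       (auto simp: less_top[symmetric])
  have "has_bochner_integral Q \<Phi> (\<Sum>a\<in>paths m t. prob (cylinder t a) *\<^sub>R \<Phi> a)"
    by (subst has_bochner_integral_cong_AE[OF m _ ae]) (use i in \<open>auto dest: has_bochner_integral_implies_finite_norm\<close>)
  then show "integrable Q \<Phi>" "(\<integral>\<xi>. \<Phi> \<xi> \<partial>Q) = (\<Sum>a\<in>paths m t. prob (cylinder t a) *\<^sub>R \<Phi> a)"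
    by (auto simp: has_bochner_integral_iff)
qed

lemma depends_upto_step:
  "depends_upto (Suc t) \<Phi> \<Longrightarrow> depends_upto t (\<lambda>\<xi>. \<Sum>j=-m..m. \<omega> (\<xi> t) j *\<^sub>R \<Phi> (extend_path \<xi> t j))"
  for \<Phi> :: "(nat \<Rightarrow> int) \<Rightarrow> 'b::real_vector"
  unfolding depends_upto_def
  by (intro allI impI sum.cong refl arg_cong2[where f=scaleR]) (auto simp: extend_path_def)

text \<open>The tower property at time \<open>t\<close>: the last jump is averaged out. By
  \<open>prob_cylinder_extend\<close> both sides are the same finite sum over prefixes and
  jumps.\<close>

lemma integral_markov:
  fixes \<Phi> :: "(nat \<Rightarrow> int) \<Rightarrow> 'b::{banach, second_countable_topology}"
  assumes "depends_upto (Suc t) \<Phi>"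
  shows "(\<integral>\<xi>. \<Phi> \<xi> \<partial>Q) = (\<integral>\<xi>. (\<Sum>j=-m..m. \<omega> (\<xi> t) j *\<^sub>R \<Phi> (extend_path \<xi> t j)) \<partial>Q)"
  unfolding integral_depends_upto[OF assms] integral_depends_upto[OF depends_upto_step[OF assms]]
    sum_paths_Suc prob_cylinder_extend
  by (simp add: scaleR_sum_right)

lemma AE_start: "AE \<xi> in Q. \<xi> 0 = 0"
  using AE_cylinder[of 0] by eventually_elim (auto simp: cylinder_def)

end

section \<open>Occupation times and second moments\<close>

text \<open>This is \<open>r\<close> summed twice: the first differences are the partial sums of
  \<open>r\<close>, so the function is discretely convex when \<open>r\<close> is
  nonnegative.\<close>

definition potential :: "(nat \<Rightarrow> real) \<Rightarrow> nat \<Rightarrow> real" where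
  "potential r n = (\<Sum>y<n. r y * (real n - real y))"

lemma potential_Suc: "potential r (Suc n) = potential r n + (\<Sum>y\<le>n. r y)"
proof -
  have "potential r (Suc n) = (\<Sum>y<n. r y * (real n - real y) + r y) + r n"
    unfolding potential_def by (simp add: algebra_simps)
  then show ?thesis
    by (simp add: sum.distrib potential_def lessThan_Suc_atMost[symmetric])
qed

text \<open>The second difference is \<open>r x\<close>, except that it is \<open>2 * r 0\<close> at \<open>x = 0\<close>.\<close>

definition int_potential :: "(int \<Rightarrow> real) \<Rightarrow> int \<Rightarrow> real" where
  "int_potential r x =
     (if 0 \<le> x then potential (\<lambda>y. r (int y)) (nat x) else potential (\<lambda>y. r (- int y)) (nat (- x)))"

lemma int_potential_0 [simp]: "int_potential r 0 = 0"
  by (simp add: int_potential_def potential_def)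

lemma int_potential_second_difference:
  assumes "\<And>x. 0 \<le> r x"
  shows "r x \<le> int_potential r (x + 1) + int_potential r (x - 1) - 2 * int_potential r x"
proof -
  consider "x = 0" | k where "x = int (Suc k)" | k where "x = - int (Suc k)"
    by (metis int_cases3 Suc_pred' of_nat_0_less_iff)
  then show ?thesis
  proof cases
    case 1
    then show ?thesis
      using assms[of 0] by (simp add: int_potential_def potential_def)
  next
    case 2
    then have "x + 1 = int (Suc (Suc k))" "x - 1 = int k" by auto
    with 2 have "int_potential r (x + 1) = potential (\<lambda>y. r (int y)) (Suc (Suc k))"
      "int_potential r (x - 1) = potential (\<lambda>y. r (int y)) k"
      "int_potential r x = potential (\<lambda>y. r (int y)) (Suc k)"
      unfolding int_potential_def by (simp_all only: nat_int of_nat_0_le_iff if_True)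
    then show ?thesis using 2 by (simp add: potential_Suc)
  next
    case 3
    \<comment> \<open>The formula for the negative half-line also holds at 0, so the point -1, whose
      right neighbour is 0, is not a special case.\<close>
    have neg: "int_potential r (- int n) = potential (\<lambda>y. r (- int y)) n" for n
      by (cases "n = 0") (auto simp: int_potential_def potential_def)
    from 3 have "x + 1 = - int k" "x - 1 = - int (Suc (Suc k))" by auto
    then show ?thesis unfolding 3
      by (simp only: neg potential_Suc) (simp add: atMost_Suc)
  qed
qed

text \<open>The value at \<open>x\<close> involves \<open>r\<close> only on the interval from 0
  towards \<open>x\<close>, with weights at most the distance of \<open>x\<close> from 0. This is
  why bounds on averages over intervals starting at the origin suffice.\<close>

lemma int_potential_le_square:
  assumes "\<And>x. 0 \<le> r x"
    and "\<And>n. (\<Sum>y<n. r (int y)) \<le> l * real n" "\<And>n. (\<Sum>y<n. r (- int y)) \<le> l * real n"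
  shows "int_potential r x \<le> l * (real_of_int x)\<^sup>2"
proof -
  have *: "potential q n \<le> l * (real n)\<^sup>2" if "\<And>y. 0 \<le> q y" "(\<Sum>y<n. q y) \<le> l * real n" for q n
  proof -
    have "potential q n \<le> (\<Sum>y<n. q y * real n)"
      unfolding potential_def by (intro sum_mono mult_left_mono) (auto simp: that)
    also have "\<dots> \<le> (l * real n) * real n"
      unfolding sum_distrib_right[symmetric] by (intro mult_right_mono that) auto
    finally show ?thesis by (simp add: power2_eq_square mult.assoc)
  qed
  show ?thesis
    unfolding int_potential_def
    using *[of "\<lambda>y. r (int y)" "nat x"] *[of "\<lambda>y. r (- int y)" "nat (- x)"] assms by auto
qed

text \<open>Increments of a convex function are nondecreasing, so the right difference at
  \<open>x\<close> is the slope of a supporting line. That line will average out under centred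
  jumps.\<close>

lemma discrete_convex_subgradient:
  fixes F :: "int \<Rightarrow> real"
  assumes "\<And>x. 0 \<le> F (x + 1) + F (x - 1) - 2 * F x"
  shows "F x + real_of_int j * (F (x + 1) - F x) \<le> F (x + j)"
proof -
  define D where "D = (\<lambda>x. F (x + 1) - F x)"
  have step: "D (y - 1) \<le> D y" for y using assms[of y] by (simp add: D_def)
  have up: "D x \<le> D (x + int n)" for n
  proof (induction n)
    case (Suc n)
    then show ?case using step[of "x + int (Suc n)"] by (simp add: algebra_simps)
  qed simp
  have down: "D (x - int n) \<le> D x" for n
  proof (induction n)
    case (Suc n)
    then show ?case using step[of "x - int n"] by (simp add: algebra_simps)
  qed simp
  have "F x + real n * D x \<le> F (x + int n)" for n
  proof (induction n)
    case (Suc n)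
    have "F (x + int (Suc n)) = F (x + int n) + D (x + int n)"
      by (simp add: D_def algebra_simps)
    then show ?case using Suc up[of n] by (simp add: algebra_simps)
  qed simp
  moreover have "F x - real n * D x \<le> F (x - int n)" for n
  proof (induction n)
    case (Suc n)
    have "F (x - int n) = F (x - int (Suc n)) + D (x - int (Suc n))"
      by (simp add: D_def algebra_simps)
    then show ?case using Suc down[of "Suc n"] by (simp add: algebra_simps)
  qed simp
  ultimately show ?thesis
    unfolding D_def by (cases j rule: int_cases2) auto
qed

section \<open>Moments, occupation times and martingales of the centred walk\<close>

locale centered_walk = walk_env +
  fixes \<epsilon> :: real
  assumes m_pos: "1 \<le> m"
    and eps_pos: "0 < \<epsilon>"
    and elliptic: "\<epsilon> \<le> \<omega> x 1" "\<epsilon> \<le> \<omega> x (- 1)"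
    and centered: "(\<Sum>j=-m..m. real_of_int j * \<omega> x j) = 0"
begin

definition var_at :: "int \<Rightarrow> real" where
  "var_at x = (\<Sum>j=-m..m. (real_of_int j)\<^sup>2 * \<omega> x j)"

definition transition :: "(int \<Rightarrow> real) \<Rightarrow> int \<Rightarrow> real" where
  "transition g x = (\<Sum>j=-m..m. \<omega> x j * g (x + j))"

lemma total_var_eq: "total_var m \<omega> \<xi> n = (\<Sum>k<n. var_at (\<xi> k))"
  unfolding total_var_def step_var_def var_at_def
  by (rule sum.reindex_bij_witness[of _ Suc "\<lambda>k. k - 1"]) auto

lemma weighted_sum_le:
  assumes "\<And>j. - m \<le> j \<Longrightarrow> j \<le> m \<Longrightarrow> f j \<le> (c::real)"
  shows "(\<Sum>j=-m..m. \<omega> x j * f j) \<le> c"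
proof -
  have "(\<Sum>j=-m..m. \<omega> x j * f j) \<le> (\<Sum>j=-m..m. \<omega> x j * c)"
    by (intro sum_mono mult_left_mono assms) auto
  then show ?thesis by (simp add: sum_distrib_right[symmetric])
qed

lemma weighted_sum_ge:
  assumes "\<And>j. - m \<le> j \<Longrightarrow> j \<le> m \<Longrightarrow> (c::real) \<le> f j"
  shows "c \<le> (\<Sum>j=-m..m. \<omega> x j * f j)"
  using weighted_sum_le[of "\<lambda>j. - f j" "- c" x] assms by (simp add: sum_negf)

lemma square_le: "- m \<le> j \<Longrightarrow> j \<le> m \<Longrightarrow> (real_of_int j)\<^sup>2 \<le> (real_of_int m)\<^sup>2"
  by (rule abs_le_square_iff[THEN iffD1]) auto

lemma var_at_le: "var_at x \<le> (real_of_int m)\<^sup>2"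
  using weighted_sum_le[of "\<lambda>j. (real_of_int j)\<^sup>2", OF square_le]
  by (simp add: var_at_def mult.commute)

lemma var_at_ge: "2 * \<epsilon> \<le> var_at x"
proof -
  have "2 * \<epsilon> \<le> (\<Sum>j\<in>{-1, 1}. (real_of_int j)\<^sup>2 * \<omega> x j)"
    using elliptic[of x] by simp
  also have "\<dots> \<le> var_at x"
    unfolding var_at_def by (rule sum_mono2) (use m_pos in auto)
  finally show ?thesis .
qed

lemma var_at_nonneg: "0 \<le> var_at x"
  using var_at_ge[of x] eps_pos by simp

lemma depends_upto_at: "k \<le> n \<Longrightarrow> depends_upto n (\<lambda>\<xi>. f (\<xi> k))"
  unfolding depends_upto_def by simp

lemma integrable_at [intro, simp]: "integrable Q (\<lambda>\<xi>. f (\<xi> k))"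
  for f :: "int \<Rightarrow> 'b::{banach, second_countable_topology}"
  by (rule integrable_depends_upto[OF depends_upto_at[OF order_refl]])

lemma integrable_sum_at: "integrable Q (\<lambda>\<xi>. \<Sum>k<n. f (\<xi> k))"
  for f :: "int \<Rightarrow> 'b::{banach, second_countable_topology}"
  by (intro Bochner_Integration.integrable_sum integrable_at)

lemma integral_at_Suc: "(\<integral>\<xi>. f (\<xi> (Suc n)) \<partial>Q) = (\<integral>\<xi>. transition f (\<xi> n) \<partial>Q)" for f :: "int \<Rightarrow> real"
  by (subst integral_markov[OF depends_upto_at[OF order_refl]]) (simp add: transition_def)

lemma integral_at_0: "(\<integral>\<xi>. f (\<xi> 0) \<partial>Q) = f 0" for f :: "int \<Rightarrow> real"
proof -
  have "(\<integral>\<xi>. f (\<xi> 0) \<partial>Q) = (\<integral>\<xi>. f 0 \<partial>Q)"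
    by (rule integral_cong_AE) (use AE_start in \<open>auto intro: borel_measurable_integrable\<close>)
  then show ?thesis by (simp add: prob_space)
qed

lemma integral_dynkin:
  fixes f :: "int \<Rightarrow> real"
  shows "(\<integral>\<xi>. f (\<xi> n) \<partial>Q) = f 0 + (\<Sum>k<n. \<integral>\<xi>. transition f (\<xi> k) - f (\<xi> k) \<partial>Q)"
  by (induction n) (simp_all add: integral_at_0 integral_at_Suc)

text \<open>Centring removes the cross term, so the squared position minus the accumulated variance
  has constant mean.\<close>

lemma transition_square: "transition (\<lambda>x. (real_of_int x)\<^sup>2) x = (real_of_int x)\<^sup>2 + var_at x"
proof -
  have "transition (\<lambda>x. (real_of_int x)\<^sup>2) x =
    (\<Sum>j=-m..m. (real_of_int x)\<^sup>2 * \<omega> x j + 2 * real_of_int x * (real_of_int j * \<omega> x j) + (real_of_int j)\<^sup>2 * \<omega> x j)"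
    unfolding transition_def by (intro sum.cong) (auto simp: power2_eq_square algebra_simps)
  also have "\<dots> = (real_of_int x)\<^sup>2 + var_at x"
    unfolding sum.distrib sum_distrib_left[symmetric] by (simp add: centered var_at_def)
  finally show ?thesis .
qed

lemma second_moment: "(\<integral>\<xi>. (real_of_int (\<xi> n))\<^sup>2 \<partial>Q) \<le> (real_of_int m)\<^sup>2 * real n"
proof -
  have "(\<integral>\<xi>. (real_of_int (\<xi> n))\<^sup>2 \<partial>Q) = (\<Sum>k<n. \<integral>\<xi>. var_at (\<xi> k) \<partial>Q)"
    using integral_dynkin[of "\<lambda>x. (real_of_int x)\<^sup>2" n] by (simp add: transition_square)
  also have "\<dots> \<le> (\<Sum>k<n. \<integral>\<xi>. (real_of_int m)\<^sup>2 \<partial>Q)"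
    by (intro sum_mono integral_mono) (auto simp: var_at_le)
  finally show ?thesis by (simp add: prob_space mult.commute)
qed

text \<open>Subtracting the supporting line at \<open>x\<close> leaves a nonnegative function
  \<open>h\<close> of the jump, and by centring its average is the drift of \<open>F\<close>. The
  slope is the right difference, so \<open>h\<close> vanishes at the jump +1 and equals the full
  second difference at -1, a jump of probability at least \<open>\<epsilon>\<close>.\<close>

lemma transition_convex:
  assumes "\<And>x. r x \<le> F (x + 1) + F (x - 1) - 2 * F x" "\<And>x. 0 \<le> r x"
  shows "\<epsilon> * r x \<le> transition F x - F x"
proof -
  have conv: "F x + real_of_int j * (F (x + 1) - F x) \<le> F (x + j)" for j
    by (rule discrete_convex_subgradient) (use assms order_trans in blast)
  define h where "h = (\<lambda>j. F (x + j) - F x - real_of_int j * (F (x + 1) - F x))"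
  have h0: "0 \<le> h j" for j using conv[of j] by (simp add: h_def)
  have h1: "r x \<le> h (- 1)" using assms(1)[of x] by (simp add: h_def)
  have "\<epsilon> * r x \<le> \<omega> x (- 1) * h (- 1)"
    using elliptic[of x] h1 assms(2)[of x] eps_pos by (intro mult_mono) auto
  also have "\<dots> \<le> (\<Sum>j=-m..m. \<omega> x j * h j)"
    by (rule member_le_sum) (use m_pos h0 in auto)
  also have "\<dots> = (\<Sum>j=-m..m. \<omega> x j * F (x + j) - F x * \<omega> x j - (F (x + 1) - F x) * (real_of_int j * \<omega> x j))"
    unfolding h_def by (intro sum.cong) (auto simp: algebra_simps)
  also have "\<dots> = transition F x - F x"
    unfolding sum_subtractf sum_distrib_left[symmetric] by (simp add: centered transition_def)
  finally show ?thesis .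
qed

text \<open>This trades averages over space for averages over time: Dynkin's formula for
  \<open>int_potential r\<close> compares expected occupation with the second moment of the
  walk.\<close>

lemma occupation_bound:
  assumes r: "\<And>x. 0 \<le> r x"
    and l: "\<And>n. (\<Sum>y<n. r (int y)) \<le> l * real n" "\<And>n. (\<Sum>y<n. r (- int y)) \<le> l * real n"
  shows "(\<integral>\<xi>. (\<Sum>k<n. r (\<xi> k)) \<partial>Q) \<le> l * (real_of_int m)\<^sup>2 / \<epsilon> * real n"
proof -
  have "0 \<le> l" using l(1)[of 1] r[of 0] by simp
  let ?F = "int_potential r"
  have "\<epsilon> * (\<integral>\<xi>. (\<Sum>k<n. r (\<xi> k)) \<partial>Q) = (\<Sum>k<n. \<integral>\<xi>. \<epsilon> * r (\<xi> k) \<partial>Q)"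
    by (simp add: sum_distrib_left)
  also have "\<dots> \<le> (\<Sum>k<n. \<integral>\<xi>. transition ?F (\<xi> k) - ?F (\<xi> k) \<partial>Q)"
    by (intro sum_mono integral_mono transition_convex int_potential_second_difference r) auto
  also have "\<dots> = (\<integral>\<xi>. ?F (\<xi> n) \<partial>Q)"
    using integral_dynkin[of ?F n] by simp
  also have "\<dots> \<le> (\<integral>\<xi>. l * (real_of_int (\<xi> n))\<^sup>2 \<partial>Q)"
    by (intro integral_mono int_potential_le_square assms) auto
  also have "\<dots> \<le> l * ((real_of_int m)\<^sup>2 * real n)"
    using second_moment[of n] \<open>0 \<le> l\<close> by (simp add: mult_left_mono)
  finally show ?thesis
    using eps_pos by (simp add: field_simps)
qed

text \<open>The increments have conditional mean zero and size at most \<open>2 * B\<close>, so each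
  step adds at most \<open>4 * B^2\<close> to the second moment.\<close>

lemma martingale_second_moment:
  assumes B: "\<And>x. \<bar>g x\<bar> \<le> B"
  shows "(\<integral>\<xi>. (\<Sum>k<n. g (\<xi> (Suc k)) - transition g (\<xi> k))\<^sup>2 \<partial>Q) \<le> 4 * B\<^sup>2 * real n"
proof (induction n)
  case (Suc n)
  define M where "M = (\<lambda>n \<xi>. \<Sum>k<n. g (\<xi> (Suc k)) - transition g (\<xi> k))"
  have dep: "depends_upto n (\<lambda>\<xi>. f (M n \<xi>) (\<xi> n))" for n and f :: "real \<Rightarrow> int \<Rightarrow> real"
    unfolding depends_upto_def M_def by (auto intro!: arg_cong2[of _ _ _ _ f] sum.cong)
  have M_extend: "M (Suc n) (extend_path \<xi> n j) = M n \<xi> + (g (\<xi> n + j) - transition g (\<xi> n))" for \<xi> j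
    unfolding M_def by simp
  have B0: "0 \<le> B" using B[of 0] by simp
  have Pg: "\<bar>transition g x\<bar> \<le> B" for x
  proof (rule abs_leI)
    show "transition g x \<le> B"
      unfolding transition_def by (rule weighted_sum_le) (use B in \<open>simp add: abs_le_iff\<close>)
    have "- B \<le> transition g x"
      unfolding transition_def by (rule weighted_sum_ge) (use B in \<open>simp add: abs_le_iff minus_le_iff[of B]\<close>)
    then show "- transition g x \<le> B" by simp
  qed
  have one: "(\<Sum>j=-m..m. \<omega> x j * (a + (g (x + j) - transition g x))\<^sup>2) \<le> a\<^sup>2 + 4 * B\<^sup>2" for a x
  proof -
    have "(\<Sum>j=-m..m. \<omega> x j * (a + (g (x + j) - transition g x))\<^sup>2) =
      (\<Sum>j=-m..m. (a\<^sup>2 - 2 * a * transition g x) * \<omega> x j + 2 * a * (\<omega> x j * g (x + j))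
         + \<omega> x j * (g (x + j) - transition g x)\<^sup>2)"
      by (intro sum.cong) (auto simp: power2_eq_square algebra_simps)
    also have "\<dots> = a\<^sup>2 + (\<Sum>j=-m..m. \<omega> x j * (g (x + j) - transition g x)\<^sup>2)"
      unfolding sum.distrib sum_distrib_left[symmetric] by (simp add: transition_def[symmetric])
    also have "(\<Sum>j=-m..m. \<omega> x j * (g (x + j) - transition g x)\<^sup>2) \<le> 4 * B\<^sup>2"
    proof (rule weighted_sum_le)
      fix j
      have "\<bar>g (x + j) - transition g x\<bar> \<le> \<bar>2 * B\<bar>"
        using B[of "x + j"] Pg[of x] by linarith
      then have "(g (x + j) - transition g x)\<^sup>2 \<le> (2 * B)\<^sup>2" by (simp only: abs_le_square_iff)
      then show "(g (x + j) - transition g x)\<^sup>2 \<le> 4 * B\<^sup>2" by (simp add: power_mult_distrib)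
    qed
    finally show ?thesis by simp
  qed
  have "(\<integral>\<xi>. (M (Suc n) \<xi>)\<^sup>2 \<partial>Q) = (\<integral>\<xi>. (\<Sum>j=-m..m. \<omega> (\<xi> n) j *\<^sub>R (M (Suc n) (extend_path \<xi> n j))\<^sup>2) \<partial>Q)"
    by (rule integral_markov) (rule dep[of "Suc n" "\<lambda>a _. a\<^sup>2"])
  also have "\<dots> = (\<integral>\<xi>. (\<Sum>j=-m..m. \<omega> (\<xi> n) j * (M n \<xi> + (g (\<xi> n + j) - transition g (\<xi> n)))\<^sup>2) \<partial>Q)"
    by (simp only: M_extend real_scaleR_def)
  also have "\<dots> \<le> (\<integral>\<xi>. (M n \<xi>)\<^sup>2 + 4 * B\<^sup>2 \<partial>Q)"
    by (intro integral_mono one integrable_depends_upto[OF dep[of n "\<lambda>a x. \<Sum>j=-m..m. \<omega> x j * (a + (g (x + j) - transition g x))\<^sup>2"]]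
      integrable_depends_upto[OF dep[of n "\<lambda>a x. a\<^sup>2 + 4 * B\<^sup>2"]])
  also have "\<dots> = (\<integral>\<xi>. (M n \<xi>)\<^sup>2 \<partial>Q) + 4 * B\<^sup>2"
    using integrable_depends_upto[OF dep[of n "\<lambda>a x. a\<^sup>2"]] by (simp add: prob_space)
  finally show ?case using Suc by (simp add: M_def algebra_simps)
qed simp

text \<open>Moving the index of \<open>g\<close> by one turns the sum into a martingale plus two
  boundary values, each bounded by \<open>B\<close>.\<close>

lemma corrector_bound:
  assumes B: "\<And>x. \<bar>g x\<bar> \<le> B"
  shows "(\<integral>\<xi>. \<bar>\<Sum>k<n. g (\<xi> k) - transition g (\<xi> k)\<bar> \<partial>Q) \<le> 2 * B + 2 * B * sqrt n"
proof -
  define M where "M = (\<lambda>\<xi>. \<Sum>k<n. g (\<xi> (Suc k)) - transition g (\<xi> k))"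
  have dep: "depends_upto n (\<lambda>\<xi>. f (M \<xi>))" for f :: "real \<Rightarrow> real"
    unfolding depends_upto_def M_def by (auto intro!: arg_cong[of _ _ f] sum.cong)
  note int = integrable_depends_upto[OF dep]
  have B0: "0 \<le> B" using B[of 0] by simp
  \<comment> \<open>Nonnegativity of the variance of \<open>|M|\<close> serves as the Cauchy-Schwarz
    inequality between first and second moments.\<close>
  have "0 \<le> variance (\<lambda>\<xi>. \<bar>M \<xi>\<bar>)" by (rule variance_positive)
  also have "variance (\<lambda>\<xi>. \<bar>M \<xi>\<bar>) = (\<integral>\<xi>. (M \<xi>)\<^sup>2 \<partial>Q) - (\<integral>\<xi>. \<bar>M \<xi>\<bar> \<partial>Q)\<^sup>2"
    using int[of abs] int[of "\<lambda>a. a\<^sup>2"] by (subst variance_eq) auto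
  finally have "(\<integral>\<xi>. \<bar>M \<xi>\<bar> \<partial>Q)\<^sup>2 \<le> 4 * B\<^sup>2 * real n"
    using martingale_second_moment[of g B n, OF B] by (simp add: M_def)
  also have "\<dots> = (2 * B * sqrt n)\<^sup>2" by (simp add: power_mult_distrib)
  finally have M: "(\<integral>\<xi>. \<bar>M \<xi>\<bar> \<partial>Q) \<le> 2 * B * sqrt n"
    by (rule power2_le_imp_le) (use B0 in auto)
  have eq: "(\<Sum>k<n. g (\<xi> k) - transition g (\<xi> k)) = M \<xi> + g (\<xi> 0) - g (\<xi> n)" for \<xi>
    unfolding M_def by (induction n) auto
  have "(\<integral>\<xi>. \<bar>\<Sum>k<n. g (\<xi> k) - transition g (\<xi> k)\<bar> \<partial>Q) \<le> (\<integral>\<xi>. \<bar>M \<xi>\<bar> + 2 * B \<partial>Q)"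
  proof (rule integral_mono)
    show "integrable Q (\<lambda>\<xi>. \<bar>\<Sum>k<n. g (\<xi> k) - transition g (\<xi> k)\<bar>)"
      by (intro integrable_abs integrable_sum_at[of "\<lambda>x. g x - transition g x"])
    show "\<bar>\<Sum>k<n. g (\<xi> k) - transition g (\<xi> k)\<bar> \<le> \<bar>M \<xi>\<bar> + 2 * B" for \<xi>
      unfolding eq using B[of "\<xi> 0"] B[of "\<xi> n"] by linarith
  qed (use int[of abs] in auto)
  also have "\<dots> = (\<integral>\<xi>. \<bar>M \<xi>\<bar> \<partial>Q) + 2 * B"
    using int[of abs] by (simp add: prob_space)
  finally show ?thesis using M by simp
qed

text \<open>All hypotheses concern one fixed environment. Later \<open>g\<close> and
  \<open>r\<close> are functions on environments evaluated at the environment shifted by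
  \<open>x\<close>.\<close>

lemma total_var_deviation:
  assumes r: "\<And>x. \<bar>var_at x - c - (g x - transition g x)\<bar> \<le> r x"
    and l: "\<And>n. (\<Sum>y<n. r (int y)) \<le> l * real n" "\<And>n. (\<Sum>y<n. r (- int y)) \<le> l * real n"
    and B: "\<And>x. \<bar>g x\<bar> \<le> B"
  shows "(\<integral>\<xi>. \<bar>total_var m \<omega> \<xi> n - c * real n\<bar> \<partial>Q)
    \<le> l * (real_of_int m)\<^sup>2 / \<epsilon> * real n + 2 * B + 2 * B * sqrt n"
proof -
  have r0: "0 \<le> r x" for x using r[of x] by simp
  have "(\<integral>\<xi>. \<bar>total_var m \<omega> \<xi> n - c * real n\<bar> \<partial>Q) \<le>
    (\<integral>\<xi>. (\<Sum>k<n. r (\<xi> k)) + \<bar>\<Sum>k<n. g (\<xi> k) - transition g (\<xi> k)\<bar> \<partial>Q)"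
  proof (rule integral_mono)
    have "total_var m \<omega> \<xi> n - c * real n = (\<Sum>k<n. (\<lambda>x. var_at x - c) (\<xi> k))" for \<xi>
      by (simp add: total_var_eq sum_subtractf)
    then show "integrable Q (\<lambda>\<xi>. \<bar>total_var m \<omega> \<xi> n - c * real n\<bar>)"
      using integrable_sum_at[of "\<lambda>x. var_at x - c"] by (simp only: integrable_abs)
    show "integrable Q (\<lambda>\<xi>. (\<Sum>k<n. r (\<xi> k)) + \<bar>\<Sum>k<n. g (\<xi> k) - transition g (\<xi> k)\<bar>)"
      by (intro Bochner_Integration.integrable_add integrable_abs integrable_sum_at[of r]
        integrable_sum_at[of "\<lambda>x. g x - transition g x"])
    fix \<xi>
    have "total_var m \<omega> \<xi> n - c * real n =
      (\<Sum>k<n. var_at (\<xi> k) - c - (g (\<xi> k) - transition g (\<xi> k))) + (\<Sum>k<n. g (\<xi> k) - transition g (\<xi> k))"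
      by (simp add: total_var_eq sum_subtractf)
    moreover have "\<bar>\<Sum>k<n. var_at (\<xi> k) - c - (g (\<xi> k) - transition g (\<xi> k))\<bar> \<le> (\<Sum>k<n. r (\<xi> k))"
      by (rule order_trans[OF sum_abs]) (intro sum_mono r)
    ultimately show "\<bar>total_var m \<omega> \<xi> n - c * real n\<bar> \<le>
        (\<Sum>k<n. r (\<xi> k)) + \<bar>\<Sum>k<n. g (\<xi> k) - transition g (\<xi> k)\<bar>"
      by linarith
  qed
  also have "\<dots> = (\<integral>\<xi>. (\<Sum>k<n. r (\<xi> k)) \<partial>Q) + (\<integral>\<xi>. \<bar>\<Sum>k<n. g (\<xi> k) - transition g (\<xi> k)\<bar> \<partial>Q)"
    by (intro Bochner_Integration.integral_add integrable_abs integrable_sum_at[of r]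
        integrable_sum_at[of "\<lambda>x. g x - transition g x"])
  finally show ?thesis
    using occupation_bound[of r l n, OF r0 l] corrector_bound[of g B n, OF B] by linarith
qed

end

section \<open>Characteristic functions\<close>

text \<open>For \<open>y\<close> equal to half of u^2 times the step variance, \<open>1 - y\<close>
  is the quadratic Taylor polynomial of the characteristic function of a step, and
  \<open>exp y\<close> is the factor that compensates it.\<close>

lemma exp_times_one_minus:
  fixes y :: real
  assumes "0 \<le> y" "y \<le> 1 / 2"
  shows "\<bar>exp y * (1 - y) - 1\<bar> \<le> y\<^sup>2" and "exp y \<le> 2"
proof -
  have "1 - y \<le> exp (- y)" using exp_ge_add_one_self[of "- y"] by simp
  then have "exp y * (1 - y) \<le> exp y * exp (- y)" by (intro mult_left_mono) auto
  then have up: "exp y * (1 - y) \<le> 1" by (simp add: exp_minus)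
  have "(1 + y) * (1 - y) \<le> exp y * (1 - y)"
    using exp_ge_add_one_self[of y] assms by (intro mult_right_mono) auto
  then have "1 - y\<^sup>2 \<le> exp y * (1 - y)" by (simp add: power2_eq_square algebra_simps)
  with up show "\<bar>exp y * (1 - y) - 1\<bar> \<le> y\<^sup>2" by simp
  have "exp y * (1 / 2) \<le> exp y * (1 - y)" using assms by (intro mult_left_mono) auto
  with up show "exp y \<le> 2" by linarith
qed

lemma exp_diff_le:
  fixes a b K :: real
  assumes "a \<le> K" "b \<le> K"
  shows "\<bar>exp a - exp b\<bar> \<le> exp K * \<bar>a - b\<bar>"
proof -
  have *: "exp a - exp b \<le> exp K * \<bar>a - b\<bar>" if "a \<le> K" for a b :: real
  proof -
    have "exp a - exp b = exp a * (1 - exp (b - a))" by (simp add: algebra_simps flip: exp_add)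
    also have "\<dots> \<le> exp a * (a - b)"
      using exp_ge_add_one_self[of "b - a"] by (intro mult_left_mono) (auto simp: algebra_simps)
    also have "\<dots> \<le> exp a * \<bar>a - b\<bar>" by (intro mult_left_mono) auto
    also have "\<dots> \<le> exp K * \<bar>a - b\<bar>" using that by (intro mult_right_mono) auto
    finally show ?thesis .
  qed
  show ?thesis using *[of a b] *[of b a] assms by (simp add: abs_le_iff abs_minus_commute)
qed

context centered_walk
begin

text \<open>With c = |u| m at most 1, the Taylor remainder contributes at most (c^3 / 6) 2 and the
  compensation error at most c^4 / 4; together they stay below c^3.\<close>

lemma char_step:
  assumes u: "\<bar>u\<bar> * real_of_int m \<le> 1"
  shows "cmod ((\<Sum>j=-m..m. \<omega> x j *\<^sub>R iexp (u * real_of_int j)) * of_real (exp (u\<^sup>2 / 2 * var_at x)) - 1)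
    \<le> (\<bar>u\<bar> * real_of_int m) ^ 3"
proof -
  define c where "c = \<bar>u\<bar> * real_of_int m"
  define y where "y = u\<^sup>2 / 2 * var_at x"
  \<comment> \<open>\<open>R\<close> is the averaged remainder after the quadratic Taylor
    polynomial; centring makes the averaged polynomial itself equal to \<open>1 - y\<close>.\<close>
  define R where "R = (\<Sum>j=-m..m. \<omega> x j *\<^sub>R (iexp (u * real_of_int j) - (\<Sum>k\<le>2. (\<i> * of_real (u * real_of_int j))^k / fact k)))"
  have c: "0 \<le> c" "c \<le> 1" using u m_pos by (auto simp: c_def)
  have y: "0 \<le> y" "y \<le> c\<^sup>2 / 2"
    using mult_left_mono[OF var_at_le[of x], of "u\<^sup>2 / 2"] var_at_nonneg[of x]
    by (auto simp: y_def c_def power_mult_distrib)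
  have c2: "c\<^sup>2 \<le> 1" using c by (simp add: power_le_one)
  have "cmod R \<le> (\<Sum>j=-m..m. \<omega> x j * (c ^ 3 / 6))"
    unfolding R_def
  proof (rule sum_norm_le)
    fix j assume j: "j \<in> {-m..m}"
    have "cmod (iexp (u * real_of_int j) - (\<Sum>k\<le>2. (\<i> * of_real (u * real_of_int j))^k / fact k))
      \<le> \<bar>u * real_of_int j\<bar> ^ 3 / 6"
      using iexp_approx1[of "u * real_of_int j" 2] by (simp add: eval_nat_numeral)
    also have "\<dots> \<le> c ^ 3 / 6"
      using j by (intro divide_right_mono power_mono) (auto simp: c_def abs_mult intro!: mult_left_mono)
    finally show "cmod (\<omega> x j *\<^sub>R (iexp (u * real_of_int j) - (\<Sum>k\<le>2. (\<i> * of_real (u * real_of_int j))^k / fact k)))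
      \<le> \<omega> x j * (c ^ 3 / 6)"
      unfolding norm_scaleR by (simp only: abs_of_nonneg env_nonneg mult_left_mono)
  qed
  then have R: "cmod R \<le> c ^ 3 / 6"
    by (simp add: sum_divide_distrib[symmetric] sum_distrib_right[symmetric])
  have "(\<Sum>j=-m..m. \<omega> x j *\<^sub>R iexp (u * real_of_int j)) - R =
    (\<Sum>j=-m..m. of_real (\<omega> x j) + \<i> * of_real u * of_real (real_of_int j * \<omega> x j)
       - of_real (u\<^sup>2 / 2) * of_real ((real_of_int j)\<^sup>2 * \<omega> x j))"
    unfolding R_def sum_subtractf[symmetric]
    by (intro sum.cong) (auto simp: scaleR_conv_of_real eval_nat_numeral algebra_simps)
  also have "\<dots> = of_real (1 - y)"
    unfolding sum_subtractf sum.distrib sum_distrib_left[symmetric] of_real_sum[symmetric]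
    by (simp add: centered y_def var_at_def)
  finally have S: "(\<Sum>j=-m..m. \<omega> x j *\<^sub>R iexp (u * real_of_int j)) = of_real (1 - y) + R"
    by (simp add: algebra_simps)
  have yh: "y \<le> 1 / 2" using y(2) c2 by simp
  have "(of_real (1 - y) + R) * of_real (exp y) - 1 = of_real (exp y * (1 - y) - 1) + R * of_real (exp y)"
    by (simp add: algebra_simps)
  then have "cmod ((of_real (1 - y) + R) * of_real (exp y) - 1)
      \<le> \<bar>exp y * (1 - y) - 1\<bar> + cmod R * exp y"
    by (metis norm_triangle_ineq norm_of_real norm_mult abs_exp_cancel)
  also have "\<dots> \<le> y\<^sup>2 + c ^ 3 / 6 * 2"
    using exp_times_one_minus[OF y(1) yh] R c by (intro add_mono mult_mono) auto
  also have "y\<^sup>2 \<le> (c\<^sup>2 / 2)\<^sup>2" using y by (intro power_mono)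
  also have "(c\<^sup>2 / 2)\<^sup>2 = c ^ 3 * (c / 4)" by (simp add: power2_eq_square eval_nat_numeral)
  also have "\<dots> \<le> c ^ 3 * (1 / 4)" using c by (intro mult_left_mono) auto
  finally have "cmod ((of_real (1 - y) + R) * of_real (exp y) - 1) \<le> c ^ 3"
    using zero_le_power[OF c(1), of 3] by linarith
  then show ?thesis unfolding S by (simp add: y_def c_def)
qed

text \<open>The increments are switched on and off by a predictable sequence \<open>b\<close>; this covers both the walk
  at a fixed time and the walk stopped at \<^const>\<open>var_time\<close>.\<close>

definition switched_sum :: "(nat \<Rightarrow> (nat \<Rightarrow> int) \<Rightarrow> bool) \<Rightarrow> nat \<Rightarrow> (nat \<Rightarrow> int) \<Rightarrow> real" where
  "switched_sum b n \<xi> = (\<Sum>k<n. of_bool (b k \<xi>) * real_of_int (\<xi> (Suc k) - \<xi> k))"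

definition switched_var :: "(nat \<Rightarrow> (nat \<Rightarrow> int) \<Rightarrow> bool) \<Rightarrow> nat \<Rightarrow> (nat \<Rightarrow> int) \<Rightarrow> real" where
  "switched_var b n \<xi> = (\<Sum>k<n. of_bool (b k \<xi>) * var_at (\<xi> k))"

lemma depends_upto_switched:
  assumes "\<And>k. depends_upto k (b k)"
  shows "depends_upto n (\<lambda>\<xi>. f (switched_sum b n \<xi>) (switched_var b n \<xi>))"
proof -
  have b: "b k \<xi> = b k \<eta>" if "\<And>s. s \<le> n \<Longrightarrow> \<xi> s = \<eta> s" "k \<le> n" for \<xi> \<eta> k
    using assms[of k] that unfolding depends_upto_def by (meson order_trans)
  have S: "switched_sum b n \<xi> = switched_sum b n \<eta>" and V: "switched_var b n \<xi> = switched_var b n \<eta>"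
    if eq: "\<And>s. s \<le> n \<Longrightarrow> \<xi> s = \<eta> s" for \<xi> \<eta>
  proof -
    have b': "b k \<xi> = b k \<eta>" if "k < n" for k by (rule b) (use eq that in auto)
    show "switched_sum b n \<xi> = switched_sum b n \<eta>"
      unfolding switched_sum_def by (rule sum.cong) (auto simp: b' eq)
    show "switched_var b n \<xi> = switched_var b n \<eta>"
      unfolding switched_var_def by (rule sum.cong) (auto simp: b' eq)
  qed
  show ?thesis
    unfolding depends_upto_def
  proof (intro allI impI)
    fix \<xi> \<eta> :: "nat \<Rightarrow> int" assume "\<forall>s\<le>n. \<xi> s = \<eta> s"
    then have eq: "\<And>s. s \<le> n \<Longrightarrow> \<xi> s = \<eta> s" by blast
    show "f (switched_sum b n \<xi>) (switched_var b n \<xi>) = f (switched_sum b n \<eta>) (switched_var b n \<eta>)"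
      by (intro arg_cong2[where f=f] S V eq)
  qed
qed

lemma switched_var_bounds:
  "0 \<le> switched_var b n \<xi>" "switched_var b n \<xi> \<le> (real_of_int m)\<^sup>2 * real n"
proof -
  show "0 \<le> switched_var b n \<xi>"
    unfolding switched_var_def by (intro sum_nonneg) (simp add: var_at_nonneg)
  have "switched_var b n \<xi> \<le> (\<Sum>k<n. (real_of_int m)\<^sup>2)"
    unfolding switched_var_def by (intro sum_mono) (auto simp: var_at_le of_bool_def)
  then show "switched_var b n \<xi> \<le> (real_of_int m)\<^sup>2 * real n" by (simp add: mult.commute)
qed

text \<open>The compensated exponential is almost a martingale: a step that is switched off leaves
  it unchanged, and one that is switched on changes its conditional mean by a relative error of at
  most (|u| m)^3. Its modulus is at most \<open>exp K\<close> throughout the horizon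
  \<open>N\<close>, which is kept apart from \<open>n\<close> so that \<open>K\<close> is fixed
  during the induction.\<close>

lemma switched_char:
  assumes b: "\<And>k. depends_upto k (b k)" and u: "\<bar>u\<bar> * real_of_int m \<le> 1"
    and K: "u\<^sup>2 / 2 * ((real_of_int m)\<^sup>2 * real N) \<le> K" and n: "n \<le> N"
  shows "cmod ((\<integral>\<xi>. iexp (u * switched_sum b n \<xi>) * of_real (exp (u\<^sup>2 / 2 * switched_var b n \<xi>)) \<partial>Q) - 1)
    \<le> real n * ((\<bar>u\<bar> * real_of_int m) ^ 3 * exp K)"
  using n
proof (induction n)
  case 0
  then show ?case by (simp add: switched_sum_def switched_var_def)
next
  case (Suc n)
  define Z where "Z = (\<lambda>n \<xi>. iexp (u * switched_sum b n \<xi>) * of_real (exp (u\<^sup>2 / 2 * switched_var b n \<xi>)))"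
  \<comment> \<open>\<open>W\<close> is the conditional expectation of \<open>Z (Suc n)\<close>
    given the first \<open>n\<close> steps.\<close>
  define W where "W = (\<lambda>\<xi>. \<Sum>j=-m..m. \<omega> (\<xi> n) j *\<^sub>R Z (Suc n) (extend_path \<xi> n j))"
  let ?d = "(\<bar>u\<bar> * real_of_int m) ^ 3"
  have depZ: "depends_upto n (Z n)" for n
    unfolding Z_def by (rule depends_upto_switched[OF b, where f="\<lambda>s v. iexp (u * s) * of_real (exp (u\<^sup>2 / 2 * v))"])
  have depW: "depends_upto n W"
    unfolding W_def by (rule depends_upto_step[OF depZ])
  have d0: "0 \<le> ?d" using m_pos by simp
  have W: "cmod (W \<xi> - Z n \<xi>) \<le> ?d * exp K" for \<xi>
  proof -
    have bn: "b k (extend_path \<xi> n j) = b k \<xi>" if "k \<le> n" for k j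
      by (rule depends_uptoD[OF b]) (use that in simp)
    have S: "switched_sum b (Suc n) (extend_path \<xi> n j) = switched_sum b n \<xi> + of_bool (b n \<xi>) * real_of_int j" for j
      unfolding switched_sum_def using bn by simp
    have V: "switched_var b (Suc n) (extend_path \<xi> n j) = switched_var b n \<xi> + of_bool (b n \<xi>) * var_at (\<xi> n)" for j
      unfolding switched_var_def using bn by simp
    have "cmod (W \<xi> - Z n \<xi>) \<le> ?d * cmod (Z n \<xi>)"
    proof (cases "b n \<xi>")
      case False
      then have "W \<xi> = Z n \<xi>"
        unfolding W_def Z_def S V by (simp add: scaleR_sum_left[symmetric])
      then show ?thesis using d0 by simp
    next
      case True
      have "W \<xi> = Z n \<xi> * ((\<Sum>j=-m..m. \<omega> (\<xi> n) j *\<^sub>R iexp (u * real_of_int j)) * of_real (exp (u\<^sup>2 / 2 * var_at (\<xi> n))))"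
        unfolding W_def Z_def S V sum_distrib_left sum_distrib_right using True
        by (intro sum.cong refl) (simp add: algebra_simps exp_add)
      then have "W \<xi> - Z n \<xi> = Z n \<xi> * ((\<Sum>j=-m..m. \<omega> (\<xi> n) j *\<^sub>R iexp (u * real_of_int j)) * of_real (exp (u\<^sup>2 / 2 * var_at (\<xi> n))) - 1)"
        by (simp add: algebra_simps)
      then show ?thesis
        using char_step[OF u, of "\<xi> n"] by (simp add: norm_mult mult.commute mult_left_mono)
    qed
    also have "cmod (Z n \<xi>) = exp (u\<^sup>2 / 2 * switched_var b n \<xi>)"
      unfolding Z_def by (simp add: norm_mult)
    also have "u\<^sup>2 / 2 * switched_var b n \<xi> \<le> u\<^sup>2 / 2 * ((real_of_int m)\<^sup>2 * real N)"
    proof (rule mult_left_mono)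
      have "(real_of_int m)\<^sup>2 * real n \<le> (real_of_int m)\<^sup>2 * real N"
        using Suc.prems by (intro mult_left_mono) auto
      with switched_var_bounds(2)[of b n \<xi>]
      show "switched_var b n \<xi> \<le> (real_of_int m)\<^sup>2 * real N" by linarith
    qed simp
    also note K
    finally show ?thesis using d0 by (simp add: mult_left_mono)
  qed
  have "(\<integral>\<xi>. Z (Suc n) \<xi> \<partial>Q) = (\<integral>\<xi>. W \<xi> \<partial>Q)"
    unfolding W_def by (rule integral_markov[OF depZ])
  then have "(\<integral>\<xi>. Z (Suc n) \<xi> \<partial>Q) - (\<integral>\<xi>. Z n \<xi> \<partial>Q) = (\<integral>\<xi>. W \<xi> - Z n \<xi> \<partial>Q)"
    using integrable_depends_upto[OF depW] integrable_depends_upto[OF depZ, of n] by simp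
  then have "cmod ((\<integral>\<xi>. Z (Suc n) \<xi> \<partial>Q) - (\<integral>\<xi>. Z n \<xi> \<partial>Q)) \<le> (\<integral>\<xi>. cmod (W \<xi> - Z n \<xi>) \<partial>Q)"
    by (simp only: integral_norm_bound)
  also have "\<dots> \<le> (\<integral>\<xi>. ?d * exp K \<partial>Q)"
    using integrable_depends_upto[OF depW] integrable_depends_upto[OF depZ, of n]
    by (intro integral_mono W integrable_norm) auto
  also have "\<dots> = ?d * exp K" by simp
  finally have "cmod ((\<integral>\<xi>. Z (Suc n) \<xi> \<partial>Q) - (\<integral>\<xi>. Z n \<xi> \<partial>Q)) \<le> ?d * exp K" .
  moreover have "cmod ((\<integral>\<xi>. Z n \<xi> \<partial>Q) - 1) \<le> real n * (?d * exp K)"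
    using Suc by (simp add: Z_def)
  ultimately have "cmod ((\<integral>\<xi>. Z (Suc n) \<xi> \<partial>Q) - 1) \<le> ?d * exp K + real n * (?d * exp K)"
    using norm_triangle_ineq[of "(\<integral>\<xi>. Z (Suc n) \<xi> \<partial>Q) - (\<integral>\<xi>. Z n \<xi> \<partial>Q)" "(\<integral>\<xi>. Z n \<xi> \<partial>Q) - 1"] by simp
  then show ?case by (simp add: Z_def algebra_simps)
qed

text \<open>The random compensator is replaced by the constant \<open>exp v\<close>. Both exponents
  are at most \<open>K\<close>, where exp is Lipschitz with constant \<open>exp K\<close>, so
  closeness of the variance in L^1 is enough. Dividing by \<open>exp v\<close>, which is at least 1,
  keeps the bound.\<close>

lemma switched_char_gaussian:
  assumes b: "\<And>k. depends_upto k (b k)" and u: "\<bar>u\<bar> * real_of_int m \<le> 1"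
    and K: "u\<^sup>2 / 2 * ((real_of_int m)\<^sup>2 * real n) \<le> K" and v: "0 \<le> v" "v \<le> K"
  shows "cmod ((\<integral>\<xi>. iexp (u * switched_sum b n \<xi>) \<partial>Q) - of_real (exp (- v)))
    \<le> exp K * (real n * (\<bar>u\<bar> * real_of_int m) ^ 3 + (\<integral>\<xi>. \<bar>u\<^sup>2 / 2 * switched_var b n \<xi> - v\<bar> \<partial>Q))"
proof -
  define X where "X = (\<lambda>\<xi>. iexp (u * switched_sum b n \<xi>))"
  define Y where "Y = (\<lambda>\<xi>. exp (u\<^sup>2 / 2 * switched_var b n \<xi>))"
  have int: "integrable Q (\<lambda>\<xi>. f (switched_sum b n \<xi>) (switched_var b n \<xi>))"
    for f :: "real \<Rightarrow> real \<Rightarrow> 'c::{banach, second_countable_topology}"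
    by (rule integrable_depends_upto[OF depends_upto_switched[OF b]])
  have iX: "integrable Q X" unfolding X_def by (rule int[of "\<lambda>s _. iexp (u * s)"])
  have iXY: "integrable Q (\<lambda>\<xi>. X \<xi> * of_real (Y \<xi>))"
    unfolding X_def Y_def by (rule int[of "\<lambda>s v. iexp (u * s) * of_real (exp (u\<^sup>2 / 2 * v))"])
  have id: "integrable Q (\<lambda>\<xi>. \<bar>u\<^sup>2 / 2 * switched_var b n \<xi> - v\<bar>)"
    by (rule int[of "\<lambda>_ a. \<bar>u\<^sup>2 / 2 * a - v\<bar>"])
  let ?I = "\<integral>\<xi>. \<bar>u\<^sup>2 / 2 * switched_var b n \<xi> - v\<bar> \<partial>Q"
  have "(\<integral>\<xi>. X \<xi> * of_real (exp v) \<partial>Q) - (\<integral>\<xi>. X \<xi> * of_real (Y \<xi>) \<partial>Q) = (\<integral>\<xi>. X \<xi> * of_real (exp v) - X \<xi> * of_real (Y \<xi>) \<partial>Q)"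
    using iX iXY by simp
  then have "cmod ((\<integral>\<xi>. X \<xi> * of_real (exp v) \<partial>Q) - (\<integral>\<xi>. X \<xi> * of_real (Y \<xi>) \<partial>Q))
      \<le> (\<integral>\<xi>. cmod (X \<xi> * of_real (exp v) - X \<xi> * of_real (Y \<xi>)) \<partial>Q)"
    by (simp only: integral_norm_bound)
  also have "\<dots> \<le> (\<integral>\<xi>. exp K * \<bar>u\<^sup>2 / 2 * switched_var b n \<xi> - v\<bar> \<partial>Q)"
  proof (rule integral_mono)
    fix \<xi>
    have "X \<xi> * of_real (exp v) - X \<xi> * of_real (Y \<xi>) = X \<xi> * of_real (exp v - Y \<xi>)"
      by (simp add: algebra_simps)
    then have "cmod (X \<xi> * of_real (exp v) - X \<xi> * of_real (Y \<xi>)) = \<bar>exp v - Y \<xi>\<bar>"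
      by (simp only: norm_mult norm_of_real) (simp add: X_def)
    also have "\<dots> = \<bar>Y \<xi> - exp v\<bar>" by simp
    also have "\<dots> \<le> exp K * \<bar>u\<^sup>2 / 2 * switched_var b n \<xi> - v\<bar>"
      unfolding Y_def
    proof (rule exp_diff_le)
      have "u\<^sup>2 / 2 * switched_var b n \<xi> \<le> u\<^sup>2 / 2 * ((real_of_int m)\<^sup>2 * real n)"
        by (intro mult_left_mono switched_var_bounds) auto
      with K show "u\<^sup>2 / 2 * switched_var b n \<xi> \<le> K" by simp
    qed fact
    finally show "cmod (X \<xi> * of_real (exp v) - X \<xi> * of_real (Y \<xi>)) \<le> exp K * \<bar>u\<^sup>2 / 2 * switched_var b n \<xi> - v\<bar>" .
  qed (use iX iXY id in auto)
  also have "\<dots> = exp K * ?I" by simp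
  finally have 1: "cmod ((\<integral>\<xi>. X \<xi> * of_real (exp v) \<partial>Q) - (\<integral>\<xi>. X \<xi> * of_real (Y \<xi>) \<partial>Q)) \<le> exp K * ?I" .
  have 2: "cmod ((\<integral>\<xi>. X \<xi> * of_real (Y \<xi>) \<partial>Q) - 1) \<le> real n * ((\<bar>u\<bar> * real_of_int m) ^ 3 * exp K)"
    unfolding X_def Y_def by (rule switched_char[OF b u K order_refl])
  have 3: "cmod ((\<integral>\<xi>. X \<xi> * of_real (exp v) \<partial>Q) - 1) \<le> exp K * (real n * (\<bar>u\<bar> * real_of_int m) ^ 3 + ?I)"
    using norm_triangle_ineq[of "(\<integral>\<xi>. X \<xi> * of_real (exp v) \<partial>Q) - (\<integral>\<xi>. X \<xi> * of_real (Y \<xi>) \<partial>Q)" "(\<integral>\<xi>. X \<xi> * of_real (Y \<xi>) \<partial>Q) - 1"] 1 2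
    by (simp add: algebra_simps)
  have "(\<integral>\<xi>. X \<xi> \<partial>Q) - of_real (exp (- v)) = of_real (exp (- v)) * ((\<integral>\<xi>. X \<xi> * of_real (exp v) \<partial>Q) - 1)"
    using iX by (simp add: algebra_simps exp_minus flip: of_real_mult)
  then have "cmod ((\<integral>\<xi>. X \<xi> \<partial>Q) - of_real (exp (- v))) = exp (- v) * cmod ((\<integral>\<xi>. X \<xi> * of_real (exp v) \<partial>Q) - 1)"
    by (simp only: norm_mult norm_of_real abs_exp_cancel)
  also have "\<dots> \<le> 1 * cmod ((\<integral>\<xi>. X \<xi> * of_real (exp v) \<partial>Q) - 1)"
    using v by (intro mult_right_mono) auto
  finally show ?thesis using 3 by (simp add: X_def)
qed

end

section \<open>Quenched central limit theorems\<close>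

text \<open>Polya's theorem: convergence at finitely many quantiles of \<open>N\<close>, at levels i
  / K, combined with monotonicity controls all other points up to 1 / K.\<close>

lemma uniform_limit_cdf:
  fixes M :: "nat \<Rightarrow> real measure"
  assumes M: "\<And>n. real_distribution (M n)" and N: "real_distribution N"
    and conv: "weak_conv_m M N" and cont: "\<And>x. isCont (cdf N) x"
  shows "uniform_limit UNIV (\<lambda>n. cdf (M n)) (cdf N) sequentially"
proof (rule uniform_limitI)
  fix e :: real assume e: "0 < e"
  interpret M: real_distribution "M n" for n by (rule M)
  interpret N: real_distribution N by (rule N)
  obtain k where k: "1 / real (Suc k) < e / 2"
    using reals_Archimedean[of "e / 2"] e by (auto simp: inverse_eq_divide)
  define K where "K = Suc k"
  have K: "0 < K" "1 / real K < e / 2" using k by (auto simp: K_def)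
  have ex: "\<exists>x. cdf N x = y" if y: "0 < y" "y < 1" for y
  proof -
    obtain a where a: "cdf N a < y"
      using order_tendstoD(2)[OF N.cdf_lim_at_bot y(1)] by (auto simp: eventually_at_bot_linorder)
    obtain b where b: "y < cdf N b"
      using order_tendstoD(1)[OF N.cdf_lim_at_top_prob y(2)] by (auto simp: eventually_at_top_linorder)
    have "a \<le> b" using a b N.cdf_nondecreasing[of b a] by (cases "a \<le> b") auto
    then show ?thesis
      using IVT[of "cdf N" a y b] a b cont by auto
  qed
  \<comment> \<open>By continuity and the limits 0 and 1 at infinity, every level strictly between 0
    and 1 is attained; \<open>q i\<close> is meaningful only for 0 < i < K.\<close>
  define q where "q = (\<lambda>i::nat. SOME x. cdf N x = real i / real K)"
  have q: "cdf N (q i) = real i / real K" if "0 < i" "i < K" for i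
    unfolding q_def by (rule someI_ex, rule ex) (use that in auto)
  have "\<forall>\<^sub>F n in sequentially. \<forall>i\<in>{0<..<K}. \<bar>cdf (M n) (q i) - cdf N (q i)\<bar> < e / 2"
  proof (rule eventually_ball_finite, simp, rule ballI)
    fix i
    have "(\<lambda>n. cdf (M n) (q i)) \<longlonglongrightarrow> cdf N (q i)"
      using conv cont by (simp add: weak_conv_m_def weak_conv_def)
    then show "\<forall>\<^sub>F n in sequentially. \<bar>cdf (M n) (q i) - cdf N (q i)\<bar> < e / 2"
      using e by (auto dest!: tendstoD[of _ _ _ "e / 2"] simp: dist_real_def)
  qed
  then show "\<forall>\<^sub>F n in sequentially. \<forall>x\<in>UNIV. dist (cdf (M n) x) (cdf N x) < e"
  proof eventually_elim
    case (elim n)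
    have "cdf N x - e < cdf (M n) x" for x
    proof (cases "cdf N x \<le> 1 / real K")
      case True
      then show ?thesis using M.cdf_nonneg[of n x] K e by linarith
    next
      case False
      \<comment> \<open>The greatest integer strictly below K times the cdf at \<open>x\<close>;
        strictness puts the quantile \<open>q i\<close> to the left of \<open>x\<close>.\<close>
      define i where "i = nat (\<lceil>real K * cdf N x\<rceil> - 1)"
      have F: "1 < real K * cdf N x" using False K by (simp add: field_simps)
      have F1: "real K * cdf N x \<le> real K * 1" by (intro mult_left_mono N.cdf_bounded_prob) auto
      have i: "real i < real K * cdf N x" "real K * cdf N x \<le> real i + 1" "0 < i"
        using F unfolding i_def by linarith+
      have iK: "i < K" using i(1) F1 by linarith
      have lt: "real i / real K < cdf N x" "cdf N x \<le> real i / real K + 1 / real K"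
        using i K by (simp_all add: field_simps)
      then have "q i < x" using q[OF i(3) iK] N.cdf_nondecreasing[of x "q i"] by (cases "q i < x") auto
      then have "cdf (M n) (q i) \<le> cdf (M n) x" by (intro M.cdf_nondecreasing) simp
      moreover have "\<bar>cdf (M n) (q i) - real i / real K\<bar> < e / 2"
        using bspec[OF elim, of i] i(3) iK q[OF i(3) iK] by simp
      ultimately show ?thesis using lt K by linarith
    qed
    moreover have "cdf (M n) x < cdf N x + e" for x
    proof -
      \<comment> \<open>The least integer strictly above K times the cdf at \<open>x\<close>. Either
        \<open>q i\<close> is a quantile to the right of \<open>x\<close>, or i >= K and the trivial
        bound 1 on the cdf suffices.\<close>
      define i where "i = nat (\<lfloor>real K * cdf N x\<rfloor> + 1)"
      have "0 \<le> real K * cdf N x" using N.cdf_nonneg[of x] by simp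
      then have i: "real K * cdf N x < real i" "real i \<le> real K * cdf N x + 1" "0 < i"
        unfolding i_def by linarith+
      have lt: "cdf N x < real i / real K" "real i / real K \<le> cdf N x + 1 / real K"
        using i K by (simp_all add: field_simps)
      show ?thesis
      proof (cases "i < K")
        case True
        have "x < q i" using lt q[OF i(3) True] N.cdf_nondecreasing[of "q i" x] by (cases "x < q i") auto
        then have "cdf (M n) x \<le> cdf (M n) (q i)" by (intro M.cdf_nondecreasing) simp
        moreover have "\<bar>cdf (M n) (q i) - real i / real K\<bar> < e / 2"
          using bspec[OF elim, of i] i(3) True q[OF i(3) True] by simp
        ultimately show ?thesis using lt K by linarith
      next
        case False
        then have "1 \<le> real i / real K" using K by (simp add: field_simps)
        then show ?thesis using M.cdf_bounded_prob[of n x] lt K e by linarith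
      qed
    qed
    ultimately show ?case by (auto simp: dist_real_def abs_less_iff)  
       (smt (verit))+
  qed
qed

lemma isCont_cdf_std_normal: "isCont (cdf std_normal_distribution) x"
proof -
  interpret real_distribution std_normal_distribution by (rule real_dist_normal_dist)
  have "emeasure std_normal_distribution {x} = 0"
    by (subst emeasure_density) (auto simp: nn_integral_0_iff_AE indicator_def intro!: AE_I[where N="{x}"])
  then show ?thesis by (simp add: isCont_cdf measure_def)
qed

lemma cdf_std_normal_scaled:
  assumes "0 < \<sigma>"
  shows "cdf std_normal_distribution (x / \<sigma>) = 1 / (sqrt (2 * pi) * \<sigma>) * (LBINT u:{..x}. exp (- u\<^sup>2 / (2 * \<sigma>\<^sup>2)))"
proof -
  interpret real_distribution std_normal_distribution by (rule real_dist_normal_dist)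
  have "cdf std_normal_distribution (x / \<sigma>) = (\<integral>u. indicator {..x / \<sigma>} u \<partial>std_normal_distribution)"
    by (simp add: cdf_def)
  also have "\<dots> = (\<integral>u. std_normal_density u * indicator {..x / \<sigma>} u \<partial>lborel)"
    by (subst integral_density) auto
  also have "\<dots> = \<bar>1 / \<sigma>\<bar> *\<^sub>R (\<integral>u. std_normal_density (0 + (1 / \<sigma>) * u) * indicator {..x / \<sigma>} (0 + (1 / \<sigma>) * u) \<partial>lborel)"
    using assms by (intro lborel_integral_real_affine) auto
  also have "(\<lambda>u. std_normal_density (0 + (1 / \<sigma>) * u) * indicator {..x / \<sigma>} (0 + (1 / \<sigma>) * u))
      = (\<lambda>u. (1 / sqrt (2 * pi)) * (indicator {..x} u *\<^sub>R exp (- u\<^sup>2 / (2 * \<sigma>\<^sup>2))))"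
    using assms by (auto simp: fun_eq_iff std_normal_density_def indicator_def field_simps)
  finally show ?thesis
    using assms by (simp add: set_lebesgue_integral_def)
qed

section \<open>The stopping time and the two limit theorems in a fixed environment\<close>

context centered_walk
begin

lemma total_var_Suc: "total_var m \<omega> \<xi> (Suc n) = total_var m \<omega> \<xi> n + var_at (\<xi> n)"
  by (simp add: total_var_eq)

lemma total_var_0 [simp]: "total_var m \<omega> \<xi> 0 = 0"
  by (simp add: total_var_eq)

lemma total_var_mono: "k \<le> n \<Longrightarrow> total_var m \<omega> \<xi> k \<le> total_var m \<omega> \<xi> n"
  by (rule lift_Suc_mono_le[of "total_var m \<omega> \<xi>"]) (simp_all add: total_var_Suc var_at_nonneg)

lemma total_var_ge: "2 * \<epsilon> * real n \<le> total_var m \<omega> \<xi> n"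
proof (induction n)
  case (Suc n)
  then show ?case using var_at_ge[of "\<xi> n"] by (simp add: total_var_Suc algebra_simps)
qed simp

text \<open>Each step adds between \<open>2 * \<epsilon>\<close> and \<open>m^2\<close> to the total
  variance: the lower bound gives a deterministic horizon, the upper one limits the overshoot beyond
  \<open>t\<close>. The first property shows that whether the walk is still running at time
  \<open>k\<close> is decided by the positions before \<open>k\<close>.\<close>

lemma var_time_props:
  assumes t: "0 < t"
  shows "k < var_time m \<omega> \<xi> t \<longleftrightarrow> total_var m \<omega> \<xi> k < t"
    and "real (var_time m \<omega> \<xi> t) \<le> t / (2 * \<epsilon>) + 1"
    and "t \<le> total_var m \<omega> \<xi> (var_time m \<omega> \<xi> t)"
    and "total_var m \<omega> \<xi> (var_time m \<omega> \<xi> t) \<le> t + (real_of_int m)\<^sup>2"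
proof -
  let ?P = "\<lambda>n. 1 \<le> n \<and> t \<le> total_var m \<omega> \<xi> n"
  let ?T = "var_time m \<omega> \<xi> t"
  have T: "?T = (LEAST n. ?P n)" by (simp add: var_time_def Inf_nat_def)
  obtain n where n: "t / (2 * \<epsilon>) \<le> real n" using real_arch_simple by blast
  then have "t \<le> 2 * \<epsilon> * real n" using eps_pos by (simp add: field_simps)
  then have "t \<le> total_var m \<omega> \<xi> n" using total_var_ge[of n \<xi>] by linarith
  moreover from this have "1 \<le> n" using t by (cases n) auto
  ultimately have "?P n" by blast
  then have PT: "?P ?T" unfolding T by (rule LeastI)
  then show "t \<le> total_var m \<omega> \<xi> ?T" by blast
  show less: "k < ?T \<longleftrightarrow> total_var m \<omega> \<xi> k < t" for k
  proof
    assume k: "k < ?T"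
    show "total_var m \<omega> \<xi> k < t"
    \<comment> \<open>The infimum ranges over n >= 1, so minimality is silent at 0; there the total
      variance is 0, which is below \<open>t\<close>.\<close>
    proof (cases "k = 0")
      case False
      then show ?thesis using not_less_Least[of k ?P] k unfolding T by auto
    qed (simp add: t)
  next
    assume "total_var m \<omega> \<xi> k < t"
    then show "k < ?T" using total_var_mono[of ?T k \<xi>] PT by (cases "k < ?T") auto
  qed
  from PT obtain k where k: "?T = Suc k" by (cases ?T) auto
  then have lt: "total_var m \<omega> \<xi> k < t" using less[of k] by simp
  then have "2 * \<epsilon> * real k \<le> t" using total_var_ge[of k \<xi>] by linarith
  then have "real k \<le> t / (2 * \<epsilon>)" using eps_pos by (simp add: field_simps)
  then show "real ?T \<le> t / (2 * \<epsilon>) + 1" by (simp add: k)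
  show "total_var m \<omega> \<xi> ?T \<le> t + (real_of_int m)\<^sup>2"
    using lt var_at_le[of "\<xi> k"] by (simp add: k total_var_Suc)
qed

lemma switched_until:
  assumes "\<And>k. b k \<xi> \<longleftrightarrow> k < T"
  shows "switched_sum b n \<xi> = real_of_int (\<xi> (min n T) - \<xi> 0)"
    and "switched_var b n \<xi> = total_var m \<omega> \<xi> (min n T)"
proof -
  have m: "min (Suc n) T = (if n < T then Suc n else min n T)" "n < T \<Longrightarrow> min n T = n" for n by auto
  show "switched_sum b n \<xi> = real_of_int (\<xi> (min n T) - \<xi> 0)"
    by (induction n) (simp_all add: switched_sum_def assms m)
  show "switched_var b n \<xi> = total_var m \<omega> \<xi> (min n T)"
    by (induction n) (simp_all add: switched_var_def assms m total_var_Suc)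
qed

lemma at_measurable [measurable]: "(\<lambda>\<xi>. \<xi> n) \<in> measurable Q (count_space UNIV)"
  by (simp add: measurable_cong_sets[OF sets_Q refl])

text \<open>Equality is asked only almost everywhere, because switched sums measure the displacement
  from \<open>\<xi> 0\<close>, which is 0 only almost surely.\<close>

lemma char_distr_eq:
  assumes X: "X \<in> borel_measurable Q" and Y: "Y \<in> borel_measurable Q"
    and eq: "AE \<xi> in Q. \<theta> * X \<xi> = u * Y \<xi>"
  shows "char (distr Q borel X) \<theta> = (\<integral>\<xi>. iexp (u * Y \<xi>) \<partial>Q)"
proof -
  have "char (distr Q borel X) \<theta> = (\<integral>\<xi>. iexp (\<theta> * X \<xi>) \<partial>Q)"
    unfolding char_def using X by (subst integral_distr) auto
  also have "\<dots> = (\<integral>\<xi>. iexp (u * Y \<xi>) \<partial>Q)"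
  proof (rule integral_cong_AE)
    show "AE \<xi> in Q. iexp (\<theta> * X \<xi>) = iexp (u * Y \<xi>)"
      using eq by eventually_elim (simp only:)
  qed (use X Y in measurable)
  finally show ?thesis .
qed

lemma switched_sum_measurable:
  "(\<And>k. depends_upto k (b k)) \<Longrightarrow> switched_sum b n \<in> borel_measurable Q"
  using depends_upto_measurable[OF depends_upto_switched[of b n "\<lambda>s _. s"]]
  by (simp add: measurable_cong_sets[OF sets_Q refl])

lemma clt_var_time:
  "weak_conv_at_top (\<lambda>t. distr Q borel (\<lambda>\<xi>. real_of_int (\<xi> (var_time m \<omega> \<xi> t)) / sqrt t))
     std_normal_distribution"
  unfolding weak_conv_at_top_iff
proof (intro allI impI)
  fix \<tau> :: "nat \<Rightarrow> real" assume \<tau>: "filterlim \<tau> at_top sequentially"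
  define X where "X = (\<lambda>t \<xi>. real_of_int (\<xi> (var_time m \<omega> \<xi> t)) / sqrt t)"
  have X: "X t \<in> borel_measurable Q" for t
    unfolding X_def using measurable_compose[OF walk_at_var_time_measurable, of "\<lambda>x. real_of_int x / sqrt t" borel m \<omega> t]
    by (simp add: measurable_cong_sets[OF sets_Q refl])
  have "weak_conv_m (\<lambda>n. distr Q borel (X (\<tau> n))) std_normal_distribution"
  proof (rule levy_continuity)
    show "real_distribution (distr Q borel (X (\<tau> n)))" for n
      by (rule real_distribution_distr[OF X])
    show "real_distribution std_normal_distribution" by (rule real_dist_normal_dist)
    fix \<theta> :: real
    \<comment> \<open>\<open>K\<close> dominates the target exponent \<open>\<theta>^2 / 2\<close>
      and the exponents of all compensators, uniformly in \<open>t\<close>. In \<open>d\<close>, the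
      first term is the accumulated cubic error over the horizon, the second the effect of the
      overshoot.\<close>
    define K where "K = \<theta>\<^sup>2 / 2 + \<theta>\<^sup>2 / 2 * (real_of_int m)\<^sup>2 * (1 / (2 * \<epsilon>) + 2)"
    define d where "d = (\<lambda>t. (1 / (2 * \<epsilon>) + 2) * (\<bar>\<theta>\<bar> * real_of_int m) ^ 3 / sqrt t + \<theta>\<^sup>2 / 2 * (real_of_int m)\<^sup>2 / t)"
    have bound: "cmod (char (distr Q borel (X t)) \<theta> - of_real (exp (- (\<theta>\<^sup>2 / 2)))) \<le> exp K * d t"
      if t1: "1 \<le> t" and t2: "(\<bar>\<theta>\<bar> * real_of_int m)\<^sup>2 \<le> t" for t
    proof -
      define u where "u = \<theta> / sqrt t"
      \<comment> \<open>A deterministic time by which the walk has certainly been stopped, so the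
        stopped walk is a switched sum of fixed length. For t >= 1 it is at most (1 / (2 \<epsilon>)
        + 2) t.\<close>
      define N where "N = nat \<lceil>t / (2 * \<epsilon>) + 1\<rceil>"
      define b where "b = (\<lambda>k \<xi>. total_var m \<omega> \<xi> k < t)"
      let ?m = "real_of_int m"
      have t: "0 < t" using t1 by simp
      have te: "0 \<le> t / (2 * \<epsilon>)" using t eps_pos by simp
      have N: "t / (2 * \<epsilon>) + 1 \<le> real N" "real N \<le> t / (2 * \<epsilon>) + 2"
        unfolding N_def using te by linarith+
      have N': "real N \<le> (1 / (2 * \<epsilon>) + 2) * t"
        using N(2) t1 by (simp add: algebra_simps)
      have TN: "var_time m \<omega> \<xi> t \<le> N" for \<xi>
        using var_time_props(2)[OF t, of \<xi>] N(1) by linarith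
      have dep: "depends_upto k (b k)" for k
        unfolding b_def depends_upto_def total_var_eq by (auto intro!: arg_cong2[where f="(<)"] sum.cong)
      have bT: "b k \<xi> \<longleftrightarrow> k < var_time m \<omega> \<xi> t" for k \<xi>
        unfolding b_def using var_time_props(1)[OF t] by simp
      have S: "switched_sum b N \<xi> = real_of_int (\<xi> (var_time m \<omega> \<xi> t) - \<xi> 0)"
        and V: "switched_var b N \<xi> = total_var m \<omega> \<xi> (var_time m \<omega> \<xi> t)" for \<xi>
        using switched_until[of b \<xi> "var_time m \<omega> \<xi> t" N, OF bT] TN[of \<xi>] by (simp_all add: min_absorb2)
      have u2: "u\<^sup>2 = \<theta>\<^sup>2 / t" using t by (simp add: u_def power_divide)
      have "(\<bar>u\<bar> * ?m)\<^sup>2 \<le> 1\<^sup>2" using t2 t by (simp add: u2 power_mult_distrib)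
      then have um: "\<bar>u\<bar> * ?m \<le> 1" by (rule power2_le_imp_le) simp
      have "u\<^sup>2 / 2 * (?m\<^sup>2 * real N) \<le> u\<^sup>2 / 2 * (?m\<^sup>2 * ((1 / (2 * \<epsilon>) + 2) * t))"
        by (intro mult_left_mono N') auto
      also have "\<dots> = \<theta>\<^sup>2 / 2 * ?m\<^sup>2 * (1 / (2 * \<epsilon>) + 2)" using t by (simp add: u2)
      also have "\<dots> \<le> K" by (simp add: K_def)
      finally have K: "u\<^sup>2 / 2 * (?m\<^sup>2 * real N) \<le> K" .
      have c1: "char (distr Q borel (X t)) \<theta> = (\<integral>\<xi>. iexp (u * switched_sum b N \<xi>) \<partial>Q)"
        by (rule char_distr_eq[OF X switched_sum_measurable[OF dep]])
           (use AE_start in eventually_elim, simp add: S X_def u_def)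
      have c2: "cmod ((\<integral>\<xi>. iexp (u * switched_sum b N \<xi>) \<partial>Q) - of_real (exp (- (\<theta>\<^sup>2 / 2))))
        \<le> exp K * (real N * (\<bar>u\<bar> * ?m) ^ 3 + (\<integral>\<xi>. \<bar>u\<^sup>2 / 2 * switched_var b N \<xi> - \<theta>\<^sup>2 / 2\<bar> \<partial>Q))"
        by (rule switched_char_gaussian[OF dep um K]) (use eps_pos in \<open>auto simp: K_def\<close>)
      have d: "real N * (\<bar>u\<bar> * ?m) ^ 3 + (\<integral>\<xi>. \<bar>u\<^sup>2 / 2 * switched_var b N \<xi> - \<theta>\<^sup>2 / 2\<bar> \<partial>Q) \<le> d t"
        unfolding d_def
      proof (rule add_mono)
        have u3: "(\<bar>u\<bar> * ?m) ^ 3 = (\<bar>\<theta>\<bar> * ?m) ^ 3 / (t * sqrt t)"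
          using t by (simp add: u_def abs_divide power_divide power_mult_distrib eval_nat_numeral)
        have "real N * (\<bar>u\<bar> * ?m) ^ 3 \<le> ((1 / (2 * \<epsilon>) + 2) * t) * (\<bar>u\<bar> * ?m) ^ 3"
          using m_pos by (intro mult_right_mono N') auto
        also have "\<dots> = (1 / (2 * \<epsilon>) + 2) * (\<bar>\<theta>\<bar> * ?m) ^ 3 / sqrt t"
          unfolding u3 using t by simp
        finally show "real N * (\<bar>u\<bar> * ?m) ^ 3 \<le> (1 / (2 * \<epsilon>) + 2) * (\<bar>\<theta>\<bar> * ?m) ^ 3 / sqrt t" .
        have "(\<integral>\<xi>. \<bar>u\<^sup>2 / 2 * switched_var b N \<xi> - \<theta>\<^sup>2 / 2\<bar> \<partial>Q) \<le> (\<integral>\<xi>. \<theta>\<^sup>2 / 2 * ?m\<^sup>2 / t \<partial>Q)"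
        proof (rule integral_mono)
          show "integrable Q (\<lambda>\<xi>. \<bar>u\<^sup>2 / 2 * switched_var b N \<xi> - \<theta>\<^sup>2 / 2\<bar>)"
            by (rule integrable_depends_upto[OF depends_upto_switched[OF dep, of N "\<lambda>_ v. \<bar>u\<^sup>2 / 2 * v - \<theta>\<^sup>2 / 2\<bar>"]])
          fix \<xi>
          have "u\<^sup>2 / 2 * switched_var b N \<xi> - \<theta>\<^sup>2 / 2 = u\<^sup>2 / 2 * (switched_var b N \<xi> - t)"
            using t by (simp add: u2 field_simps)
          moreover have "\<bar>switched_var b N \<xi> - t\<bar> \<le> ?m\<^sup>2"
            using var_time_props(3,4)[OF t, of \<xi>] by (simp add: V abs_le_iff)
          ultimately have "\<bar>u\<^sup>2 / 2 * switched_var b N \<xi> - \<theta>\<^sup>2 / 2\<bar> \<le> u\<^sup>2 / 2 * ?m\<^sup>2"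
            by (simp only: abs_mult) (simp add: mult_left_mono)
          then show "\<bar>u\<^sup>2 / 2 * switched_var b N \<xi> - \<theta>\<^sup>2 / 2\<bar> \<le> \<theta>\<^sup>2 / 2 * ?m\<^sup>2 / t"
            by (simp add: u2 field_simps)
        qed simp
        then show "(\<integral>\<xi>. \<bar>u\<^sup>2 / 2 * switched_var b N \<xi> - \<theta>\<^sup>2 / 2\<bar> \<partial>Q) \<le> \<theta>\<^sup>2 / 2 * ?m\<^sup>2 / t" by simp
      qed
      show ?thesis
        unfolding c1 by (rule order_trans[OF c2 mult_left_mono[OF d exp_ge_zero]])
    qed
    have "((\<lambda>t. exp K * d t) \<longlongrightarrow> exp K * (0 + 0)) at_top"
      unfolding d_def
      by (intro tendsto_intros tendsto_divide_0[OF tendsto_const] filterlim_at_top_imp_at_infinity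
          sqrt_at_top filterlim_ident)
    then have "((\<lambda>t. exp K * d t) \<longlongrightarrow> 0) at_top" by simp
    then have "((\<lambda>t. char (distr Q borel (X t)) \<theta> - of_real (exp (- (\<theta>\<^sup>2 / 2)))) \<longlongrightarrow> 0) at_top"
      by (rule Lim_null_comparison[rotated])
         (use bound eventually_ge_at_top[of "max 1 ((\<bar>\<theta>\<bar> * real_of_int m)\<^sup>2)"] in \<open>auto elim!: eventually_mono\<close>)
    then have "((\<lambda>t. char (distr Q borel (X t)) \<theta>) \<longlongrightarrow> of_real (exp (- (\<theta>\<^sup>2 / 2)))) at_top"
      by (rule LIM_zero_cancel)
    from filterlim_compose[OF this \<tau>]
    show "(\<lambda>n. char (distr Q borel (X (\<tau> n))) \<theta>) \<longlonglongrightarrow> char std_normal_distribution \<theta>"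
      by (simp add: char_std_normal_distribution)
  qed
  then show "weak_conv_m (\<lambda>n. distr Q borel (\<lambda>\<xi>. real_of_int (\<xi> (var_time m \<omega> \<xi> (\<tau> n))) / sqrt (\<tau> n)))
     std_normal_distribution"
    by (simp add: X_def)
qed

text \<open>With all switches on and u = \<theta> / (\<sigma> sqrt n), the hypothesis
  \<open>conv\<close> says precisely that the variance term of \<open>switched_char_gaussian\<close>
  vanishes in the limit.\<close>

lemma clt_fixed_time:
  assumes \<sigma>: "0 < \<sigma>"
    and conv: "(\<lambda>n. \<integral>\<xi>. \<bar>total_var m \<omega> \<xi> n - \<sigma>\<^sup>2 * real n\<bar> \<partial>Q) \<in> o(\<lambda>n. real n)"
  shows "uniform_limit UNIV
            (\<lambda>(t::nat) x. prob {\<xi> \<in> space Q. real_of_int (\<xi> t) / sqrt (real t) \<le> x})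
            (\<lambda>x. 1 / (sqrt (2 * pi) * \<sigma>) * (LBINT u:{..x}. exp (- u\<^sup>2 / (2 * \<sigma>\<^sup>2))))
            sequentially"
proof -
  define X where "X = (\<lambda>n \<xi>. real_of_int (\<xi> n) / (\<sigma> * sqrt (real n)))"
  have X [measurable]: "X n \<in> borel_measurable Q" for n
    \<comment> \<open>Dividing by \<open>\<sigma>\<close> as well makes the limit standard normal;
      replacing x by x / \<sigma> at the end restores \<open>\<sigma>\<close> and preserves
      uniformity.\<close>
    unfolding X_def by measurable
  have rX: "real_distribution (distr Q borel (X n))" for n
    by (rule real_distribution_distr[OF X])
  define E where "E = (\<lambda>n. \<integral>\<xi>. \<bar>total_var m \<omega> \<xi> n - \<sigma>\<^sup>2 * real n\<bar> \<partial>Q)"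
  have E: "(\<lambda>n. E n / real n) \<longlonglongrightarrow> 0"
    using smalloD_tendsto[OF conv] by (simp add: E_def)
  have "weak_conv_m (\<lambda>n. distr Q borel (X n)) std_normal_distribution"
  proof (rule levy_continuity[OF rX real_dist_normal_dist])
    fix \<theta> :: real
    let ?m = "real_of_int m"
    define K where "K = \<theta>\<^sup>2 / 2 + \<theta>\<^sup>2 / (2 * \<sigma>\<^sup>2) * ?m\<^sup>2"
    define d where "d = (\<lambda>n. (\<bar>\<theta>\<bar> / \<sigma> * ?m) ^ 3 / sqrt (real n) + \<theta>\<^sup>2 / (2 * \<sigma>\<^sup>2) * (E n / real n))"
    have bound: "cmod (char (distr Q borel (X n)) \<theta> - of_real (exp (- (\<theta>\<^sup>2 / 2)))) \<le> exp K * d n"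
      if n1: "1 \<le> n" and n2: "(\<bar>\<theta>\<bar> / \<sigma> * ?m)\<^sup>2 \<le> real n" for n
    proof -
      define u where "u = \<theta> / (\<sigma> * sqrt (real n))"
      define b where "b = (\<lambda>(k::nat) (\<xi>::nat \<Rightarrow> int). True)"
      have n: "0 < real n" using n1 by simp
      have dep: "depends_upto k (b k)" for k
        unfolding b_def depends_upto_def by simp
      have S: "switched_sum b n \<xi> = real_of_int (\<xi> n - \<xi> 0)" for \<xi>
        unfolding switched_sum_def b_def by (induction n) auto
      have V: "switched_var b n \<xi> = total_var m \<omega> \<xi> n" for \<xi>
        unfolding switched_var_def b_def total_var_eq by simp
      have u2: "u\<^sup>2 = \<theta>\<^sup>2 / (\<sigma>\<^sup>2 * real n)" by (simp add: u_def power_divide power_mult_distrib)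
      have au: "\<bar>u\<bar> * ?m = \<bar>\<theta>\<bar> / \<sigma> * ?m / sqrt (real n)" using \<sigma> by (simp add: u_def abs_mult)
      have "(\<bar>u\<bar> * ?m)\<^sup>2 \<le> 1\<^sup>2" using n2 n unfolding au power_divide[of _ "sqrt (real n)"] by simp
      then have um: "\<bar>u\<bar> * ?m \<le> 1" by (rule power2_le_imp_le) simp
      have "u\<^sup>2 / 2 * (?m\<^sup>2 * real n) = \<theta>\<^sup>2 / (2 * \<sigma>\<^sup>2) * ?m\<^sup>2" using n by (simp add: u2)
      also have "\<dots> \<le> K" by (simp add: K_def)
      finally have K: "u\<^sup>2 / 2 * (?m\<^sup>2 * real n) \<le> K" .
      have "char (distr Q borel (X n)) \<theta> = (\<integral>\<xi>. iexp (u * switched_sum b n \<xi>) \<partial>Q)"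
        by (rule char_distr_eq[OF X switched_sum_measurable[OF dep]])
           (use AE_start in eventually_elim, simp add: S X_def u_def)
      moreover have "cmod ((\<integral>\<xi>. iexp (u * switched_sum b n \<xi>) \<partial>Q) - of_real (exp (- (\<theta>\<^sup>2 / 2))))
        \<le> exp K * (real n * (\<bar>u\<bar> * ?m) ^ 3 + (\<integral>\<xi>. \<bar>u\<^sup>2 / 2 * switched_var b n \<xi> - \<theta>\<^sup>2 / 2\<bar> \<partial>Q))"
        by (rule switched_char_gaussian[OF dep um K]) (auto simp: K_def)
      moreover have "real n * (\<bar>u\<bar> * ?m) ^ 3 + (\<integral>\<xi>. \<bar>u\<^sup>2 / 2 * switched_var b n \<xi> - \<theta>\<^sup>2 / 2\<bar> \<partial>Q) = d n"
      proof -
        have "real n * (\<bar>u\<bar> * ?m) ^ 3 = (\<bar>\<theta>\<bar> / \<sigma> * ?m) ^ 3 / sqrt (real n)"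
          unfolding au power_divide using n by (simp add: eval_nat_numeral)
        moreover have "\<bar>u\<^sup>2 / 2 * switched_var b n \<xi> - \<theta>\<^sup>2 / 2\<bar> = \<theta>\<^sup>2 / (2 * \<sigma>\<^sup>2 * real n) * \<bar>total_var m \<omega> \<xi> n - \<sigma>\<^sup>2 * real n\<bar>" for \<xi>
        proof -
          have "u\<^sup>2 / 2 * switched_var b n \<xi> - \<theta>\<^sup>2 / 2 = \<theta>\<^sup>2 / (2 * \<sigma>\<^sup>2 * real n) * (total_var m \<omega> \<xi> n - \<sigma>\<^sup>2 * real n)"
            using n \<sigma> by (simp add: u2 V field_simps)
          then show ?thesis by (simp add: abs_mult)
        qed
        ultimately show ?thesis by (simp add: d_def E_def)
      qed
      ultimately show ?thesis by simp
    qed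
    have "(\<lambda>n. exp K * d n) \<longlonglongrightarrow> exp K * (0 + \<theta>\<^sup>2 / (2 * \<sigma>\<^sup>2) * 0)"
      unfolding d_def
      by (intro tendsto_intros E tendsto_divide_0[OF tendsto_const] filterlim_at_top_imp_at_infinity
          filterlim_compose[OF sqrt_at_top filterlim_real_sequentially])
    then have "(\<lambda>n. exp K * d n) \<longlonglongrightarrow> 0" by simp
    moreover have "\<forall>\<^sub>F n in sequentially. 1 \<le> n \<and> (\<bar>\<theta>\<bar> / \<sigma> * ?m)\<^sup>2 \<le> real n"
      using filterlim_real_sequentially by (intro eventually_conj eventually_ge_at_top) (simp add: filterlim_at_top)
    ultimately have "(\<lambda>n. char (distr Q borel (X n)) \<theta> - of_real (exp (- (\<theta>\<^sup>2 / 2)))) \<longlonglongrightarrow> 0"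
      by (elim Lim_null_comparison[rotated]) (auto elim!: eventually_mono intro: bound)
    then have "(\<lambda>n. char (distr Q borel (X n)) \<theta>) \<longlonglongrightarrow> of_real (exp (- (\<theta>\<^sup>2 / 2)))"
      by (rule LIM_zero_cancel)
    then show "(\<lambda>n. char (distr Q borel (X n)) \<theta>) \<longlonglongrightarrow> char std_normal_distribution \<theta>"
      by (simp add: char_std_normal_distribution)
  qed
  then have "uniform_limit UNIV (\<lambda>n. cdf (distr Q borel (X n))) (cdf std_normal_distribution) sequentially"
    by (intro uniform_limit_cdf rX real_dist_normal_dist isCont_cdf_std_normal)
  then have lim: "uniform_limit UNIV (\<lambda>n x. cdf (distr Q borel (X n)) (x / \<sigma>)) (\<lambda>x. cdf std_normal_distribution (x / \<sigma>)) sequentially"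
    unfolding uniform_limit_iff by (fast elim: eventually_mono)
  have "cdf (distr Q borel (X n)) (x / \<sigma>) = prob {\<xi> \<in> space Q. real_of_int (\<xi> n) / sqrt (real n) \<le> x}" for n x
  proof -
    have "cdf (distr Q borel (X n)) (x / \<sigma>) = prob {\<xi> \<in> space Q. X n \<xi> \<le> x / \<sigma>}"
      unfolding cdf_def by (subst measure_distr) (auto intro!: arg_cong[where f=prob])
    moreover have "X n \<xi> \<le> x / \<sigma> \<longleftrightarrow> real_of_int (\<xi> n) / sqrt (real n) \<le> x" for \<xi>
    proof -
      have "X n \<xi> = (real_of_int (\<xi> n) / sqrt (real n)) / \<sigma>" by (simp add: X_def)
      then show ?thesis using \<sigma> by (simp only: divide_le_cancel) auto
    qed
    ultimately show ?thesis by simp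
  qed
  with lim show ?thesis by (simp only: cdf_std_normal_scaled[OF \<sigma>])
qed

end

section \<open>Approximation in mean and the maximal inequality\<close>

text \<open>The complement of the support is the union of all null open sets; a countable basis
  reduces this to a countable union of null sets.\<close>

lemma AE_measure_support:
  fixes M :: "'a::second_countable_topology measure"
  assumes M: "sets M = sets borel"
  shows "AE x in M. x \<in> measure_support M"
proof -
  obtain B :: "'a set set" where B: "countable B" "topological_basis B"
    using ex_countable_basis by blast
  define N where "N = (\<Union>U\<in>{U \<in> B. emeasure M U = 0}. U)"
  have "N \<in> null_sets M"
    unfolding N_def
  proof (rule null_sets_UN')
    show "countable {U \<in> B. emeasure M U = 0}" using B(1) by (auto intro: countable_subset)
    show "U \<in> null_sets M" if "U \<in> {U \<in> B. emeasure M U = 0}" for U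
      using that topological_basis_open[OF B(2), of U] M by (auto simp: null_sets_def)
  qed
  moreover have "x \<in> measure_support M" if "x \<notin> N" for x
    unfolding measure_support_def
  proof (clarify, rule ccontr)
    fix U assume U: "open U" "x \<in> U" "\<not> 0 < emeasure M U"
    obtain V where V: "V \<in> B" "x \<in> V" "V \<subseteq> U"
      using topological_basisE[OF B(2) U(1,2)] by blast
    have "emeasure M V \<le> emeasure M U"
      using V U(1) M by (intro emeasure_mono) auto
    then have "emeasure M V = 0" using U(3) by (simp add: zero_less_iff_neq_zero)
    then show False using V that by (auto simp: N_def)
  qed
  ultimately show ?thesis by (auto intro!: AE_I'[of N])
qed

section \<open>Orthogonal approximation and the maximal ergodic inequality\<close>

context prob_space
begin

lemma integrable_bounded:
  fixes f :: "'a \<Rightarrow> real"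
  assumes "f \<in> borel_measurable M" "\<And>x. x \<in> space M \<Longrightarrow> \<bar>f x\<bar> \<le> C"
  shows "integrable M f"
  by (rule integrable_const_bound[of _ C]) (use assms in auto)

lemma integral_abs_le_L2:
  fixes f :: "'a \<Rightarrow> real"
  assumes f: "f \<in> borel_measurable M" "\<And>x. x \<in> space M \<Longrightarrow> \<bar>f x\<bar> \<le> C"
  shows "(\<integral>x. \<bar>f x\<bar> \<partial>M) \<le> sqrt (\<integral>x. (f x)\<^sup>2 \<partial>M)"
proof (rule real_le_rsqrt)
  have i: "integrable M (\<lambda>x. \<bar>f x\<bar>)" using integrable_bounded[OF f] by simp
  have i2: "integrable M (\<lambda>x. \<bar>f x\<bar>\<^sup>2)"
  proof (rule integrable_bounded[where C="C\<^sup>2"])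
    show "\<bar>\<bar>f x\<bar>\<^sup>2\<bar> \<le> C\<^sup>2" if "x \<in> space M" for x
      using power_mono[OF f(2)[OF that], of 2] by simp
  qed (use f in measurable)
  show "(\<integral>x. \<bar>f x\<bar> \<partial>M)\<^sup>2 \<le> (\<integral>x. (f x)\<^sup>2 \<partial>M)"
    using variance_positive[of "\<lambda>x. \<bar>f x\<bar>"] variance_eq[OF i i2] by simp
qed

text \<open>Completeness of L^1 with a rate: a subsequence converges almost everywhere, and Fatou's
  lemma carries the bound \<open>d i\<close> over to its limit.\<close>

lemma L1_limit_exists:
  fixes r :: "nat \<Rightarrow> 'a \<Rightarrow> real"
  assumes r: "\<And>i. integrable M (r i)"
    and cauchy: "\<And>i j. i \<le> j \<Longrightarrow> (\<integral>x. \<bar>r i x - r j x\<bar> \<partial>M) \<le> d i" and d: "d \<longlonglongrightarrow> 0"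
  obtains \<phi> where "integrable M \<phi>" "\<And>i. (\<integral>x. \<bar>r i x - \<phi> x\<bar> \<partial>M) \<le> d i"
proof -
  have [measurable]: "r i \<in> borel_measurable M" for i using r by auto
  have ex: "\<exists>N. \<forall>i\<ge>N. \<forall>j\<ge>N. (\<integral>x. norm (r i x - r j x) \<partial>M) < e" if e: "0 < e" for e
  proof -
    obtain N where N: "\<And>i. i \<ge> N \<Longrightarrow> d i < e"
      using order_tendstoD(2)[OF d e] by (auto simp: eventually_sequentially)
    have "(\<integral>x. norm (r i x - r j x) \<partial>M) < e" if "i \<ge> N" "j \<ge> N" for i j
    proof (cases "i \<le> j")
      case True
      then show ?thesis using cauchy[of i j] N[of i] that by simp
    next
      case False
      then show ?thesis using cauchy[of j i] N[of j] that by (simp add: abs_minus_commute)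
    qed
    then show ?thesis by blast
  qed
  obtain s where s: "strict_mono s" "AE x in M. Cauchy (\<lambda>i. r (s i) x)"
    by (rule cauchy_L1_AE_cauchy_subseq[of M r, OF r ex])
  define \<phi> where "\<phi> = (\<lambda>x. lim (\<lambda>i. r (s i) x))"
  have \<phi>m [measurable]: "\<phi> \<in> borel_measurable M" unfolding \<phi>_def by measurable
  have lim: "AE x in M. (\<lambda>i. r (s i) x) \<longlonglongrightarrow> \<phi> x"
    using s(2) by eventually_elim (simp add: \<phi>_def Cauchy_convergent_iff convergent_LIMSEQ_iff)
  have d0: "0 \<le> d i" for i using cauchy[of i i] by simp
  have le: "(\<integral>\<^sup>+x. ennreal \<bar>r i x - \<phi> x\<bar> \<partial>M) \<le> ennreal (d i)" for i
  proof -
    have "(\<integral>\<^sup>+x. ennreal \<bar>r i x - \<phi> x\<bar> \<partial>M) = (\<integral>\<^sup>+x. liminf (\<lambda>k. ennreal \<bar>r i x - r (s k) x\<bar>) \<partial>M)"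
    proof (rule nn_integral_cong_AE)
      show "AE x in M. ennreal \<bar>r i x - \<phi> x\<bar> = liminf (\<lambda>k. ennreal \<bar>r i x - r (s k) x\<bar>)"
        using lim
      proof eventually_elim
        case (elim x)
        have "(\<lambda>k. ennreal \<bar>r i x - r (s k) x\<bar>) \<longlonglongrightarrow> ennreal \<bar>r i x - \<phi> x\<bar>"
          by (intro tendsto_intros elim)
        then show ?case by (intro lim_imp_Liminf[symmetric]) simp_all
      qed
    qed
    also have "\<dots> \<le> liminf (\<lambda>k. \<integral>\<^sup>+x. ennreal \<bar>r i x - r (s k) x\<bar> \<partial>M)"
      by (rule nn_integral_liminf) measurable
    also have "\<dots> \<le> liminf (\<lambda>k. ennreal (d i))"
    proof (rule Liminf_mono)
      show "\<forall>\<^sub>F k in sequentially. (\<integral>\<^sup>+x. ennreal \<bar>r i x - r (s k) x\<bar> \<partial>M) \<le> ennreal (d i)"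
        using eventually_ge_at_top[of i]
      proof eventually_elim
        case (elim k)
        then have "i \<le> s k" using seq_suble[OF s(1), of k] by simp
        have "(\<integral>\<^sup>+x. ennreal \<bar>r i x - r (s k) x\<bar> \<partial>M) = ennreal (\<integral>x. \<bar>r i x - r (s k) x\<bar> \<partial>M)"
          using r by (intro nn_integral_eq_integral) auto
        then show ?case using cauchy[OF \<open>i \<le> s k\<close>] by (simp add: ennreal_leI)
      qed
    qed
    also have "\<dots> = ennreal (d i)" by (simp add: Liminf_const)
    finally show ?thesis .
  qed
  have int: "integrable M (\<lambda>x. r i x - \<phi> x)" for i
    by (rule integrableI_bounded) (use le[of i] in \<open>auto intro: le_less_trans\<close>)
  have "integrable M (\<lambda>x. r 0 x - (r 0 x - \<phi> x))"
    by (rule Bochner_Integration.integrable_diff[OF r int])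
  then have "integrable M \<phi>" by simp
  moreover have "(\<integral>x. \<bar>r i x - \<phi> x\<bar> \<partial>M) \<le> d i" for i
  proof -
    have "ennreal (\<integral>x. \<bar>r i x - \<phi> x\<bar> \<partial>M) \<le> ennreal (d i)"
      using le[of i] int by (subst nn_integral_eq_integral[symmetric]) auto
    then show ?thesis using d0 by simp
  qed
  ultimately show ?thesis by (rule that)
qed

text \<open>The residuals of a minimising sequence for the \<open>L\<^sup>2\<close> distance from \<open>f\<close> to \<open>H\<close> converge in \<open>L\<^sup>1\<close>
  to a function orthogonal to \<open>H\<close>.\<close>

lemma L1_dense_if_no_annihilator:
  fixes f :: "'a \<Rightarrow> real" and H :: "('a \<Rightarrow> real) set"
  assumes f: "f \<in> borel_measurable M" "\<And>x. x \<in> space M \<Longrightarrow> \<bar>f x\<bar> \<le> C"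
    and H: "\<And>h. h \<in> H \<Longrightarrow> h \<in> borel_measurable M"
      "\<And>h. h \<in> H \<Longrightarrow> \<exists>C. \<forall>x\<in>space M. \<bar>h x\<bar> \<le> C"
      "\<And>h k t. h \<in> H \<Longrightarrow> k \<in> H \<Longrightarrow> (\<lambda>x. h x + t * k x) \<in> H" "H \<noteq> {}"
    and ann: "\<And>\<phi>. integrable M \<phi> \<Longrightarrow> (\<And>h. h \<in> H \<Longrightarrow> (\<integral>x. \<phi> x * h x \<partial>M) = 0) \<Longrightarrow> AE x in M. \<phi> x = 0"
    and e: "0 < e"
  shows "\<exists>h\<in>H. (\<integral>x. \<bar>f x - h x\<bar> \<partial>M) < e"
proof -
  define bdd where "bdd = (\<lambda>g::'a \<Rightarrow> real. g \<in> borel_measurable M \<and> (\<exists>C. \<forall>x\<in>space M. \<bar>g x\<bar> \<le> C))"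
  have bH: "bdd h" if "h \<in> H" for h using H(1,2)[OF that] by (simp add: bdd_def)
  have bf: "bdd f" using f by (auto simp: bdd_def)
  have bint: "integrable M g" if "bdd g" for g using that by (auto simp: bdd_def intro: integrable_bounded)
  have bmult: "bdd (\<lambda>x. g x * k x)" if gk: "bdd g" "bdd k" for g k
  proof -
    obtain A B where AB: "\<forall>x\<in>space M. \<bar>g x\<bar> \<le> A" "\<forall>x\<in>space M. \<bar>k x\<bar> \<le> B" and
      [measurable]: "g \<in> borel_measurable M" "k \<in> borel_measurable M"
      using gk by (auto simp: bdd_def)
    have "\<bar>g x * k x\<bar> \<le> A * B" if "x \<in> space M" for x
      unfolding abs_mult using AB that by (intro mult_mono) (auto intro: order_trans[OF abs_ge_zero])
    then show ?thesis by (auto simp: bdd_def)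
  qed
  have bdiff: "bdd (\<lambda>x. g x - t * k x)" if gk: "bdd g" "bdd k" for g k t
  proof -
    obtain A B where AB: "\<forall>x\<in>space M. \<bar>g x\<bar> \<le> A" "\<forall>x\<in>space M. \<bar>k x\<bar> \<le> B" and
      [measurable]: "g \<in> borel_measurable M" "k \<in> borel_measurable M"
      using gk by (auto simp: bdd_def)
    have "\<bar>g x - t * k x\<bar> \<le> A + \<bar>t\<bar> * B" if "x \<in> space M" for x
    proof -
      have "\<bar>g x - t * k x\<bar> \<le> \<bar>g x\<bar> + \<bar>t\<bar> * \<bar>k x\<bar>" unfolding abs_mult[symmetric] by (rule abs_triangle_ineq4)
      also have "\<dots> \<le> A + \<bar>t\<bar> * B" using AB that by (intro add_mono mult_left_mono) auto
      finally show ?thesis .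
    qed
    then show ?thesis by (auto simp: bdd_def)
  qed
  define ip :: "('a \<Rightarrow> real) \<Rightarrow> ('a \<Rightarrow> real) \<Rightarrow> real" where "ip = (\<lambda>g k. \<integral>x. g x * k x \<partial>M)"
  have ip_expand: "ip (\<lambda>x. g x - t * k x) (\<lambda>x. g x - t * k x) = ip g g - 2 * t * ip g k + t\<^sup>2 * ip k k"
    if "bdd g" "bdd k" for g k t
  proof -
    have "(\<integral>x. (g x - t * k x) * (g x - t * k x) \<partial>M) = (\<integral>x. g x * g x - 2 * t * (g x * k x) + t\<^sup>2 * (k x * k x) \<partial>M)"
      by (intro Bochner_Integration.integral_cong) (auto simp: power2_eq_square algebra_simps)
    also have "\<dots> = ip g g - 2 * t * ip g k + t\<^sup>2 * ip k k"
      unfolding ip_def using that by (simp add: bint bmult)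
    finally show ?thesis by (simp add: ip_def)
  qed
  have ip_nonneg: "0 \<le> ip g g" for g unfolding ip_def by (rule Bochner_Integration.integral_nonneg) simp
  define res where "res = (\<lambda>h x. f x - 1 * h x :: real)"
  define D where "D = (\<lambda>h. ip (res h) (res h))"
  have bres: "bdd (res h)" if "h \<in> H" for h unfolding res_def by (rule bdiff[OF bf bH[OF that]])
  define d where "d = Inf (D ` H)"
  have bb: "bdd_below (D ` H)" using ip_nonneg by (auto intro!: bdd_belowI[of _ 0] simp: D_def)
  have dle: "d \<le> D h" if "h \<in> H" for h unfolding d_def using bb that by (auto intro: cInf_lower)
  define \<epsilon> where "\<epsilon> = (\<lambda>i::nat. 1 / real (Suc i))"
  have \<epsilon>0: "0 < \<epsilon> i" for i by (simp add: \<epsilon>_def)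
  have "\<exists>h\<in>H. D h < d + (\<epsilon> i)\<^sup>2" for i
    using cInf_lessD[of "D ` H" "d + (\<epsilon> i)\<^sup>2"] H(4) \<epsilon>0[of i] by (auto simp: d_def)
  then obtain h where h: "\<And>i. h i \<in> H" "\<And>i. D (h i) < d + (\<epsilon> i)\<^sup>2" by metis
  define r where "r = (\<lambda>i. res (h i))"
  have br: "bdd (r i)" for i unfolding r_def by (rule bres[OF h(1)])
  \<comment> \<open>Moving \<open>h i\<close> by a multiple of \<open>k\<close> stays in
    \<open>H\<close>, so the squared distance cannot fall below \<open>d\<close>, that is, cannot
    drop by \<open>\<epsilon> i ^ 2\<close> or more. This quadratic inequality in t makes
    \<open>r i\<close> almost orthogonal to \<open>k\<close>.\<close>
  have orth: "\<bar>ip (r i) k\<bar> \<le> \<epsilon> i * sqrt (ip k k)" if k: "k \<in> H" for i k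
  proof -
    have "0 \<le> (\<epsilon> i)\<^sup>2 - 2 * t * ip (r i) k + t\<^sup>2 * ip k k" for t
    proof -
      have "res (\<lambda>x. h i x + t * k x) = (\<lambda>x. r i x - t * k x)"
        by (auto simp: res_def r_def fun_eq_iff)
      then have "d \<le> ip (r i) (r i) - 2 * t * ip (r i) k + t\<^sup>2 * ip k k"
        using dle[OF H(3)[OF h(1)[of i] k, of t]] by (simp add: D_def ip_expand[OF br bH[OF k]])
      then show ?thesis using h(2)[of i] by (simp add: D_def r_def)
    qed note q = this
    have "(ip (r i) k)\<^sup>2 \<le> (\<epsilon> i)\<^sup>2 * ip k k"
    proof (cases "ip k k = 0")
      case True
      have "ip (r i) k = 0"
      proof (rule ccontr)
        assume "ip (r i) k \<noteq> 0"
        \<comment> \<open>When \<open>k\<close> has norm zero the inequality is linear in t, and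
          this t makes its right-hand side -1.\<close>
        then show False using q[of "((\<epsilon> i)\<^sup>2 + 1) / (2 * ip (r i) k)"] True by simp
      qed
      then show ?thesis by (simp add: True)
    next
      case False
      then have pos: "0 < ip k k" using ip_nonneg[of k] by simp
      have "0 \<le> (\<epsilon> i)\<^sup>2 - (ip (r i) k)\<^sup>2 / ip k k"
        using q[of "ip (r i) k / ip k k"] pos by (simp add: power2_eq_square field_simps)
      then show ?thesis using pos by (simp add: field_simps)
    qed
    then have "(ip (r i) k)\<^sup>2 \<le> (\<epsilon> i * sqrt (ip k k))\<^sup>2"
      using ip_nonneg by (simp add: power_mult_distrib)
    then have "\<bar>ip (r i) k\<bar> \<le> \<bar>\<epsilon> i * sqrt (ip k k)\<bar>" by (simp only: abs_le_square_iff)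
    then show ?thesis using \<epsilon>0[of i] ip_nonneg[of k] by simp
  qed
  \<comment> \<open>The difference \<open>k\<close> of two residuals lies in \<open>H\<close>, so
    near-orthogonality of both residuals to \<open>k\<close> bounds the square of its norm by
    (\<epsilon> i + \<epsilon> j) times its norm.\<close>
  have cauchy: "(\<integral>x. \<bar>r i x - r j x\<bar> \<partial>M) \<le> 2 * \<epsilon> i" if "i \<le> j" for i j
  proof -
    define k where "k = (\<lambda>x. r i x - r j x)"
    have kH: "k \<in> H"
      using H(3)[OF h(1)[of j] h(1)[of i], of "- 1"] by (simp add: k_def r_def res_def algebra_simps)
    have bk: "bdd k" by (rule bH[OF kH])
    have "ip k k = ip (r i) k - ip (r j) k"
      unfolding ip_def k_def using bmult[OF br bk] by (simp add: k_def algebra_simps bint br bmult)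
    also have "\<dots> \<le> (\<epsilon> i + \<epsilon> j) * sqrt (ip k k)"
      using orth[OF kH, of i] orth[OF kH, of j] by (simp add: algebra_simps abs_le_iff)
    finally have "sqrt (ip k k) * sqrt (ip k k) \<le> (\<epsilon> i + \<epsilon> j) * sqrt (ip k k)"
      using ip_nonneg[of k] by simp
    then have "sqrt (ip k k) \<le> \<epsilon> i + \<epsilon> j"
    proof (cases "ip k k = 0")
      case False
      then have "0 < sqrt (ip k k)" using ip_nonneg[of k] by simp
      with \<open>sqrt (ip k k) * sqrt (ip k k) \<le> (\<epsilon> i + \<epsilon> j) * sqrt (ip k k)\<close> show ?thesis
        by (rule mult_right_le_imp_le)
    qed (use \<epsilon>0[of i] \<epsilon>0[of j] in simp)
    moreover have "(\<integral>x. \<bar>k x\<bar> \<partial>M) \<le> sqrt (ip k k)"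
      using bk integral_abs_le_L2[of k] by (auto simp: bdd_def ip_def power2_eq_square)
    moreover have "\<epsilon> j \<le> \<epsilon> i" using that by (simp add: \<epsilon>_def frac_le)
    ultimately show ?thesis by (simp add: k_def)
  qed
  have \<epsilon>lim: "\<epsilon> \<longlonglongrightarrow> 0" unfolding \<epsilon>_def by (rule LIMSEQ_Suc[OF lim_1_over_n])
  have lim2: "(\<lambda>i. 2 * \<epsilon> i) \<longlonglongrightarrow> 0" using tendsto_mult_right_zero[OF \<epsilon>lim] by simp
  obtain \<phi> where \<phi>: "integrable M \<phi>" "\<And>i. (\<integral>x. \<bar>r i x - \<phi> x\<bar> \<partial>M) \<le> 2 * \<epsilon> i"
    using L1_limit_exists[of r "\<lambda>i. 2 * \<epsilon> i", OF bint[OF br] cauchy lim2] by blast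
  have "AE x in M. \<phi> x = 0"
  proof (rule ann[OF \<phi>(1)])
    fix k assume k: "k \<in> H"
    obtain B where B: "\<forall>x\<in>space M. \<bar>k x\<bar> \<le> B" and [measurable]: "k \<in> borel_measurable M"
      using bH[OF k] by (auto simp: bdd_def)
    have ik: "integrable M (\<lambda>x. g x * k x)" if g: "integrable M g" for g
    proof (rule Bochner_Integration.integrable_bound[of M "\<lambda>x. B * g x"])
      show "AE x in M. norm (g x * k x) \<le> norm (B * g x)"
      proof (rule AE_I2)
        fix x assume "x \<in> space M"
        then have "\<bar>k x\<bar> \<le> \<bar>B\<bar>" using B by force
        then show "norm (g x * k x) \<le> norm (B * g x)" by (simp add: abs_mult mult.commute[of "\<bar>B\<bar>"] mult_left_mono)
      qed
    qed (use g in auto)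
    have bound: "\<bar>\<integral>x. \<phi> x * k x \<partial>M\<bar> \<le> \<epsilon> i * (sqrt (ip k k) + 2 * \<bar>B\<bar>)" for i
    proof -
      have ir: "integrable M (r i)" by (rule bint[OF br])
      have "(\<integral>x. \<phi> x * k x \<partial>M) = ip (r i) k - (\<integral>x. (r i x - \<phi> x) * k x \<partial>M)"
        unfolding ip_def using ik[OF ir] ik[OF \<phi>(1)] by (simp add: left_diff_distrib)
      moreover have "\<bar>\<integral>x. (r i x - \<phi> x) * k x \<partial>M\<bar> \<le> 2 * \<epsilon> i * \<bar>B\<bar>"
      proof -
        have "\<bar>\<integral>x. (r i x - \<phi> x) * k x \<partial>M\<bar> \<le> (\<integral>x. \<bar>(r i x - \<phi> x) * k x\<bar> \<partial>M)"
          by (rule integral_abs_bound)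
        also have "\<dots> \<le> (\<integral>x. \<bar>r i x - \<phi> x\<bar> * \<bar>B\<bar> \<partial>M)"
        proof (rule integral_mono_AE)
          show "integrable M (\<lambda>x. \<bar>(r i x - \<phi> x) * k x\<bar>)"
            by (intro integrable_abs ik Bochner_Integration.integrable_diff ir \<phi>(1))
          show "integrable M (\<lambda>x. \<bar>r i x - \<phi> x\<bar> * \<bar>B\<bar>)"
            using ir \<phi>(1) by simp
          show "AE x in M. \<bar>(r i x - \<phi> x) * k x\<bar> \<le> \<bar>r i x - \<phi> x\<bar> * \<bar>B\<bar>"
            unfolding abs_mult using B by (intro AE_I2 mult_left_mono) force+
        qed
        also have "\<dots> = (\<integral>x. \<bar>r i x - \<phi> x\<bar> \<partial>M) * \<bar>B\<bar>" by simp
        also have "\<dots> \<le> 2 * \<epsilon> i * \<bar>B\<bar>" using \<phi>(2)[of i] by (intro mult_right_mono) auto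
        finally show ?thesis .
      qed
      ultimately show ?thesis using orth[OF k, of i] by (simp add: algebra_simps)
    qed
    have "(\<lambda>i. \<epsilon> i * (sqrt (ip k k) + 2 * \<bar>B\<bar>)) \<longlonglongrightarrow> 0"
      using \<epsilon>lim by (rule tendsto_mult_left_zero)
    then have "\<bar>\<integral>x. \<phi> x * k x \<partial>M\<bar> \<le> 0"
      by (rule LIMSEQ_le_const) (use bound in blast)
    then show "(\<integral>x. \<phi> x * k x \<partial>M) = 0" by simp
  qed
  \<comment> \<open>The limit of the residuals vanishes, so the rate of convergence bounds the
    residuals themselves.\<close>
  then have "(\<integral>x. \<bar>r i x - \<phi> x\<bar> \<partial>M) = (\<integral>x. \<bar>r i x\<bar> \<partial>M)" for i
    using \<phi>(1) br[of i] by (intro integral_cong_AE) (auto simp: bdd_def elim: eventually_mono)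
  then have small: "(\<integral>x. \<bar>f x - h i x\<bar> \<partial>M) \<le> 2 * \<epsilon> i" for i
    using \<phi>(2)[of i] by (simp add: r_def res_def)
  obtain i where "2 * \<epsilon> i < e"
    using order_tendstoD(2)[OF lim2 e] by (auto simp: eventually_sequentially)
  with small[of i] h(1)[of i] show ?thesis by (meson le_less_trans)
qed

text \<open>\<open>ergodic_max a l T K\<close> is the maximum of \<open>0\<close> and the partial sums of \<open>a \<circ> T ^^ y - l\<close> over
  at most \<open>K\<close> terms; the proof of the maximal inequality is Garsia's.\<close>

primrec ergodic_max :: "('a \<Rightarrow> real) \<Rightarrow> real \<Rightarrow> ('a \<Rightarrow> 'a) \<Rightarrow> nat \<Rightarrow> 'a \<Rightarrow> real" where
  "ergodic_max a l T 0 x = 0"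
| "ergodic_max a l T (Suc K) x = max 0 (a x - l + ergodic_max a l T K (T x))"

lemma ergodic_max_ge_sum: "(\<Sum>y<N. a ((T ^^ y) x)) - l * real N \<le> ergodic_max a l T N x"
proof (induction N arbitrary: x)
  case (Suc N)
  have "(\<Sum>y<Suc N. a ((T ^^ y) x)) = a x + (\<Sum>y<N. a ((T ^^ y) (T x)))"
    by (simp add: sum.lessThan_Suc_shift funpow_swap1 del: sum.lessThan_Suc)
  then show ?case using Suc[of "T x"] by (simp add: algebra_simps)
qed simp

lemma ergodic_max_mono: "ergodic_max a l T K x \<le> ergodic_max a l T (Suc K) x"
proof (induction K arbitrary: x)
  case (Suc K)
  show ?case
    unfolding ergodic_max.simps(2)[of a l T K x] ergodic_max.simps(2)[of a l T "Suc K" x]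
    by (intro max.mono add_left_mono Suc order_refl)
qed simp

lemma maximal_inequality:
  fixes a :: "'a \<Rightarrow> real"
  assumes a: "integrable M a" "\<And>x. 0 \<le> a x"
    and T[measurable]: "T \<in> measurable M M" and inv: "distr M M T = M" and l: "0 < l"
  shows "prob {x \<in> space M. \<exists>N. l * real N < (\<Sum>y<N. a ((T ^^ y) x))} \<le> (\<integral>x. a x \<partial>M) / l"
proof -
  have [measurable]: "a \<in> borel_measurable M" using a by auto
  define S where "S = (\<lambda>K. ergodic_max a l T K)"
  have [measurable]: "S K \<in> borel_measurable M" for K
    unfolding S_def by (induction K) (simp_all add: measurable_compose[OF T])
  have intT: "integrable M (\<lambda>x. g (T x))" "(\<integral>x. g (T x) \<partial>M) = (\<integral>x. g x \<partial>M)" if "integrable M g" for g :: "'a \<Rightarrow> real"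
    using integrable_distr[OF T, of g] integral_distr[OF T, of g] that by (auto simp: inv)
  have S0: "0 \<le> S K x" for K x unfolding S_def by (cases K) auto
  have int: "integrable M (S K)" for K
    unfolding S_def
  proof (induction K)
    case (Suc K)
    show ?case using a intT(1)[OF Suc] by simp
  qed simp
  define A where "A = (\<lambda>K. {x \<in> space M. 0 < S K x})"
  have [measurable]: "A K \<in> sets M" for K unfolding A_def by measurable
  have A_bound: "prob (A K) \<le> (\<integral>x. a x \<partial>M) / l" for K
  proof (cases K)
    case 0
    then show ?thesis using a l by (simp add: A_def S_def)
  next
    case (Suc k)
    have iA: "integrable M (\<lambda>x. l * indicator (A K) x :: real)"
      by (intro integrable_mult_right integrable_real_indicator) (auto simp: less_top[symmetric])
    \<comment> \<open>Where \<open>S K\<close> is positive it equals \<open>a - l\<close> plus the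
      shorter maximum at \<open>T x\<close>, which is at most \<open>S K (T x)\<close>; elsewhere it
      is 0 and nonnegativity of \<open>a\<close> suffices. After integration the two copies of
      \<open>S K\<close> cancel by invariance.\<close>
    have "(\<integral>x. S K x \<partial>M) \<le> (\<integral>x. a x - l * indicator (A K) x + S K (T x) \<partial>M)"
    proof (rule integral_mono_AE)
      show "AE x in M. S K x \<le> a x - l * indicator (A K) x + S K (T x)"
      proof (rule AE_I2)
        fix x assume x: "x \<in> space M"
        show "S K x \<le> a x - l * indicator (A K) x + S K (T x)"
        proof (cases "0 < S K x")
          case True
          then have "S K x = a x - l + S k (T x)" by (simp add: S_def Suc max_def split: if_splits)
          moreover have "S k (T x) \<le> S K (T x)" unfolding S_def Suc by (rule ergodic_max_mono)
          ultimately show ?thesis using True x by (simp add: A_def)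
        next
          case False
          then show ?thesis using S0[of K x] S0[of K "T x"] a(2)[of x] by (simp add: A_def)
        qed
      qed
    next
      show "integrable M (\<lambda>x. a x - l * indicator (A K) x + S K (T x))"
        by (intro Bochner_Integration.integrable_add Bochner_Integration.integrable_diff a intT(1)[OF int] iA)
    qed (rule int)
    also have "\<dots> = (\<integral>x. a x \<partial>M) - l * prob (A K) + (\<integral>x. S K x \<partial>M)"
      using a intT[OF int[of K]] iA by simp
    finally show ?thesis using l by (simp add: field_simps)
  qed
  have "incseq A"
    unfolding A_def S_def
    by (intro incseq_SucI) (auto simp del: ergodic_max.simps intro: less_le_trans[OF _ ergodic_max_mono])
  then have "(\<lambda>K. prob (A K)) \<longlonglongrightarrow> prob (\<Union>K. A K)"
    by (intro finite_Lim_measure_incseq) auto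
  then have "prob (\<Union>K. A K) \<le> (\<integral>x. a x \<partial>M) / l"
    by (rule LIMSEQ_le_const2) (use A_bound in blast)
  moreover have "prob {x \<in> space M. \<exists>N. l * real N < (\<Sum>y<N. a ((T ^^ y) x))} \<le> prob (\<Union>K. A K)"
  proof (rule finite_measure_mono)
    show "{x \<in> space M. \<exists>N. l * real N < (\<Sum>y<N. a ((T ^^ y) x))} \<subseteq> (\<Union>K. A K)"
    proof clarify
      fix x N assume "x \<in> space M" "l * real N < (\<Sum>y<N. a ((T ^^ y) x))"
      moreover from this have "0 < S N x" unfolding S_def using ergodic_max_ge_sum[of a T x N l] by simp
      ultimately show "x \<in> (\<Union>K. A K)" by (auto simp: A_def)
    qed
  qed auto
  ultimately show ?thesis by simp
qed

end

section \<open>Stationary ergodic environments\<close>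

context centered_walk
begin

text \<open>Two constants \<open>c i\<close> and \<open>c j\<close> approximate the same total
  variance; letting n tend to infinity with i and j fixed removes the square-root terms, so they
  differ by at most \<open>l i + l j\<close>. The factors \<open>B i\<close> may be unbounded, since
  i is always chosen before n.\<close>

lemma variance_limit:
  fixes c l B :: "nat \<Rightarrow> real"
  assumes bound: "\<forall>\<^sub>F i in sequentially. \<forall>n.
      (\<integral>\<xi>. \<bar>total_var m \<omega> \<xi> n - c i * real n\<bar> \<partial>Q) \<le> l i * real n + B i * (1 + sqrt (real n))"
    and l: "l \<longlonglongrightarrow> 0"
  shows "convergent c" and "2 * \<epsilon> \<le> lim c"
    and "(\<lambda>n. \<integral>\<xi>. \<bar>total_var m \<omega> \<xi> n - lim c * real n\<bar> \<partial>Q) \<in> o(\<lambda>n. real n)"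
proof -
  define E where "E = (\<lambda>n a. \<integral>\<xi>. \<bar>total_var m \<omega> \<xi> n - a * real n\<bar> \<partial>Q)"
  define G where "G = {i. \<forall>n. E n (c i) \<le> l i * real n + B i * (1 + sqrt (real n))}"
  have G: "\<forall>\<^sub>F i in sequentially. i \<in> G" using bound by (simp add: G_def E_def)
  have V: "integrable Q (\<lambda>\<xi>. total_var m \<omega> \<xi> n - a * real n)" for n a
    unfolding total_var_eq by (intro Bochner_Integration.integrable_diff integrable_sum_at) simp
  have lim: "(\<lambda>n. b * ((1 + sqrt (real n)) / real n)) \<longlonglongrightarrow> 0" for b
  proof -
    have "(\<lambda>n. b * (1 / real n + 1 / sqrt (real n))) \<longlonglongrightarrow> b * (0 + 0)"
      by (intro tendsto_intros lim_1_over_n tendsto_divide_0[OF tendsto_const] filterlim_at_top_imp_at_infinity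
          filterlim_compose[OF sqrt_at_top filterlim_real_sequentially])
    moreover have "(1 + sqrt (real n)) / real n = 1 / real n + 1 / sqrt (real n)" for n
      by (simp add: add_divide_distrib sqrt_divide_self_eq inverse_eq_divide)
    ultimately show ?thesis by simp
  qed
  have le: "a \<le> q" if "\<And>n. 1 \<le> n \<Longrightarrow> a * real n \<le> q * real n + b * (1 + sqrt (real n))" for a b q
  proof -
    have "(\<lambda>n. q + b * ((1 + sqrt (real n)) / real n)) \<longlonglongrightarrow> q + 0"
      by (intro tendsto_add tendsto_const lim)
    moreover have "a \<le> q + b * ((1 + sqrt (real n)) / real n)" if "1 \<le> n" for n
      using \<open>\<And>n. 1 \<le> n \<Longrightarrow> a * real n \<le> q * real n + b * (1 + sqrt (real n))\<close>[OF that] that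
      by (simp add: field_simps)
    ultimately show ?thesis by (intro LIMSEQ_le_const[of _ q]) auto
  qed
  have diff: "\<bar>a - a'\<bar> * real n \<le> E n a + E n a'" for a a' n
  proof -
    have "\<bar>a - a'\<bar> * real n = (\<integral>\<xi>. \<bar>a - a'\<bar> * real n \<partial>Q)" by simp
    also have "\<dots> \<le> (\<integral>\<xi>. \<bar>total_var m \<omega> \<xi> n - a * real n\<bar> + \<bar>total_var m \<omega> \<xi> n - a' * real n\<bar> \<partial>Q)"
    proof (rule integral_mono)
      fix \<xi>
      have "\<bar>a - a'\<bar> * real n = \<bar>a * real n - a' * real n\<bar>"
        by (simp add: abs_mult left_diff_distrib[symmetric])
      then show "\<bar>a - a'\<bar> * real n \<le> \<bar>total_var m \<omega> \<xi> n - a * real n\<bar> + \<bar>total_var m \<omega> \<xi> n - a' * real n\<bar>"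
        by linarith
    qed (use V in auto)
    finally show ?thesis using V by (simp add: E_def)
  qed
  have E_le: "E n a \<le> E n a' + \<bar>a' - a\<bar> * real n" for n a a'
  proof -
    have "E n a \<le> (\<integral>\<xi>. \<bar>total_var m \<omega> \<xi> n - a' * real n\<bar> + \<bar>a' - a\<bar> * real n \<partial>Q)"
      unfolding E_def
    proof (rule integral_mono)
      fix \<xi>
      have "\<bar>a' - a\<bar> * real n = \<bar>a' * real n - a * real n\<bar>"
        by (simp add: abs_mult left_diff_distrib[symmetric])
      then show "\<bar>total_var m \<omega> \<xi> n - a * real n\<bar> \<le> \<bar>total_var m \<omega> \<xi> n - a' * real n\<bar> + \<bar>a' - a\<bar> * real n"
        by linarith
    qed (use V in auto)
    then show ?thesis using V by (simp add: E_def)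
  qed
  have cc: "\<bar>c i - c j\<bar> \<le> l i + l j" if "i \<in> G" "j \<in> G" for i j
  proof (rule le)
    fix n
    have "E n (c i) + E n (c j) \<le> (l i * real n + B i * (1 + sqrt (real n))) + (l j * real n + B j * (1 + sqrt (real n)))"
      using that by (intro add_mono) (auto simp: G_def)
    also have "\<dots> = (l i + l j) * real n + (B i + B j) * (1 + sqrt (real n))" by (simp add: algebra_simps)
    finally show "\<bar>c i - c j\<bar> * real n \<le> (l i + l j) * real n + (B i + B j) * (1 + sqrt (real n))"
      using diff[of "c i" "c j" n] by simp
  qed
  have "Cauchy c"
  proof (rule CauchyI)
    fix e :: real assume "0 < e"
    then have "\<forall>\<^sub>F i in sequentially. i \<in> G \<and> l i < e / 2"
      by (intro eventually_conj G order_tendstoD(2)[OF l]) simp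
    then obtain N where N: "\<And>i. N \<le> i \<Longrightarrow> i \<in> G \<and> l i < e / 2" by (auto simp: eventually_sequentially)
    have "norm (c i - c j) < e" if "N \<le> i" "N \<le> j" for i j
      using cc[of i j] N[OF that(1)] N[OF that(2)] by simp
    then show "\<exists>N. \<forall>i\<ge>N. \<forall>j\<ge>N. norm (c i - c j) < e" by blast
  qed
  then show conv: "convergent c" by (rule Cauchy_convergent)
  then have c: "c \<longlonglongrightarrow> lim c" by (simp add: convergent_LIMSEQ_iff)
  have cl: "\<bar>c i - lim c\<bar> \<le> l i" if "i \<in> G" for i
  proof (rule tendsto_le[OF trivial_limit_sequentially])
    show "(\<lambda>j. \<bar>c i - c j\<bar>) \<longlonglongrightarrow> \<bar>c i - lim c\<bar>" by (intro tendsto_intros c)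
    show "(\<lambda>j. l i + l j) \<longlonglongrightarrow> l i" using tendsto_add[OF tendsto_const l] by simp
    show "\<forall>\<^sub>F j in sequentially. \<bar>c i - c j\<bar> \<le> l i + l j"
      using G by eventually_elim (rule cc[OF that])
  qed
  have "2 * \<epsilon> \<le> lim c + 2 * l i" if "i \<in> G" for i
  proof -
    have "2 * \<epsilon> - c i \<le> l i"
    proof (rule le)
      fix n
      have "(2 * \<epsilon> - c i) * real n = (\<integral>\<xi>. (2 * \<epsilon> - c i) * real n \<partial>Q)" by simp
      also have "\<dots> \<le> E n (c i)"
        unfolding E_def
      proof (rule integral_mono)
        show "(2 * \<epsilon> - c i) * real n \<le> \<bar>total_var m \<omega> \<xi> n - c i * real n\<bar>" for \<xi>
          using total_var_ge[of n \<xi>] by (simp add: left_diff_distrib)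
      qed (use V in auto)
      also have "\<dots> \<le> l i * real n + B i * (1 + sqrt (real n))" using that by (simp add: G_def)
      finally show "(2 * \<epsilon> - c i) * real n \<le> l i * real n + B i * (1 + sqrt (real n))" .
    qed
    then show ?thesis using cl[OF that] by linarith
  qed
  then have "\<forall>\<^sub>F i in sequentially. 2 * \<epsilon> \<le> lim c + 2 * l i" using G by (auto elim: eventually_mono)
  moreover have "(\<lambda>i. lim c + 2 * l i) \<longlonglongrightarrow> lim c + 2 * 0" by (intro tendsto_intros l)
  ultimately show "2 * \<epsilon> \<le> lim c"
    using tendsto_lowerbound[of "\<lambda>i. lim c + 2 * l i" "lim c" sequentially "2 * \<epsilon>"] by simp
  show "(\<lambda>n. \<integral>\<xi>. \<bar>total_var m \<omega> \<xi> n - lim c * real n\<bar> \<partial>Q) \<in> o(\<lambda>n. real n)"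
  proof (rule smalloI_tendsto)
    have E0: "0 \<le> E n a" for n a unfolding E_def by (rule Bochner_Integration.integral_nonneg) simp
    have "(\<lambda>n. E n (lim c) / real n) \<longlonglongrightarrow> 0"
    proof (rule tendstoI)
      fix e :: real assume e: "0 < e"
      have "\<forall>\<^sub>F i in sequentially. i \<in> G \<and> l i < e / 4"
        by (intro eventually_conj G order_tendstoD(2)[OF l]) (use e in simp)
      then obtain i where i: "i \<in> G" "l i < e / 4" by (auto simp: eventually_sequentially)
      have "\<forall>\<^sub>F n in sequentially. B i * ((1 + sqrt (real n)) / real n) < e / 2"
        by (rule order_tendstoD(2)[OF lim]) (use e in simp)
      then show "\<forall>\<^sub>F n in sequentially. dist (E n (lim c) / real n) 0 < e"
        using eventually_gt_at_top[of 0]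
      proof eventually_elim
        case (elim n)
        have "E n (lim c) \<le> E n (c i) + \<bar>c i - lim c\<bar> * real n" by (rule E_le)
        also have "\<dots> \<le> (l i * real n + B i * (1 + sqrt (real n))) + l i * real n"
          using i(1) cl[OF i(1)] by (intro add_mono mult_right_mono) (auto simp: G_def)
        finally have "E n (lim c) / real n \<le> ((l i * real n + B i * (1 + sqrt (real n))) + l i * real n) / real n"
          by (intro divide_right_mono) auto
        also have "\<dots> = 2 * l i + B i * ((1 + sqrt (real n)) / real n)"
          using elim by (simp add: field_simps)
        also have "\<dots> < e" using elim i by linarith
        finally show ?case using E0[of n "lim c"] by simp
      qed
    qed
    then show "(\<lambda>n. (\<integral>\<xi>. \<bar>total_var m \<omega> \<xi> n - lim c * real n\<bar> \<partial>Q) / real n) \<longlonglongrightarrow> 0" by (simp add: E_def)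
    show "\<forall>\<^sub>F n in sequentially. real n \<noteq> 0" using eventually_gt_at_top[of "0::nat"] by eventually_elim simp
  qed
qed

end

lemma shift_apply_0 [simp]: "shift k \<omega> 0 = \<omega> k"
  by (simp add: shift_def)

lemma shift_shift [simp]: "shift j (shift k \<omega>) = shift (j + k) \<omega>"
  by (simp add: shift_def add.assoc)

lemma shift_0 [simp]: "shift 0 \<omega> = \<omega>"
  by (simp add: shift_def)

lemma shift_funpow: "(shift k ^^ n) \<omega> = shift (int n * k) \<omega>"
  by (induction n) (simp_all add: algebra_simps)

section \<open>The environment seen from the walk and the asymptotic variance\<close>

locale ergodic_env = prob_space P for P :: "env measure" +
  fixes m :: int and \<epsilon> :: real
  assumes m_pos: "1 \<le> m"
    and env_law: "env_law m P"
    and stationary: "strictly_stationary P"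
    and ergodic: "ergodic P"
    and eps_pos: "0 < \<epsilon>"
    and support_elliptic: "\<And>p. p \<in> vector_support P \<Longrightarrow> \<epsilon> \<le> p 1 \<and> \<epsilon> \<le> p (- 1)"
    and support_centered: "\<And>p. p \<in> vector_support P \<Longrightarrow> (\<Sum>j=-m..m. real_of_int j * p j) = 0"
begin

lemma sets_P: "sets P = sets (env_space m)"
  using env_law by (simp add: env_law_def)

lemma space_P: "space P = {\<omega>. \<forall>x. \<omega> x \<in> prob_vectors m}"
  using sets_eq_imp_space_eq[OF sets_P] by (simp add: space_env_space)

lemma shift_measurable_P [measurable]: "shift k \<in> measurable P P"
  using shift_measurable[of k m] by (simp add: measurable_cong_sets[OF sets_P sets_P])

lemma distr_shift: "distr P P (shift k) = P"
  using stationary by (simp add: strictly_stationary_def)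

lemma shift_in_space: "\<omega> \<in> space P \<Longrightarrow> shift k \<omega> \<in> space P"
  by (simp add: space_P shift_def)

lemma AE_shift: "AE \<omega> in P. R \<omega> \<Longrightarrow> AE \<omega> in P. R (shift k \<omega>)"
  using AE_distrD[OF shift_measurable_P, of R k] unfolding distr_shift by blast

lemma integral_shift: "f \<in> borel_measurable P \<Longrightarrow> (\<integral>\<omega>. f (shift k \<omega>) \<partial>P) = (\<integral>\<omega>. f \<omega> \<partial>P)" for f :: "env \<Rightarrow> real"
  using integral_distr[OF shift_measurable_P, of f k] by (simp add: distr_shift)

lemma entry_measurable [measurable]: "(\<lambda>\<omega>. \<omega> x j) \<in> borel_measurable P"
proof -
  have "(\<lambda>p::int \<Rightarrow> real. p j) \<in> borel_measurable borel"
    by (rule borel_measurable_continuous_onI[OF continuous_on_product_coordinates])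
  from measurable_compose[OF env_coordinate_measurable[OF env_law] this] show ?thesis .
qed

lemma AE_in_support: "AE \<omega> in P. \<forall>x. \<omega> x \<in> vector_support P"
proof -
  have "AE p in distr P borel (\<lambda>\<omega>. \<omega> 0). p \<in> vector_support P"
    unfolding vector_support_def by (rule AE_measure_support) simp
  from AE_distrD[OF env_coordinate_measurable[OF env_law] this]
  have "AE \<omega> in P. \<omega> 0 \<in> vector_support P" .
  from AE_shift[OF this] have "AE \<omega> in P. \<omega> x \<in> vector_support P" for x by simp
  then show ?thesis by (simp add: AE_all_countable)
qed

lemma centered_walk_if_in_support:
  assumes "\<And>x. \<omega> x \<in> vector_support P"
  shows "centered_walk m \<omega> \<epsilon>"
proof
  show "\<forall>x. \<omega> x \<in> prob_vectors m" using assms vector_support_subset[OF env_law] by blast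
qed (use assms support_elliptic support_centered m_pos eps_pos in auto)

lemma env_entry:
  assumes "\<omega> \<in> space P"
  shows "0 \<le> \<omega> x j" "(\<Sum>j=-m..m. \<omega> x j) = 1"
  using assms by (auto simp: space_P prob_vectors_def)

definition env_transition :: "(env \<Rightarrow> real) \<Rightarrow> env \<Rightarrow> real" where
  "env_transition g \<omega> = (\<Sum>j=-m..m. \<omega> 0 j * g (shift j \<omega>))"

definition env_var :: "env \<Rightarrow> real" where
  "env_var \<omega> = (\<Sum>j=-m..m. (real_of_int j)\<^sup>2 * \<omega> 0 j)"

text \<open>An integrable \<open>\<phi>\<close> is orthogonal to this space exactly when
  \<open>\<phi>\<close> is the density of a signed invariant measure of total mass zero for the
  environment seen from the walk.\<close>

definition corrected_constants :: "(env \<Rightarrow> real) set" where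
  "corrected_constants = {h. \<exists>c g B. g \<in> borel_measurable P \<and> (\<forall>\<omega>. \<bar>g \<omega>\<bar> \<le> B) \<and>
     h = (\<lambda>\<omega>. c + (g \<omega> - env_transition g \<omega>))}"

lemma env_transition_measurable [measurable]:
  assumes g: "g \<in> borel_measurable P"
  shows "env_transition g \<in> borel_measurable P"
proof -
  have [measurable]: "(\<lambda>\<omega>. g (shift j \<omega>)) \<in> borel_measurable P" for j
    by (rule measurable_compose[OF shift_measurable_P g])
  show ?thesis unfolding env_transition_def[abs_def] by measurable
qed

lemma env_var_measurable [measurable]: "env_var \<in> borel_measurable P"
  unfolding env_var_def[abs_def] by measurable

lemma env_transition_bound:
  assumes "\<omega> \<in> space P" "\<And>\<omega>. \<bar>g \<omega>\<bar> \<le> B"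
  shows "\<bar>env_transition g \<omega>\<bar> \<le> B"
proof -
  have "\<bar>env_transition g \<omega>\<bar> \<le> (\<Sum>j=-m..m. \<omega> 0 j * B)"
    unfolding env_transition_def
    by (rule order_trans[OF sum_abs])
       (auto intro!: sum_mono mult_left_mono simp: abs_mult assms env_entry(1)[OF assms(1)])
  then show ?thesis by (simp add: sum_distrib_right[symmetric] env_entry(2)[OF assms(1)])
qed

lemma env_var_bound: "\<omega> \<in> space P \<Longrightarrow> \<bar>env_var \<omega>\<bar> \<le> (\<Sum>j=-m..m. (real_of_int j)\<^sup>2)"
proof -
  assume \<omega>: "\<omega> \<in> space P"
  have "\<omega> 0 j \<le> 1" if "j \<in> {-m..m}" for j
    using member_le_sum[OF that, of "\<omega> 0"] env_entry[OF \<omega>] by simp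
  then show ?thesis
    unfolding env_var_def
    by (intro order_trans[OF sum_abs] sum_mono) (auto simp: abs_mult env_entry(1)[OF \<omega>] intro: mult_left_le)
qed

text \<open>A set that the shift maps into itself almost surely is invariant up to null sets: the
  indicator can only increase along the shift, yet its mean is preserved.\<close>

lemma ergodic_forward_closed:
  fixes \<phi> :: "env \<Rightarrow> real"
  assumes \<phi>[measurable]: "\<phi> \<in> borel_measurable P"
    and closed: "AE \<omega> in P. 0 < \<phi> \<omega> \<longrightarrow> 0 < \<phi> (shift 1 \<omega>)"
  shows "(AE \<omega> in P. 0 < \<phi> \<omega>) \<or> (AE \<omega> in P. \<phi> \<omega> \<le> 0)"
proof -
  define I where "I = (\<lambda>\<omega>. if 0 < \<phi> \<omega> then 1 else 0 :: real)"
  have I [measurable]: "I \<in> borel_measurable P" unfolding I_def by measurable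
  have int: "integrable P I" "integrable P (\<lambda>\<omega>. I (shift 1 \<omega>))"
    by (rule integrable_bounded[where C=1]; simp add: I_def)+
  have "(\<integral>\<omega>. I (shift 1 \<omega>) - I \<omega> \<partial>P) = 0"
    using int integral_shift[OF I, of 1] by simp
  moreover have "AE \<omega> in P. 0 \<le> I (shift 1 \<omega>) - I \<omega>"
    using closed by eventually_elim (auto simp: I_def)
  ultimately have "AE \<omega> in P. I (shift 1 \<omega>) - I \<omega> = 0"
    using int by (subst (asm) integral_nonneg_eq_0_iff_AE) auto
  then have "AE \<omega> in P. 0 < \<phi> \<omega> \<longleftrightarrow> 0 < \<phi> (shift 1 \<omega>)"
    by eventually_elim (auto simp: I_def split: if_splits)
  from AE_shift[OF this] have step: "AE \<omega> in P. \<forall>n. 0 < \<phi> (shift (int n) \<omega>) \<longleftrightarrow> 0 < \<phi> (shift (1 + int n) \<omega>)"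
    by (simp add: AE_all_countable)
  \<comment> \<open>\<open>ergodic\<close> speaks of strictly invariant sets only. The set of
    environments whose forward orbit meets the positivity set infinitely often is strictly invariant
    and differs from that set by a null set.\<close>
  define A where "A = {\<omega> \<in> space P. \<forall>N. \<exists>n\<ge>N. 0 < \<phi> (shift (int n) \<omega>)}"
  have A [measurable]: "A \<in> sets P" unfolding A_def by measurable
  have "shift 1 -` A \<inter> space P = A"
  proof -
    have "(\<forall>N. \<exists>n\<ge>N. R (Suc n)) \<longleftrightarrow> (\<forall>N. \<exists>n\<ge>N. R n)" for R :: "nat \<Rightarrow> bool"
      by (metis Suc_le_D Suc_le_mono le_SucI)
    from this[of "\<lambda>n. 0 < \<phi> (shift (int n) _)"] show ?thesis
      by (auto simp: A_def shift_in_space add.commute)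
  qed
  with ergodic A have "measure P A = 0 \<or> measure P A = 1" unfolding ergodic_def by blast
  moreover have eq: "AE \<omega> in P. \<omega> \<in> A \<longleftrightarrow> 0 < \<phi> \<omega>"
    using step AE_space
  proof eventually_elim
    case (elim \<omega>)
    have "0 < \<phi> (shift (int n) \<omega>) \<longleftrightarrow> 0 < \<phi> \<omega>" for n
      by (induction n) (use elim in auto)
    then show ?case using elim by (auto simp: A_def)
  qed
  ultimately show ?thesis
  proof (elim disjE)
    assume "measure P A = 0"
    then have "AE \<omega> in P. \<omega> \<notin> A" using A by (simp add: prob_eq_0)
    with eq have "AE \<omega> in P. \<phi> \<omega> \<le> 0" by eventually_elim auto
    then show ?thesis ..
  next
    assume "measure P A = 1"
    then have "AE \<omega> in P. \<omega> \<in> A" using A by (simp add: prob_eq_1)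
    with eq have "AE \<omega> in P. 0 < \<phi> \<omega>" by eventually_elim auto
    then show ?thesis ..
  qed
qed

text \<open>Testing against the sign of \<open>\<phi>\<close> shows that the walk on environments cannot leave the set
  where \<open>\<phi>\<close> is positive.\<close>

lemma annihilator_trivial:
  assumes \<phi>: "integrable P \<phi>"
    and orth: "\<And>h. h \<in> corrected_constants \<Longrightarrow> (\<integral>\<omega>. \<phi> \<omega> * h \<omega> \<partial>P) = 0"
  shows "AE \<omega> in P. \<phi> \<omega> = 0"
proof -
  have \<phi>m [measurable]: "\<phi> \<in> borel_measurable P" using \<phi> by auto
  define g where "g = (\<lambda>\<omega>. (if 0 < \<phi> \<omega> then 1 else 0) - (if \<phi> \<omega> < 0 then 1 else 0) :: real)"
  have gm [measurable]: "g \<in> borel_measurable P" unfolding g_def by measurable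
  have gb: "\<bar>g \<omega>\<bar> \<le> 1" for \<omega> by (simp add: g_def)
  have "(\<lambda>\<omega>. 1 + (0 - env_transition (\<lambda>_. 0) \<omega>)) \<in> corrected_constants"
    unfolding corrected_constants_def
    \<comment> \<open>The constant 1 is an approximant, so \<open>\<phi>\<close> has mean zero; this
      finally excludes a nonzero \<open>\<phi>\<close> of constant sign.\<close>
    by (rule CollectI, rule exI[of _ 1], rule exI[of _ "\<lambda>_. 0"], rule exI[of _ 0]) simp
  from orth[OF this] have \<phi>0: "(\<integral>\<omega>. \<phi> \<omega> \<partial>P) = 0" by (simp add: env_transition_def)
  have "(\<lambda>\<omega>. 0 + (g \<omega> - env_transition g \<omega>)) \<in> corrected_constants"
    unfolding corrected_constants_def
    by (rule CollectI, rule exI[of _ 0], rule exI[of _ g], rule exI[of _ 1]) (simp add: gb)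
  from orth[OF this] have k0: "(\<integral>\<omega>. \<phi> \<omega> * (g \<omega> - env_transition g \<omega>) \<partial>P) = 0" by simp
  have int: "integrable P (\<lambda>\<omega>. \<phi> \<omega> * (g \<omega> - env_transition g \<omega>))"
  proof (rule Bochner_Integration.integrable_bound[of P "\<lambda>\<omega>. 2 * \<phi> \<omega>"])
    show "AE \<omega> in P. norm (\<phi> \<omega> * (g \<omega> - env_transition g \<omega>)) \<le> norm (2 * \<phi> \<omega>)"
    proof (rule AE_I2)
      fix \<omega> assume "\<omega> \<in> space P"
      then have "\<bar>env_transition g \<omega>\<bar> \<le> 1" by (rule env_transition_bound) (rule gb)
      then have "\<bar>g \<omega> - env_transition g \<omega>\<bar> \<le> 2" using gb[of \<omega>] by linarith
      then show "norm (\<phi> \<omega> * (g \<omega> - env_transition g \<omega>)) \<le> norm (2 * \<phi> \<omega>)"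
        by (simp add: abs_mult mult.commute[of 2] mult_left_mono)
    qed
  qed (use \<phi> in auto)
  \<comment> \<open>Here \<open>g\<close> is the sign of \<open>\<phi>\<close>, so the product is
    \<open>|\<phi>|\<close> minus \<open>\<phi>\<close> times an average of signs, which is at most
    1 in modulus. Its integral is zero, so it vanishes almost everywhere.\<close>
  have nonneg: "0 \<le> \<phi> \<omega> * (g \<omega> - env_transition g \<omega>)" if "\<omega> \<in> space P" for \<omega>
  proof -
    have "\<bar>env_transition g \<omega>\<bar> \<le> 1" using env_transition_bound[of \<omega> g 1] gb that by blast
    then show ?thesis
      by (cases "\<phi> \<omega>" "0::real" rule: linorder_cases) (auto simp: g_def intro!: mult_nonneg_nonneg mult_nonpos_nonpos)
  qed
  have "AE \<omega> in P. \<phi> \<omega> * (g \<omega> - env_transition g \<omega>) = 0"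
    using k0 int nonneg by (subst (asm) integral_nonneg_eq_0_iff_AE) auto
  then have "AE \<omega> in P. 0 < \<phi> \<omega> \<longrightarrow> 0 < \<phi> (shift 1 \<omega>)"
    using AE_in_support AE_space
  proof eventually_elim
    case (elim \<omega>)
    show ?case
    proof
      assume pos: "0 < \<phi> \<omega>"
      then have T: "env_transition g \<omega> = 1" using elim(1) by (auto simp: g_def)
      \<comment> \<open>An average of signs equal to 1 forces sign 1 at every jump of positive
        probability, in particular at the jump +1.\<close>
      have "\<omega> 0 1 * (1 - g (shift 1 \<omega>)) \<le> (\<Sum>j=-m..m. \<omega> 0 j * (1 - g (shift j \<omega>)))"
        by (rule member_le_sum) (use m_pos env_entry(1)[OF elim(3)] gb in \<open>auto simp: abs_le_iff\<close>)
      also have "\<dots> = 1 - env_transition g \<omega>"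
        by (simp add: env_transition_def right_diff_distrib sum_subtractf env_entry(2)[OF elim(3)])
      finally have "\<omega> 0 1 * (1 - g (shift 1 \<omega>)) \<le> 0" by (simp add: T)
      moreover have "0 < \<omega> 0 1" using support_elliptic[of "\<omega> 0"] elim(2) eps_pos by auto
      ultimately have "1 \<le> g (shift 1 \<omega>)" by (simp add: mult_le_0_iff)
      then show "0 < \<phi> (shift 1 \<omega>)" by (auto simp: g_def split: if_splits)
    qed
  qed
  from ergodic_forward_closed[OF \<phi>m this] show ?thesis
  proof
    assume "AE \<omega> in P. 0 < \<phi> \<omega>"
    then have "AE \<omega> in P. 0 \<le> \<phi> \<omega>" by eventually_elim simp
    then show ?thesis using integral_nonneg_eq_0_iff_AE[OF \<phi>] \<phi>0 by blast
  next
    assume "AE \<omega> in P. \<phi> \<omega> \<le> 0"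
    then have "AE \<omega> in P. 0 \<le> - \<phi> \<omega>" by eventually_elim simp
    then have "AE \<omega> in P. - \<phi> \<omega> = 0"
      using integral_nonneg_eq_0_iff_AE[of P "\<lambda>\<omega>. - \<phi> \<omega>"] \<phi> \<phi>0 by simp
    then show ?thesis by simp
  qed
qed

lemma approximate_corrector:
  assumes "0 < e"
  shows "\<exists>c g B. g \<in> borel_measurable P \<and> (\<forall>\<omega>. \<bar>g \<omega>\<bar> \<le> B) \<and>
    (\<integral>\<omega>. \<bar>env_var \<omega> - (c + (g \<omega> - env_transition g \<omega>))\<bar> \<partial>P) < e"
proof -
  have "\<exists>h\<in>corrected_constants. (\<integral>\<omega>. \<bar>env_var \<omega> - h \<omega>\<bar> \<partial>P) < e"
  proof (rule L1_dense_if_no_annihilator[OF env_var_measurable env_var_bound _ _ _ _ annihilator_trivial assms])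
    fix h assume "h \<in> corrected_constants"
    then obtain c g B where h: "g \<in> borel_measurable P" "\<And>\<omega>. \<bar>g \<omega>\<bar> \<le> B" "h = (\<lambda>\<omega>. c + (g \<omega> - env_transition g \<omega>))"
      by (auto simp: corrected_constants_def)
    note h(1) [measurable]
    show "h \<in> borel_measurable P" unfolding h(3) by measurable
    have "\<bar>h \<omega>\<bar> \<le> \<bar>c\<bar> + 2 * B" if "\<omega> \<in> space P" for \<omega>
      using env_transition_bound[of \<omega> g B, OF that h(2)] h(2)[of \<omega>] unfolding h(3) by linarith
    then show "\<exists>C. \<forall>\<omega>\<in>space P. \<bar>h \<omega>\<bar> \<le> C" by blast
    fix k t assume "k \<in> corrected_constants"
    then obtain c' g' B' where k: "g' \<in> borel_measurable P" "\<And>\<omega>. \<bar>g' \<omega>\<bar> \<le> B'" "k = (\<lambda>\<omega>. c' + (g' \<omega> - env_transition g' \<omega>))"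
      by (auto simp: corrected_constants_def)
    note k(1) [measurable]
    have T: "env_transition (\<lambda>\<omega>. g \<omega> + t * g' \<omega>) \<omega> = env_transition g \<omega> + t * env_transition g' \<omega>" for \<omega>
      by (simp add: env_transition_def sum_distrib_left sum.distrib[symmetric] algebra_simps)
    show "(\<lambda>\<omega>. h \<omega> + t * k \<omega>) \<in> corrected_constants"
      unfolding corrected_constants_def
    proof (rule CollectI, rule exI[of _ "c + t * c'"], rule exI[of _ "\<lambda>\<omega>. g \<omega> + t * g' \<omega>"],
        rule exI[of _ "B + \<bar>t\<bar> * B'"], intro conjI allI)
      show "(\<lambda>\<omega>. g \<omega> + t * g' \<omega>) \<in> borel_measurable P" by measurable
      show "\<bar>g \<omega> + t * g' \<omega>\<bar> \<le> B + \<bar>t\<bar> * B'" for \<omega>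
        using abs_triangle_ineq[of "g \<omega>" "t * g' \<omega>"] h(2)[of \<omega>] mult_left_mono[OF k(2)[of \<omega>], of "\<bar>t\<bar>"]
        by (simp add: abs_mult)
      show "(\<lambda>\<omega>. h \<omega> + t * k \<omega>) = (\<lambda>\<omega>. (c + t * c') + ((g \<omega> + t * g' \<omega>) - env_transition (\<lambda>\<omega>. g \<omega> + t * g' \<omega>) \<omega>))"
        unfolding T h(3) k(3) by (simp add: algebra_simps)
    qed
  next
    have "(\<lambda>\<omega>. 0 + (0 - env_transition (\<lambda>_. 0) \<omega>)) \<in> corrected_constants"
      unfolding corrected_constants_def
      by (rule CollectI, rule exI[of _ 0], rule exI[of _ "\<lambda>_. 0"], rule exI[of _ 0]) simp
    then show "corrected_constants \<noteq> {}" by blast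
  qed
  then show ?thesis unfolding corrected_constants_def by blast
qed

lemma quenched_variance:
  "\<exists>\<sigma>>0. AE \<omega> in P. centered_walk m \<omega> \<epsilon> \<and>
     (\<lambda>n. \<integral>\<xi>. \<bar>total_var m \<omega> \<xi> n - \<sigma>\<^sup>2 * real n\<bar> \<partial>walk_law \<omega>) \<in> o(\<lambda>n. real n)"
proof -
  \<comment> \<open>An error below 4^-i allows the maximal inequality at level 2^-i, with
    exceptional probability at most 2^-i; the first makes the error vanish, the second is summable
    for Borel-Cantelli.\<close>
  have "\<forall>i::nat. \<exists>c g B. g \<in> borel_measurable P \<and> (\<forall>\<omega>. \<bar>g \<omega>\<bar> \<le> B) \<and>
    (\<integral>\<omega>. \<bar>env_var \<omega> - (c + (g \<omega> - env_transition g \<omega>))\<bar> \<partial>P) < (1 / 4) ^ i"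
    by (intro allI approximate_corrector) simp
  then obtain c g B where gm: "\<And>i. g i \<in> borel_measurable P" and gB: "\<And>i \<omega>. \<bar>g i \<omega>\<bar> \<le> B i"
    and small: "\<And>i. (\<integral>\<omega>. \<bar>env_var \<omega> - (c i + (g i \<omega> - env_transition (g i) \<omega>))\<bar> \<partial>P) < (1 / 4) ^ i"
    unfolding choice_iff by blast
  note gm [measurable]
  define \<rho> where "\<rho> = (\<lambda>i \<omega>. \<bar>env_var \<omega> - (c i + (g i \<omega> - env_transition (g i) \<omega>))\<bar>)"
  have \<rho>m [measurable]: "\<rho> i \<in> borel_measurable P" for i unfolding \<rho>_def by measurable
  have \<rho>int: "integrable P (\<rho> i)" for i
  proof (rule integrable_bounded[OF \<rho>m])
    show "\<bar>\<rho> i \<omega>\<bar> \<le> (\<Sum>j=-m..m. (real_of_int j)\<^sup>2) + \<bar>c i\<bar> + 2 * B i" if "\<omega> \<in> space P" for \<omega>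
      using env_var_bound[OF that] env_transition_bound[where g="g i" and B="B i", OF that gB] gB[of i \<omega>]
      unfolding \<rho>_def by linarith
  qed
  \<comment> \<open>The values 1 and -1 of \<open>k\<close> serve the two half-lines that start at
    the origin, as required by \<open>occupation_bound\<close>.\<close>
  define bad where "bad = (\<lambda>k i. {\<omega> \<in> space P. \<exists>N. (1 / 2) ^ i * real N < (\<Sum>y<N. \<rho> i (shift (int y * k) \<omega>))})"
  have bad_sets: "bad k i \<in> sets P" for k i unfolding bad_def by measurable
  have bad_prob: "prob (bad k i) \<le> (1 / 2) ^ i" for k i
  proof -
    have "prob (bad k i) \<le> (\<integral>\<omega>. \<rho> i \<omega> \<partial>P) / (1 / 2) ^ i"
      using maximal_inequality[OF \<rho>int _ shift_measurable_P distr_shift, of i "(1 / 2) ^ i" k]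
      by (simp add: bad_def shift_funpow \<rho>_def)
    also have "\<dots> \<le> (1 / 4) ^ i / (1 / 2) ^ i"
      using small[of i] by (intro divide_right_mono) (auto simp: \<rho>_def)
    also have "\<dots> = (1 / 2) ^ i" by (simp add: power_divide[symmetric] flip: power_divide)
    finally show ?thesis .
  qed
  have "AE \<omega> in P. \<forall>\<^sub>F i in sequentially. \<omega> \<in> space P - bad k i" for k
  proof (rule borel_cantelli_AE1[OF bad_sets])
    show "summable (\<lambda>i. prob (bad k i))"
      by (rule summable_comparison_test'[of "\<lambda>i. (1 / 2) ^ i" 0]) (use bad_prob in auto)
  qed (simp add: less_top[symmetric])
  from this[of 1] this[of "- 1"] AE_in_support
  have main: "AE \<omega> in P. centered_walk m \<omega> \<epsilon> \<and> convergent c \<and> 2 * \<epsilon> \<le> lim c \<and>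
     (\<lambda>n. \<integral>\<xi>. \<bar>total_var m \<omega> \<xi> n - lim c * real n\<bar> \<partial>walk_law \<omega>) \<in> o(\<lambda>n. real n)"
  proof eventually_elim
    case (elim \<omega>)
    interpret W: centered_walk m \<omega> \<epsilon> by (rule centered_walk_if_in_support) (use elim(3) in blast)
    \<comment> \<open>The level 2^-i times the constant \<open>m^2 / \<epsilon>\<close> of
      \<open>occupation_bound\<close>.\<close>
    define l where "l = (\<lambda>i. (1 / 2) ^ i * ((real_of_int m)\<^sup>2 / \<epsilon>))"
    have "\<forall>\<^sub>F i in sequentially. \<forall>n. (\<integral>\<xi>. \<bar>total_var m \<omega> \<xi> n - c i * real n\<bar> \<partial>walk_law \<omega>)
        \<le> l i * real n + 2 * B i * (1 + sqrt (real n))"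
      using elim(1,2)
    proof eventually_elim
      case (elim i)
      show ?case
      proof
        fix n
        have "(\<integral>\<xi>. \<bar>total_var m \<omega> \<xi> n - c i * real n\<bar> \<partial>walk_law \<omega>)
          \<le> (1 / 2) ^ i * (real_of_int m)\<^sup>2 / \<epsilon> * real n + 2 * B i + 2 * B i * sqrt n"
        proof (rule W.total_var_deviation[where r="\<lambda>x. \<rho> i (shift x \<omega>)" and g="\<lambda>x. g i (shift x \<omega>)"])
          fix x
          have "W.var_at x = env_var (shift x \<omega>)"
            by (simp add: W.var_at_def env_var_def)
          moreover have "W.transition (\<lambda>x. g i (shift x \<omega>)) x = env_transition (g i) (shift x \<omega>)"
            by (simp add: W.transition_def env_transition_def add.commute)
          ultimately show "\<bar>W.var_at x - c i - (g i (shift x \<omega>) - W.transition (\<lambda>x. g i (shift x \<omega>)) x)\<bar> \<le> \<rho> i (shift x \<omega>)"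
            by (simp add: \<rho>_def algebra_simps)
        next
          show "(\<Sum>y<n. \<rho> i (shift (int y) \<omega>)) \<le> (1 / 2) ^ i * real n" for n
            using elim(1) by (auto simp: bad_def not_less)
          show "(\<Sum>y<n. \<rho> i (shift (- int y) \<omega>)) \<le> (1 / 2) ^ i * real n" for n
            using elim(2) by (auto simp: bad_def not_less)
        qed (rule gB)
        then show "(\<integral>\<xi>. \<bar>total_var m \<omega> \<xi> n - c i * real n\<bar> \<partial>walk_law \<omega>)
            \<le> l i * real n + 2 * B i * (1 + sqrt (real n))"
          by (simp add: l_def algebra_simps)
      qed
    qed
    moreover have "l \<longlonglongrightarrow> 0"
      unfolding l_def by (rule tendsto_mult_left_zero) (rule LIMSEQ_power_zero, simp)
    ultimately show ?case
      using W.variance_limit[of c l "\<lambda>i. 2 * B i"] W.centered_walk_axioms by blast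
  qed
  \<comment> \<open>The inequality does not involve the environment, so holding almost surely under
    a probability measure it simply holds.\<close>
  then have "AE \<omega> in P. 2 * \<epsilon> \<le> lim c" by eventually_elim blast
  then have "0 < lim c" using eps_pos by simp
  then have "0 < sqrt (lim c)" "(sqrt (lim c))\<^sup>2 = lim c" by simp_all
  with main show ?thesis by (intro exI[of _ "sqrt (lim c)"]) (auto elim: eventually_mono)
qed

end

theorem theorem3:
  fixes m :: int and P :: "env measure"
  assumes "m > 1"
    and "env_law m P"
    and "\<forall>x. measure P {\<omega> \<in> space P. \<omega> x m > 0} > 0 \<or> measure P {\<omega> \<in> space P. \<omega> x (-m) > 0} > 0"
    and "strictly_stationary P" and "ergodic P"
    and "\<exists>\<epsilon>>0. \<forall>p\<in>vector_support P. p 1 \<ge> \<epsilon> \<and> p (-1) \<ge> \<epsilon>"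
    and "\<forall>p\<in>vector_support P. (\<Sum>j=-m..m. real_of_int j * p j) = 0"
  shows "(\<forall>\<omega>. (\<forall>x. \<omega> x \<in> vector_support P) \<longrightarrow>
            weak_conv_at_top
              (\<lambda>t. distr (walk_law \<omega>) borel (\<lambda>\<xi>. real_of_int (\<xi> (var_time m \<omega> \<xi> t)) / sqrt t))
              std_normal_distribution)
    \<and> (\<exists>\<sigma>>0. AE \<omega> in P.
          uniform_limit UNIV
            (\<lambda>(t::nat) x. measure (walk_law \<omega>)
               {\<xi> \<in> space (walk_law \<omega>). real_of_int (\<xi> t) / sqrt (real t) \<le> x})
            (\<lambda>x. 1 / (sqrt (2 * pi) * \<sigma>) * (LBINT u:{..x}. exp (- u\<^sup>2 / (2 * \<sigma>\<^sup>2))))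
            sequentially)"
proof -
  have env_law: "env_law m P" and "ergodic P" and stat: "strictly_stationary P" by fact+
  have "1 \<le> m" using \<open>m > 1\<close> by simp
  obtain \<epsilon> where "0 < \<epsilon>" and ell: "\<forall>p\<in>vector_support P. p 1 \<ge> \<epsilon> \<and> p (-1) \<ge> \<epsilon>"
    using assms(6) by blast
  have "prob_space P" using env_law by (simp add: env_law_def)
  then interpret ergodic_env P m \<epsilon>
    using \<open>1 \<le> m\<close> env_law stat \<open>ergodic P\<close> \<open>0 < \<epsilon>\<close> ell assms(7)
    by (intro ergodic_env.intro ergodic_env_axioms.intro) auto
  obtain \<sigma> where \<sigma>: "0 < \<sigma>" "AE \<omega> in P. centered_walk m \<omega> \<epsilon> \<and>
     (\<lambda>n. \<integral>\<xi>. \<bar>total_var m \<omega> \<xi> n - \<sigma>\<^sup>2 * real n\<bar> \<partial>walk_law \<omega>) \<in> o(\<lambda>n. real n)"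
    using quenched_variance by blast
  show ?thesis
  proof (intro conjI allI impI exI[of _ \<sigma>] \<sigma>(1))
    fix \<omega> :: env assume "\<forall>x. \<omega> x \<in> vector_support P"
    then show "weak_conv_at_top
        (\<lambda>t. distr (walk_law \<omega>) borel (\<lambda>\<xi>. real_of_int (\<xi> (var_time m \<omega> \<xi> t)) / sqrt t))
        std_normal_distribution"
      by (intro centered_walk.clt_var_time[OF centered_walk_if_in_support]) blast
  next
    show "AE \<omega> in P. uniform_limit UNIV
            (\<lambda>(t::nat) x. measure (walk_law \<omega>)
               {\<xi> \<in> space (walk_law \<omega>). real_of_int (\<xi> t) / sqrt (real t) \<le> x})
            (\<lambda>x. 1 / (sqrt (2 * pi) * \<sigma>) * (LBINT u:{..x}. exp (- u\<^sup>2 / (2 * \<sigma>\<^sup>2))))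
            sequentially"
      using \<sigma>(2) by eventually_elim (rule centered_walk.clt_fixed_time[OF _ \<sigma>(1)], blast+)
  qed
qed

end
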